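(* Let $\lambda,\mu\in\mathbb{C}$ with $\mu-\lambda\notin\{0,\tfrac12,1,\tfrac32,2\}$. Then: (i) The space $\mathcal{D}^{2}_{\lambda\mu}$ of $2$-differential operators from $\mathcal{F}_\lambda$ to $\mathcal{F}_\mu$ and the corresponding space of symbols $\operatorname{gr}\mathcal{D}^2_{\lambda\mu}=\bigoplus_{i=0}^{4}\operatorname{gr}^{i/2}\mathcal{D}_{\lambda\mu}$ are isomorphic as $\mathrm{osp}(2|2)$-modules. (ii) This isomorphism is unique: there is exactly one $\mathrm{osp}(2|2)$-equivariant quantization map $Q:\operatorname{gr}\mathcal{D}^2_{\lambda\mu}\to\mathcal{D}^2_{\lambda\mu}$.
   Context: Functions on the supercircle $S^{1|2}$: $C^\infty(S^{1|2})$ consists of $f=f_0(x)+\xi_1f_1(x)+\xi_2f_2(x)+\xi_1\xi_2f_{12}(x)$ with $f_0,f_1,f_2,f_{12}$ smooth complex-valued functions on the circle and $\xi_1,\xi_2$ odd Grassmann variables ($\xi_i^2=0$, $\xi_1\xi_2=-\xi_2\xi_1$); parity $p(x)=0$, $p(\xi_i)=1$; $f'=\partial_x f$. Set $\overline{D}_i=\partial_{\xi_i}-\xi_i\partial_x$ ($i=1,2$), so $\overline D_i^2=-\partial_x$. For homogeneous $f$ the contact vector field is $X_f=f\partial_x-(-1)^{p(f)}\tfrac12\big(\overline D_1(f)\overline D_1+\overline D_2(f)\overline D_2\big)$; these form the Lie superalgebra $\mathcal K(2)$. The subalgebra $\mathrm{osp}(2|2)\subset\mathcal K(2)$ is spanned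 by $X_f$ for $f\in\{1,x,x^2,\xi_1\xi_2,\xi_1,\xi_2,x\xi_1,x\xi_2\}$. For $\lambda\in\mathbb C$, $\mathcal F_\lambda$ denotes $C^\infty(S^{1|2})$ with $\mathcal K(2)$-action $L^\lambda_{X_f}=X_f+\lambda f'$ ($f'$ acting by multiplication). $\mathcal D_{\lambda\mu}$ is the space of linear differential operators $\mathcal F_\lambda\to\mathcal F_\mu$, with $\mathcal K(2)$-action $\mathcal L_{X_f}(A)=L^\mu_{X_f}\circ A-(-1)^{p(f)p(A)}A\circ L^\lambda_{X_f}$. Every $A\in\mathcal D_{\lambda\mu}$ is a finite sum $\sum a_{\ell,m,n}\partial_x^\ell\overline D_1^m\overline D_2^n$ with $a_{\ell,m,n}\in C^\infty(S^{1|2})$, $\ell\ge0$, $m,n\in\{0,1\}$. For $k\in\frac12\mathbb Z_{\ge0}$, $\mathcal D^k_{\lambda\mu}$ is the subspace of those $A$ with $a_{\ell,m,n}=0$ unless $\ell+\frac m2+\frac n2\le k$ (a $\mathcal K(2)$-invariant filtration); $\operatorname{gr}^k\mathcal D_{\lambda\mu}=\mathcal D^k_{\lambda\mu}/\mathcal D^{k-1/2}_{\lambda\mu}$ (with $\mathcal D^{-1/2}=0$), with the induced $\mathcal K(2)$-action, and the principal symbol $\sigma_{pr}:\mathcal D^k_{\lambda\mu}\to\operatorname{gr}^k\mathcal D_{\lambda\mu}$ is the projection. A quantization map $Q:\operatorname{gr}\mathcal D^2_{\lambda\mu}\to\mathcal D^2_{\lambda\mu}$ is a linear bijection (given by differential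 expressions) such that for each $k$ it maps $\operatorname{gr}^k$ into $\mathcal D^k_{\lambda\mu}$ with $\sigma_{pr}\circ Q=\mathrm{id}$ on $\operatorname{gr}^k$.
   Formalization: Functions are taken smooth on the line (superline R^{1|2}) instead of the supercircle, because x, x^2, xξ_i are not functions on the circle and the stated osp(2|2)-action (e.g. X_x sending 1 to (μ−λ)x) is not defined there. *)

theory Defs
  imports "HOL-Analysis.Analysis"
begin

section \<open>Superfunctions on the super line R^{1|2} (local model of S^{1|2})\<close>

text \<open>A superfunction f = f0 + xi1 f1 + xi2 f2 + xi1 xi2 f12 is encoded as
  f a b, where a (resp. b) says whether xi1 (resp. xi2) occurs:
  f False False = f0, f True False = f1, f False True = f2, f True True = f12.\<close>

type_synonym sfun = "bool \<Rightarrow> bool \<Rightarrow> real \<Rightarrow> complex"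

definition dr :: "(real \<Rightarrow> complex) \<Rightarrow> real \<Rightarrow> complex" where
  "dr u = (\<lambda>t. vector_derivative u (at t))"

definition smooth_fn :: "(real \<Rightarrow> complex) \<Rightarrow> bool" where
  "smooth_fn u \<longleftrightarrow> (\<forall>n t. ((dr ^^ n) u) differentiable (at t))"

definition smooth_sf :: "sfun \<Rightarrow> bool" where
  "smooth_sf f \<longleftrightarrow> (\<forall>a b. smooth_fn (f a b))"

definition szero :: sfun where "szero = (\<lambda>a b t. 0)"

definition sadd :: "sfun \<Rightarrow> sfun \<Rightarrow> sfun" where
  "sadd f g = (\<lambda>a b t. f a b t + g a b t)"

definition ssub :: "sfun \<Rightarrow> sfun \<Rightarrow> sfun" where
  "ssub f g = (\<lambda>a b t. f a b t - g a b t)"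

definition ssc :: "complex \<Rightarrow> sfun \<Rightarrow> sfun" where
  "ssc c f = (\<lambda>a b t. c * f a b t)"

text \<open>Supercommutative product (xi1^2 = xi2^2 = 0, xi1 xi2 = - xi2 xi1).\<close>
definition smul :: "sfun \<Rightarrow> sfun \<Rightarrow> sfun" where
  "smul f g = (\<lambda>a b t.
     if \<not> a \<and> \<not> b then f False False t * g False False t
     else if a \<and> \<not> b then f False False t * g True False t + f True False t * g False False t
     else if \<not> a \<and> b then f False False t * g False True t + f False True t * g False False t
     else f False False t * g True True t + f True True t * g False False t
          + f True False t * g False True t - f False True t * g True False t)"

definition xi1 :: sfun where "xi1 = (\<lambda>a b t. if a \<and> \<not> b then 1 else 0)"
definition xi2 :: sfun where "xi2 = (\<lambda>a b t. if \<not> a \<and> b then 1 else 0)"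

text \<open>Partial derivatives: d/dx, and the left derivatives d/dxi1, d/dxi2.\<close>
definition sdx :: "sfun \<Rightarrow> sfun" where
  "sdx f = (\<lambda>a b. dr (f a b))"

definition dxi1 :: "sfun \<Rightarrow> sfun" where
  "dxi1 f = (\<lambda>a b t. if a then 0 else f True b t)"

definition dxi2 :: "sfun \<Rightarrow> sfun" where
  "dxi2 f = (\<lambda>a b t. if b then 0 else (if a then - f True True t else f False True t))"

definition Dbar1 :: "sfun \<Rightarrow> sfun" where
  "Dbar1 f = ssub (dxi1 f) (smul xi1 (sdx f))"

definition Dbar2 :: "sfun \<Rightarrow> sfun" where
  "Dbar2 f = ssub (dxi2 f) (smul xi2 (sdx f))"

definition peven :: "sfun \<Rightarrow> sfun" where
  "peven f = (\<lambda>a b t. if a = b then f a b t else 0)"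

definition podd :: "sfun \<Rightarrow> sfun" where
  "podd f = (\<lambda>a b t. if a = b then 0 else f a b t)"

definition is_even :: "sfun \<Rightarrow> bool" where "is_even f \<longleftrightarrow> f = peven f"
definition is_odd :: "sfun \<Rightarrow> bool" where "is_odd f \<longleftrightarrow> f = podd f"

text \<open>X_f g = f g' - (-1)^{p(f)} 1/2 (Dbar1 f Dbar1 g + Dbar2 f Dbar2 g), f homogeneous.\<close>
definition Xc :: "sfun \<Rightarrow> sfun \<Rightarrow> sfun" where
  "Xc f g = ssub (smul f (sdx g))
     (ssc ((if is_odd f then -1 else 1) / 2)
        (sadd (smul (Dbar1 f) (Dbar1 g)) (smul (Dbar2 f) (Dbar2 g))))"

definition Lden :: "complex \<Rightarrow> sfun \<Rightarrow> sfun \<Rightarrow> sfun" where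
  "Lden lam f g = sadd (Xc f g) (ssc lam (smul (sdx f) g))"

definition osp22 :: "sfun set" where
  "osp22 = {f. \<exists>c :: nat \<Rightarrow> complex. f = (\<lambda>a b t.
      if \<not> a \<and> \<not> b then c 0 + c 1 * complex_of_real t + c 2 * (complex_of_real t)^2
      else if a \<and> \<not> b then c 4 + c 5 * complex_of_real t
      else if \<not> a \<and> b then c 6 + c 7 * complex_of_real t
      else c 3)}"

text \<open>A differential operator sum a_{l,m,n} d_x^l Dbar1^m Dbar2^n is given by its
  coefficient family A l m n (m, n in {0,1} encoded as booleans).\<close>
type_synonym dop = "nat \<Rightarrow> bool \<Rightarrow> bool \<Rightarrow> sfun"

definition Dpow :: "bool \<Rightarrow> (sfun \<Rightarrow> sfun) \<Rightarrow> sfun \<Rightarrow> sfun" where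
  "Dpow m h = (if m then h else id)"

definition dsupp :: "dop \<Rightarrow> nat set" where
  "dsupp A = {l. \<exists>m n. A l m n \<noteq> szero}"

definition valid_dop :: "dop \<Rightarrow> bool" where
  "valid_dop A \<longleftrightarrow> finite (dsupp A) \<and> (\<forall>l m n. smooth_sf (A l m n))"

definition dapply :: "dop \<Rightarrow> sfun \<Rightarrow> sfun" where
  "dapply A g = (\<lambda>a b t. \<Sum>l\<in>dsupp A. \<Sum>m\<in>UNIV. \<Sum>n\<in>UNIV.
      smul (A l m n) ((sdx ^^ l) (Dpow m Dbar1 (Dpow n Dbar2 g))) a b t)"

definition dzero :: dop where "dzero = (\<lambda>l m n. szero)"

definition dadd :: "dop \<Rightarrow> dop \<Rightarrow> dop" where
  "dadd A B = (\<lambda>l m n. sadd (A l m n) (B l m n))"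

definition dsc :: "complex \<Rightarrow> dop \<Rightarrow> dop" where
  "dsc c A = (\<lambda>l m n. ssc c (A l m n))"

text \<open>Twice the order of d_x^l Dbar1^m Dbar2^n, i.e. 2(l + m/2 + n/2).\<close>
definition wt :: "nat \<Rightarrow> bool \<Rightarrow> bool \<Rightarrow> nat" where
  "wt l m n = 2 * l + (if m then 1 else 0) + (if n then 1 else 0)"

text \<open>Filtration: Dk K is D^{K/2}_{lambda mu}.\<close>
definition filt :: "nat \<Rightarrow> dop \<Rightarrow> bool" where
  "filt K A \<longleftrightarrow> (\<forall>l m n. K < wt l m n \<longrightarrow> A l m n = szero)"

definition Dk :: "nat \<Rightarrow> dop set" where
  "Dk K = {A. valid_dop A \<and> filt K A}"

text \<open>Part of exact (doubled) order K: the principal-symbol projection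
  D^{K/2} -> gr^{K/2}, identifying gr^{K/2} = D^{K/2}/D^{(K-1)/2} with the
  operators all of whose terms have order exactly K/2.\<close>
definition top :: "nat \<Rightarrow> dop \<Rightarrow> dop" where
  "top K A = (\<lambda>l m n. if wt l m n = K then A l m n else szero)"

definition opE :: "(sfun \<Rightarrow> sfun) \<Rightarrow> sfun \<Rightarrow> sfun" where
  "opE A h = sadd (peven (A (peven h))) (podd (A (podd h)))"

definition opO :: "(sfun \<Rightarrow> sfun) \<Rightarrow> sfun \<Rightarrow> sfun" where
  "opO A h = sadd (podd (A (peven h))) (peven (A (podd h)))"

text \<open>L_{X_f}(A) = L^mu_{X_f} o A - (-1)^{p(f)p(A)} A o L^lambda_{X_f}, as a map.\<close>
definition act_map :: "complex \<Rightarrow> complex \<Rightarrow> sfun \<Rightarrow> (sfun \<Rightarrow> sfun) \<Rightarrow> sfun \<Rightarrow> sfun" where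
  "act_map lam mu f A g =
     ssub (Lden mu f (A g))
       (if is_odd f then ssub (opE A (Lden lam f g)) (opO A (Lden lam f g))
        else A (Lden lam f g))"

definition dact :: "complex \<Rightarrow> complex \<Rightarrow> sfun \<Rightarrow> dop \<Rightarrow> dop" where
  "dact lam mu f A = (THE B. valid_dop B \<and>
      (\<forall>g. smooth_sf g \<longrightarrow> dapply B g = act_map lam mu f (dapply A) g))"

definition gract :: "complex \<Rightarrow> complex \<Rightarrow> sfun \<Rightarrow> dop \<Rightarrow> dop" where
  "gract lam mu f S = (\<lambda>l m n a b t.
      \<Sum>K\<le>4. top K (dact lam mu f (top K S)) l m n a b t)"

definition lin_on :: "dop set \<Rightarrow> (dop \<Rightarrow> dop) \<Rightarrow> bool" where
  "lin_on S Q \<longleftrightarrow> (\<forall>A\<in>S. \<forall>B\<in>S. Q (dadd A B) = dadd (Q A) (Q B)) \<and>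
                   (\<forall>c. \<forall>A\<in>S. Q (dsc c A) = dsc c (Q A))"

definition diff_expr :: "(dop \<Rightarrow> dop) \<Rightarrow> bool" where
  "diff_expr Q \<longleftrightarrow> (\<exists>P :: nat \<Rightarrow> bool \<Rightarrow> bool \<Rightarrow> nat \<Rightarrow> bool \<Rightarrow> bool \<Rightarrow> dop.
     (\<forall>l m n l' m' n'. valid_dop (P l m n l' m' n')) \<and>
     (\<forall>S\<in>Dk 4. \<forall>l m n. Q S l m n = (\<lambda>a b t.
         \<Sum>l'\<le>2. \<Sum>m'\<in>UNIV. \<Sum>n'\<in>UNIV. dapply (P l m n l' m' n') (S l' m' n') a b t)))"

definition quantization :: "(dop \<Rightarrow> dop) \<Rightarrow> bool" where
  "quantization Q \<longleftrightarrow>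
     bij_betw Q (Dk 4) (Dk 4) \<and> lin_on (Dk 4) Q \<and> diff_expr Q \<and>
     (\<forall>K\<le>4. \<forall>S\<in>Dk 4. top K S = S \<longrightarrow> Q S \<in> Dk K \<and> top K (Q S) = S)"

definition equivariant :: "complex \<Rightarrow> complex \<Rightarrow> (dop \<Rightarrow> dop) \<Rightarrow> bool" where
  "equivariant lam mu Q \<longleftrightarrow>
     (\<forall>f\<in>osp22. (is_even f \<or> is_odd f) \<longrightarrow>
        (\<forall>S\<in>Dk 4. Q (gract lam mu f S) = dact lam mu f (Q S)))"

definition module_iso :: "complex \<Rightarrow> complex \<Rightarrow> (dop \<Rightarrow> dop) \<Rightarrow> bool" where
  "module_iso lam mu Phi \<longleftrightarrow>
     bij_betw Phi (Dk 4) (Dk 4) \<and> lin_on (Dk 4) Phi \<and> equivariant lam mu Phi"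

end

theory Submission
  imports Defs
begin

text \<open>
  In coordinates, an operator of order at most two is a tuple of nine superfunctions. Writing
  \<open>E\<^sub>i a = D\<^sub>i (star a)\<close> with the parity involution \<open>star\<close>, the commutators of \<open>E\<^sub>i\<close> with the
  Lie derivative and with multiplication by the derivatives of \<open>F\<close> have the same form for even and for
  odd \<open>F\<close>. Equivariance of a triangular map with constant coefficients in \<open>E\<^sub>1\<close>, \<open>E\<^sub>2\<close> thereby becomes
  a finite linear system for these coefficients, whose solution has denominators vanishing only
  at resonances.

  For uniqueness, the difference of two equivariant quantization maps strictly lowers the order. By
  locality, the top part of such a map at a point \<open>t0\<close> is given by functionals on the jets at \<open>t0\<close>, and
  these are determined by their values on monomials. The Euler field \<open>x - t0\<close> leaves only the
  monomials of one weight, at most two for each component, and equivariance under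
  \<open>(x - t0) \<xi>\<^sub>i\<close> kills these outside the resonances. The fields \<open>\<xi>\<^sub>i\<close> then transport the vanishing
  from the body component to all other components.
\<close>

section \<open>Smooth functions and their derivatives\<close>

text \<open>A competing quantization map is only known to be given by differential expressions, with
  arbitrary smooth coefficients and of unknown order. It cannot be fitted to a finite ansatz, so
  uniqueness is argued on functionals at a point, where the order need only be finite. For fields
  centred at \<open>t0\<close> the target side of the equivariance equation collapses to a multiple
  of the coefficient at \<open>t0\<close>. What remains is a condition on one functional, or on two
  functionals coupled by the rotation D1 D2 F, which exchanges the components of D1 and D2 at the
  orders 1/2 and 3/2. Write d for mu - lambda. For a symbol of order K/2 and a coefficient of lower
  order, the condition can fail only for d in {0, 1} if K = 1, {1/2, 1} if K = 2, {1/2, 1, 3/2, 2}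
  if K = 3, and {1, 3/2, 2} if K = 4. The union is the excluded set. The same five values are the
  zeros of d, 2d - 1, d - 1, 2d - 3 and d - 2, the factors in the denominators of the explicit
  map.\<close>

lemma smooth_fn_imp_differentiable: "smooth_fn u \<Longrightarrow> u differentiable (at t)"
  unfolding smooth_fn_def by (metis funpow_0)

lemma smooth_fn_dr [simp, intro]: "smooth_fn u \<Longrightarrow> smooth_fn (dr u)"
  unfolding smooth_fn_def by (metis comp_apply funpow_Suc_right)

lemma smooth_fn_has_vector_derivative:
  "smooth_fn u \<Longrightarrow> (u has_vector_derivative dr u t) (at t)"
  unfolding dr_def using smooth_fn_imp_differentiable vector_derivative_works by blast

lemma dr_eqI: "(\<And>t. (u has_vector_derivative u' t) (at t)) \<Longrightarrow> dr u = u'"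
  unfolding dr_def by (auto intro!: ext vector_derivative_at)

lemma dr_const [simp]: "dr (\<lambda>t. c) = (\<lambda>t. 0)"
  by (rule dr_eqI) auto

lemma dr_of_real [simp]: "dr complex_of_real = (\<lambda>t. 1)"
proof (rule dr_eqI)
  fix t show "(complex_of_real has_vector_derivative 1) (at t)"
    using has_vector_derivative_of_real[of "\<lambda>x. x" 1 "at t"] by (simp add: o_def)
qed

lemma dr_add: "smooth_fn u \<Longrightarrow> smooth_fn v \<Longrightarrow> dr (\<lambda>t. u t + v
    t) = (\<lambda>t. dr u t + dr v t)"
  by (intro dr_eqI has_vector_derivative_add smooth_fn_has_vector_derivative)

text \<open>The product rule turns one product into two products of the same kind. Closure under
  products is therefore proved by induction on a finite order, for all pairs of factors at once;
  smoothness is the conjunction over all orders.\<close>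

definition diff_upto :: "nat \<Rightarrow> (real \<Rightarrow> complex) \<Rightarrow> bool" where
  "diff_upto n u \<longleftrightarrow> (\<forall>k\<le>n. \<forall>t. ((dr ^^ k) u) differentiable
      (at t))"

lemma diff_upto_Suc: "diff_upto (Suc n) u \<longleftrightarrow> (\<forall>t. u differentiable (at
    t)) \<and> diff_upto n (dr u)"
  unfolding diff_upto_def
proof safe
  fix t assume *: "\<forall>k\<le>Suc n. \<forall>t. (dr ^^ k) u differentiable at t"
  show "u differentiable at t" using *[rule_format, of 0 t] by simp
  fix k assume "k \<le> n"
  then show "(dr ^^ k) (dr u) differentiable at t" using *[rule_format, of "Suc k" t]
    by (simp add: funpow_Suc_right del: funpow.simps)
next
  fix k t assume "\<forall>t. u differentiable (at t)" "\<forall>k\<le>n. \<forall>t. (dr ^^ k) (dr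
      u) differentiable at t" "k \<le> Suc n"
  then show "(dr ^^ k) u differentiable at t"
    by (cases k) (auto simp: funpow_Suc_right simp del: funpow.simps(2))
qed

lemma diff_upto_0: "diff_upto 0 u \<longleftrightarrow> (\<forall>t. u differentiable (at t))"
  by (auto simp: diff_upto_def)

lemma diff_upto_SucD: "diff_upto (Suc n) u \<Longrightarrow> diff_upto n u"
  by (auto simp: diff_upto_def)

lemma differentiable_dr:
  "u differentiable (at t) \<Longrightarrow> (u has_vector_derivative dr u t) (at t)"
  unfolding dr_def using vector_derivative_works by blast

lemma diff_upto_add: "diff_upto n u \<Longrightarrow> diff_upto n v \<Longrightarrow> diff_upto n
    (\<lambda>t. u t + v t)"
proof (induction n arbitrary: u v)
  case 0 then show ?case by (auto simp: diff_upto_0)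
next
  case (Suc n)
  then have d: "u differentiable (at t)" "v differentiable (at t)" for t by (auto simp: diff_upto_Suc)
  have "dr (\<lambda>t. u t + v t) = (\<lambda>t. dr u t + dr v t)"
    by (intro dr_eqI has_vector_derivative_add differentiable_dr d)
  with Suc d show ?case by (simp add: diff_upto_Suc)
qed

lemma diff_upto_mult: "diff_upto n u \<Longrightarrow> diff_upto n v \<Longrightarrow> diff_upto n
    (\<lambda>t. u t * v t)"
proof (induction n arbitrary: u v)
  case 0 then show ?case by (auto simp: diff_upto_0)
next
  case (Suc n)
  then have d: "u differentiable (at t)" "v differentiable (at t)" for t by (auto simp: diff_upto_Suc)
  have "dr (\<lambda>t. u t * v t) = (\<lambda>t. u t * dr v t + dr u t * v t)"
    by (intro dr_eqI has_vector_derivative_mult differentiable_dr d)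
  moreover have "diff_upto n (\<lambda>t. u t * dr v t + dr u t * v t)"
    using Suc.prems diff_upto_SucD by (intro diff_upto_add Suc.IH) (auto simp: diff_upto_Suc)
  ultimately show ?case using d by (simp add: diff_upto_Suc)
qed

lemma smooth_fn_diff_upto: "smooth_fn u \<longleftrightarrow> (\<forall>n. diff_upto n u)"
  by (auto simp: smooth_fn_def diff_upto_def)

lemma smooth_fn_add [simp, intro]: "smooth_fn u \<Longrightarrow> smooth_fn v \<Longrightarrow>
    smooth_fn (\<lambda>t. u t + v t)"
  by (simp add: smooth_fn_diff_upto diff_upto_add)

lemma smooth_fn_mult [simp, intro]: "smooth_fn u \<Longrightarrow> smooth_fn v \<Longrightarrow>
    smooth_fn (\<lambda>t. u t * v t)"
  by (simp add: smooth_fn_diff_upto diff_upto_mult)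

lemma smooth_fn_const [simp, intro]: "smooth_fn (\<lambda>t. c)"
proof -
  have "(dr ^^ n) (\<lambda>t. c) = (\<lambda>t. if n = 0 then c else 0)" for n
    by (induction n) auto
  then show ?thesis by (auto simp: smooth_fn_def)
qed

lemma smooth_fn_of_real [simp, intro]: "smooth_fn complex_of_real"
proof -
  have "(dr ^^ Suc n) complex_of_real differentiable at t" for n t
    using smooth_fn_const[of 1] unfolding funpow_Suc_right o_apply dr_of_real smooth_fn_def by blast
  moreover have "complex_of_real differentiable at t" for t
    using has_vector_derivative_of_real[of "\<lambda>x. x" 1 "at t"] differentiableI_vector by
        (auto simp: o_def)
  ultimately show ?thesis unfolding smooth_fn_def
    by (metis funpow_0 not0_implies_Suc)
qed

lemma smooth_fn_uminus [simp, intro]: "smooth_fn u \<Longrightarrow> smooth_fn (\<lambda>t. - u t)"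
  using smooth_fn_mult[OF smooth_fn_const[of "-1"]] by simp

lemma smooth_fn_diff [simp, intro]: "smooth_fn u \<Longrightarrow> smooth_fn v \<Longrightarrow>
    smooth_fn (\<lambda>t. u t - v t)"
  using smooth_fn_add[OF _ smooth_fn_uminus, of u v] by simp

lemma dr_mult: "smooth_fn u \<Longrightarrow> smooth_fn v \<Longrightarrow> dr (\<lambda>t. u t * v
    t) = (\<lambda>t. dr u t * v t + u t * dr v t)"
  by (rule dr_eqI) (auto intro!: derivative_eq_intros smooth_fn_has_vector_derivative simp:
      algebra_simps)

lemma dr_cmult: "smooth_fn u \<Longrightarrow> dr (\<lambda>t. c * u t) = (\<lambda>t. c * dr u t)"
  by (simp add: dr_mult)

lemma dr_uminus: "smooth_fn u \<Longrightarrow> dr (\<lambda>t. - u t) = (\<lambda>t. - dr u t)"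
  using dr_cmult[of u "-1"] by simp

lemma dr_diff: "smooth_fn u \<Longrightarrow> smooth_fn v \<Longrightarrow> dr (\<lambda>t. u t - v
    t) = (\<lambda>t. dr u t - dr v t)"
  using dr_add[of u "\<lambda>t. - v t"] by (simp add: dr_uminus)

lemmas dr_simps = dr_add dr_mult dr_uminus dr_diff

lemma sfun_eq_iff: "f = (g :: sfun) \<longleftrightarrow>
   f False False = g False False \<and> f True False = g True False \<and>
   f False True = g False True \<and> f True True = g True True"
  unfolding fun_eq_iff[of f] fun_eq_iff[of "f a" for a] all_bool_eq by blast

lemma smooth_sf_iff: "smooth_sf f \<longleftrightarrow> smooth_fn (f False False) \<and> smooth_fn
    (f True False) \<and>
   smooth_fn (f False True) \<and> smooth_fn (f True True)"
  unfolding smooth_sf_def all_bool_eq by blast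

lemmas sfun_defs = szero_def sadd_def ssub_def ssc_def smul_def xi1_def xi2_def sdx_def
  dxi1_def dxi2_def Dbar1_def Dbar2_def peven_def podd_def

definition sone :: sfun where "sone = (\<lambda>a b t. if a \<or> b then 0 else 1)"
definition sstar :: "sfun \<Rightarrow> sfun" where
  "sstar f = (\<lambda>a b t. if a = b then f a b t else - f a b t)"

section \<open>The ring of smooth superfunctions\<close>

text \<open>Bundling smoothness into a type makes the Leibniz rules unconditional and gives access
  to the simplification rules of a noncommutative ring.\<close>

typedef ssf = "{f. smooth_sf f}" morphisms rep ab
  by (rule exI[of _ szero]) (simp add: smooth_sf_iff szero_def)

setup_lifting type_definition_ssf

instantiation ssf :: ring_1
begin

lift_definition zero_ssf :: ssf is szero by (simp add: smooth_sf_iff szero_def)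
lift_definition one_ssf :: ssf is sone by (simp add: smooth_sf_iff sone_def)
lift_definition plus_ssf :: "ssf \<Rightarrow> ssf \<Rightarrow> ssf" is sadd by (simp add:
    smooth_sf_iff sadd_def)
lift_definition minus_ssf :: "ssf \<Rightarrow> ssf \<Rightarrow> ssf" is ssub by (simp add:
    smooth_sf_iff ssub_def)
lift_definition times_ssf :: "ssf \<Rightarrow> ssf \<Rightarrow> ssf" is smul by (simp add:
    smooth_sf_iff smul_def)
lift_definition uminus_ssf :: "ssf \<Rightarrow> ssf" is "\<lambda>f. ssub szero f"
  by (simp add: smooth_sf_iff ssub_def szero_def)

instance
proof
  fix a b c :: ssf
  show "a * b * c = a * (b * c)" by transfer (simp only: sfun_eq_iff fun_eq_iff smul_def, intro
      conjI allI, simp_all add: algebra_simps)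
  show "(a + b) * c = a * c + b * c"
    by transfer (simp only: sfun_eq_iff fun_eq_iff smul_def sadd_def, intro conjI allI, simp_all
        add: algebra_simps)
  show "a * (b + c) = a * b + a * c"
    by transfer (simp only: sfun_eq_iff fun_eq_iff smul_def sadd_def, intro conjI allI, simp_all
        add: algebra_simps)
  show "1 * a = a" by transfer (simp add: sfun_eq_iff smul_def sone_def)
  show "a * 1 = a" by transfer (simp add: sfun_eq_iff smul_def sone_def)
  show "a + b + c = a + (b + c)" "a + b = b + a" "0 + a = a" "- a + a = 0" "a - b = a + - b"
    by (transfer; simp add: sfun_eq_iff fun_eq_iff sadd_def ssub_def szero_def)+
  show "(0::ssf) \<noteq> 1" by transfer (simp add: sfun_eq_iff szero_def sone_def fun_eq_iff)
qed

end

section \<open>Operations on superfunctions and their Leibniz rules\<close>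

lift_definition sc :: "complex \<Rightarrow> ssf \<Rightarrow> ssf" is ssc by (simp add:
    smooth_sf_iff ssc_def)
lift_definition star :: "ssf \<Rightarrow> ssf" is sstar by (simp add: smooth_sf_iff sstar_def)
lift_definition dx :: "ssf \<Rightarrow> ssf" is sdx by (simp add: smooth_sf_iff sdx_def)
lift_definition D1 :: "ssf \<Rightarrow> ssf" is Dbar1 by (simp add: smooth_sf_iff sfun_defs)
lift_definition D2 :: "ssf \<Rightarrow> ssf" is Dbar2 by (simp add: smooth_sf_iff sfun_defs)
lift_definition X1 :: ssf is xi1 by (simp add: smooth_sf_iff sfun_defs)
lift_definition X2 :: ssf is xi2 by (simp add: smooth_sf_iff sfun_defs)

lemmas component_defs = sfun_eq_iff fun_eq_iff smooth_sf_iff sfun_defs sstar_def sone_def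

lemma sc_add: "sc c (a + b) = sc c a + sc c b" by transfer (simp add: component_defs algebra_simps)
lemma sc_diff: "sc c (a - b) = sc c a - sc c b" by transfer (simp add: component_defs algebra_simps)
lemma sc_uminus: "sc c (- a) = - sc c a" by transfer (simp add: component_defs algebra_simps)
lemma sc_0 [simp]: "sc c 0 = 0" by transfer (simp add: component_defs algebra_simps)
lemma sc_zero [simp]: "sc 0 a = 0" by transfer (simp add: component_defs algebra_simps)
lemma sc_1 [simp]: "sc 1 a = a" by transfer (simp add: component_defs algebra_simps)
lemma sc_m1 [simp]: "sc (- 1) a = - a" by transfer (simp add: component_defs algebra_simps)
lemma sc_sc [simp]: "sc c (sc e a) = sc (c * e) a" by transfer (simp add: component_defs algebra_simps)
lemma sc_mult_left [simp]: "sc c a * b = sc c (a * b)" by transfer (simp add: component_defs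
    algebra_simps)
lemma sc_mult_right [simp]: "a * sc c b = sc c (a * b)" by transfer (simp add: component_defs
    algebra_simps)

lemma star_add: "star (a + b) = star a + star b" by transfer (simp add: component_defs)
lemma star_diff: "star (a - b) = star a - star b" by transfer (simp add: component_defs)
lemma star_uminus: "star (- a) = - star a" by transfer (simp add: component_defs)
lemma star_0: "star 0 = 0" by transfer (simp add: component_defs)
lemma star_sc: "star (sc c a) = sc c (star a)" by transfer (simp add: component_defs)
lemma star_mult: "star (a * b) = star a * star b" by transfer (simp add: component_defs)
lemma star_star: "star (star a) = a" by transfer (simp add: component_defs)

lemma dx_add: "dx (a + b) = dx a + dx b" by transfer (simp add: component_defs dr_simps)
lemma dx_diff: "dx (a - b) = dx a - dx b" by transfer (simp add: component_defs dr_simps)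
lemma dx_uminus: "dx (- a) = - dx a" by transfer (simp add: component_defs dr_simps)
lemma dx_0: "dx 0 = 0" by transfer (simp add: component_defs dr_simps)
lemma dx_sc: "dx (sc c a) = sc c (dx a)" by transfer (simp add: component_defs dr_simps)
lemma dx_mult: "dx (a * b) = dx a * b + a * dx b" by transfer (simp add: component_defs dr_simps
    algebra_simps)
lemma dx_star: "dx (star a) = star (dx a)" by transfer (simp add: component_defs dr_simps)

lemma D1_add: "D1 (a + b) = D1 a + D1 b" by transfer (simp add: component_defs dr_simps algebra_simps)
lemma D1_diff: "D1 (a - b) = D1 a - D1 b" by transfer (simp add: component_defs dr_simps algebra_simps)
lemma D1_uminus: "D1 (- a) = - D1 a" by transfer (simp add: component_defs dr_simps algebra_simps)
lemma D1_0: "D1 0 = 0" by transfer (simp add: component_defs dr_simps)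
lemma D1_sc: "D1 (sc c a) = sc c (D1 a)" by transfer (simp add: component_defs dr_simps algebra_simps)
text \<open>The sign in the Leibniz rule of an odd derivation is carried by \<open>star\<close>, so
  the factors need not be homogeneous.\<close>

lemma D1_mult: "D1 (a * b) = D1 a * b + star a * D1 b" by transfer (simp add: component_defs
    dr_simps algebra_simps)
lemma D1_star: "D1 (star a) = - star (D1 a)" by transfer (simp add: component_defs dr_simps)
lemma D1_D1: "D1 (D1 a) = - dx a" by transfer (simp add: component_defs dr_simps)
lemma D1_dx: "D1 (dx a) = dx (D1 a)" by transfer (simp add: component_defs dr_simps)

lemma D2_add: "D2 (a + b) = D2 a + D2 b" by transfer (simp add: component_defs dr_simps algebra_simps)
lemma D2_diff: "D2 (a - b) = D2 a - D2 b" by transfer (simp add: component_defs dr_simps algebra_simps)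
lemma D2_uminus: "D2 (- a) = - D2 a" by transfer (simp add: component_defs dr_simps algebra_simps)
lemma D2_0: "D2 0 = 0" by transfer (simp add: component_defs dr_simps)
lemma D2_sc: "D2 (sc c a) = sc c (D2 a)" by transfer (simp add: component_defs dr_simps algebra_simps)
lemma D2_mult: "D2 (a * b) = D2 a * b + star a * D2 b" by transfer (simp add: component_defs
    dr_simps algebra_simps)
lemma D2_star: "D2 (star a) = - star (D2 a)" by transfer (simp add: component_defs dr_simps)
lemma D2_D2: "D2 (D2 a) = - dx a" by transfer (simp add: component_defs dr_simps)
lemma D2_dx: "D2 (dx a) = dx (D2 a)" by transfer (simp add: component_defs dr_simps)
lemma D2_D1: "D2 (D1 a) = - D1 (D2 a)" by transfer (simp add: component_defs dr_simps)

section \<open>Contact vector fields\<close>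

text \<open>Complex scalars act only through \<open>sc\<close>, so field arithmetic does not reach
  identities of superfunctions directly. Evaluation at points turns them into identities of complex
  numbers; the long computations below are closed this way.\<close>

lemma ssf_eq_iff: "a = b \<longleftrightarrow> (\<forall>p q t. rep a p q t = rep b p q t)"
  by (simp add: rep_inject[symmetric] fun_eq_iff)

lemma rep_arith:
  "rep (a + b) p q t = rep a p q t + rep b p q t"
  "rep (a - b) p q t = rep a p q t - rep b p q t"
  "rep (- a) p q t = - rep a p q t"
  "rep (sc c a) p q t = c * rep a p q t"
  "rep 0 p q t = 0"
  by (transfer; simp add: sadd_def ssub_def szero_def ssc_def)+

lemmas op_linear =
  sc_add sc_diff sc_uminus
  star_add star_diff star_uminus star_0 star_sc star_mult star_star
  dx_add dx_diff dx_uminus dx_0 dx_sc dx_star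
  D1_add D1_diff D1_uminus D1_0 D1_sc D1_star D1_D1 D1_dx
  D2_add D2_diff D2_uminus D2_0 D2_sc D2_star D2_D2 D2_dx D2_D1
  distrib_left distrib_right left_diff_distrib right_diff_distrib

lemmas op_leibniz = dx_mult D1_mult D2_mult

lemma smooth_sf_closed:
  assumes "smooth_sf f" "smooth_sf g"
  shows "smooth_sf (sadd f g)" "smooth_sf (ssub f g)" "smooth_sf (smul f g)" "smooth_sf (ssc c f)"
    "smooth_sf (sdx f)" "smooth_sf (Dbar1 f)" "smooth_sf (Dbar2 f)"
  using assms by (simp_all add: smooth_sf_iff sfun_defs)

lift_definition Lie :: "complex \<Rightarrow> ssf \<Rightarrow> ssf \<Rightarrow> ssf" is Lden
  by (simp add: Lden_def Xc_def smooth_sf_closed)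

lemma is_odd_rep: "is_odd (rep F) \<longleftrightarrow> star F = - F"
  unfolding is_odd_def by transfer (auto simp add: component_defs)

lemma is_even_rep: "is_even (rep F) \<longleftrightarrow> star F = F"
  unfolding is_even_def by transfer (auto simp add: component_defs)

lemma Lden_zero: "Lden w szero g = szero"
  by (simp add: Lden_def Xc_def component_defs)

lemma Lie_odd: "star F = - F \<Longrightarrow>
  Lie w F a = F * dx a + sc (1/2) (D1 F * D1 a + D2 F * D2 a) + sc w (dx F * a)"
proof -
  assume "star F = - F"
  then have "is_odd (rep F)" by (simp add: is_odd_rep)
  then show ?thesis
    by transfer (simp only: Lden_def Xc_def if_True fun_eq_iff ssub_def sadd_def ssc_def, simp)
qed

text \<open>The zero function is both even and odd, and \<open>Xc\<close> gives it the odd sign. It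
  is split off because for F = 0 the test in \<open>Xc\<close> selects the other branch, where all
  terms vanish.\<close>

lemma Lie_even: "star F = F \<Longrightarrow>
  Lie w F a = F * dx a - sc (1/2) (D1 F * D1 a + D2 F * D2 a) + sc w (dx F * a)"
proof (cases "F = 0")
  case True
  then show ?thesis by transfer (simp add: Lden_zero dx_0 D1_0 D2_0, simp add: component_defs)
next
  assume "star F = F"
  case False
  have "\<not> is_odd (rep F)"
  proof
    assume "is_odd (rep F)"
    with \<open>star F = F\<close> have "F = - F" by (simp add: is_odd_rep)
    then have "F = 0" by (simp add: ssf_eq_iff rep_arith)
    with False show False by simp
  qed
  then show ?thesis
    by transfer (simp only: Lden_def Xc_def if_False fun_eq_iff ssub_def sadd_def ssc_def, simp)
qed

section \<open>Supercommutation with homogeneous factors\<close>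

lemma even_comm:
  assumes "star F = F" shows "a * F = F * a"
  using assms by transfer (auto simp add: component_defs algebra_simps)

lemma odd_comm:
  assumes "star F = - F" shows "a * F = F * star a"
  using assms by transfer (auto simp add: component_defs algebra_simps)

text \<open>Companion of the supercommutation rules for right-nested products, so that rewriting can
  sort all factors built from F to the front.\<close>

lemma mult_comm_left: "a * F = F * b \<Longrightarrow> a * (F * c) = F * (b * (c::ssf))"
  by (metis mult.assoc)

lemma star_D: "star (D1 a) = - D1 (star a)" "star (D2 a) = - D2 (star a)" "star (dx a) = dx (star a)"
  by (simp_all add: D1_star D2_star dx_star)

lemmas D_uminus = dx_uminus D1_uminus D2_uminus

text \<open>In components the conditions read f0''' = 0, f1'' = f2'' = 0 and f12' = 0, which for a
  smooth superfunction is membership in osp(2|2). In this form they serve as rewrite rules that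
  truncate every commutator.\<close>

definition osp_sf :: "ssf \<Rightarrow> bool" where
  "osp_sf F \<longleftrightarrow> D1 (dx (dx F)) = 0 \<and> D2 (dx (dx F)) = 0 \<and> D1 (D2 (dx
      F)) = 0"

section \<open>Commutators of even fields with the monomials of order at most two\<close>

context
  fixes F :: ssf
  assumes ev: "star F = F" and osp: "osp_sf F"
begin

lemma ev_star: "star F = F" "star (dx F) = dx F" "star (dx (dx F)) = dx (dx F)"
  "star (D1 F) = - D1 F" "star (D2 F) = - D2 F" "star (D1 (D2 F)) = D1 (D2 F)"
  "star (dx (D1 F)) = - dx (D1 F)" "star (dx (D2 F)) = - dx (D2 F)"
  by (simp_all add: ev star_D D_uminus)

lemma ev_osp: "dx (dx (D1 F)) = 0" "dx (dx (D2 F)) = 0" "dx (D1 (D2 F)) = 0" "dx (dx (dx F)) = 0"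
  using osp D1_D1[of "dx (dx F)"] by (simp_all add: osp_sf_def op_linear)

lemma ev_comm:
  "a * F = F * a" "a * dx F = dx F * a" "a * dx (dx F) = dx (dx F) * a"
  "a * D1 F = D1 F * star a" "a * D2 F = D2 F * star a" "a * D1 (D2 F) = D1 (D2 F) * a"
  "a * dx (D1 F) = dx (D1 F) * star a" "a * dx (D2 F) = dx (D2 F) * star a"
  by (intro even_comm odd_comm; simp add: ev_star)+

lemmas ev_comms = ev_comm ev_comm[THEN mult_comm_left]

text \<open>Each of the nine formulas expands a commutator in the basis dx^l D1^m D2^n. The leading
  term is the Lie derivative of the coefficient, its weight mu - lambda lowered by the order of the
  monomial. A term with D1 D2 F rotates D1 into D2 and keeps the order, a term with D_i F' lowers it
  by 1/2, and one with F'' by 1. The dependence on \<open>lam\<close> arises where the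
  multiplication by \<open>lam\<close> F' is differentiated.\<close>

lemma ev_000:
 "Lie mu F (a * g) - a * (Lie lam F g) =
  Lie (mu - lam - 0) F a * g"
  by (simp add: Lie_even[OF ev] op_linear op_leibniz ev_star ev_osp mult.assoc ev_comms[of a],
      simp add: ssf_eq_iff rep_arith, simp add: field_simps)

lemma ev_010:
 "Lie mu F (a * (D1 g)) - a * (D1 (Lie lam F g)) =
  Lie (mu - lam - 1/2) F a * (D1 g)
  + sc (1/2) (D1 (D2 F) * a) * (D2 g)
  + sc (lam) (star (D1 (dx F) * a)) * g"
  by (simp add: Lie_even[OF ev] op_linear op_leibniz ev_star ev_osp mult.assoc ev_comms[of a],
      simp add: ssf_eq_iff rep_arith, simp add: field_simps)

lemma ev_001:
 "Lie mu F (a * (D2 g)) - a * (D2 (Lie lam F g)) =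
  Lie (mu - lam - 1/2) F a * (D2 g)
  + sc (-1/2) (D1 (D2 F) * a) * (D1 g)
  + sc (lam) (star (D2 (dx F) * a)) * g"
  by (simp add: Lie_even[OF ev] op_linear op_leibniz ev_star ev_osp mult.assoc ev_comms[of a],
      simp add: ssf_eq_iff rep_arith, simp add: field_simps)

lemma ev_100:
 "Lie mu F (a * (dx g)) - a * (dx (Lie lam F g)) =
  Lie (mu - lam - 1) F a * (dx g)
  + sc (-1/2) (star (D1 (dx F) * a)) * (D1 g)
  + sc (-1/2) (star (D2 (dx F) * a)) * (D2 g)
  + sc (-lam) (dx (dx F) * a) * g"
  by (simp add: Lie_even[OF ev] op_linear op_leibniz ev_star ev_osp mult.assoc ev_comms[of a],
      simp add: ssf_eq_iff rep_arith, simp add: field_simps)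

lemma ev_011:
 "Lie mu F (a * (D1 (D2 g))) - a * (D1 (D2 (Lie lam F g))) =
  Lie (mu - lam - 1) F a * (D1 (D2 g))
  + sc (-(lam+1/2)) (star (D2 (dx F) * a)) * (D1 g)
  + sc (lam+1/2) (star (D1 (dx F) * a)) * (D2 g)"
  by (simp add: Lie_even[OF ev] op_linear op_leibniz ev_star ev_osp mult.assoc ev_comms[of a],
      simp add: ssf_eq_iff rep_arith, simp add: field_simps)

lemma ev_110:
 "Lie mu F (a * (dx (D1 g))) - a * (dx (D1 (Lie lam F g))) =
  Lie (mu - lam - 3/2) F a * (dx (D1 g))
  + sc (1/2) (D1 (D2 F) * a) * (dx (D2 g))
  + sc (lam+1/2) (star (D1 (dx F) * a)) * (dx g)
  + sc (1/2) (star (D2 (dx F) * a)) * (D1 (D2 g))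
  + sc (-(lam+1/2)) (dx (dx F) * a) * (D1 g)"
  by (simp add: Lie_even[OF ev] op_linear op_leibniz ev_star ev_osp mult.assoc ev_comms[of a],
      simp add: ssf_eq_iff rep_arith, simp add: field_simps)

lemma ev_101:
 "Lie mu F (a * (dx (D2 g))) - a * (dx (D2 (Lie lam F g))) =
  Lie (mu - lam - 3/2) F a * (dx (D2 g))
  + sc (-1/2) (D1 (D2 F) * a) * (dx (D1 g))
  + sc (lam+1/2) (star (D2 (dx F) * a)) * (dx g)
  + sc (-1/2) (star (D1 (dx F) * a)) * (D1 (D2 g))
  + sc (-(lam+1/2)) (dx (dx F) * a) * (D2 g)"
  by (simp add: Lie_even[OF ev] op_linear op_leibniz ev_star ev_osp mult.assoc ev_comms[of a],
      simp add: ssf_eq_iff rep_arith, simp add: field_simps)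

lemma ev_200:
 "Lie mu F (a * (dx (dx g))) - a * (dx (dx (Lie lam F g))) =
  Lie (mu - lam - 2) F a * (dx (dx g))
  + sc (-1) (star (D1 (dx F) * a)) * (dx (D1 g))
  + sc (-1) (star (D2 (dx F) * a)) * (dx (D2 g))
  + sc (-(2*lam+1)) (dx (dx F) * a) * (dx g)"
  by (simp add: Lie_even[OF ev] op_linear op_leibniz ev_star ev_osp mult.assoc ev_comms[of a],
      simp add: ssf_eq_iff rep_arith, simp add: field_simps)

lemma ev_111:
 "Lie mu F (a * (dx (D1 (D2 g)))) - a * (dx (D1 (D2 (Lie lam F g)))) =
  Lie (mu - lam - 2) F a * (dx (D1 (D2 g)))
  + sc (-(lam+1)) (star (D2 (dx F) * a)) * (dx (D1 g))
  + sc (lam+1) (star (D1 (dx F) * a)) * (dx (D2 g))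
  + sc (-(lam+1)) (dx (dx F) * a) * (D1 (D2 g))"
  by (simp add: Lie_even[OF ev] op_linear op_leibniz ev_star ev_osp mult.assoc ev_comms[of a],
      simp add: ssf_eq_iff rep_arith, simp add: field_simps)

end

section \<open>The same commutators for odd fields\<close>

context
  fixes F :: ssf
  assumes od: "star F = - F" and osp: "osp_sf F"
begin

lemma od_star: "star F = - F" "star (dx F) = - dx F" "star (dx (dx F)) = - dx (dx F)"
  "star (D1 F) = D1 F" "star (D2 F) = D2 F" "star (D1 (D2 F)) = - D1 (D2 F)"
  "star (dx (D1 F)) = dx (D1 F)" "star (dx (D2 F)) = dx (D2 F)"
  by (simp_all add: od star_D D_uminus)

lemma od_osp: "dx (dx (D1 F)) = 0" "dx (dx (D2 F)) = 0" "dx (D1 (D2 F)) = 0" "dx (dx (dx F)) = 0"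
  using osp D1_D1[of "dx (dx F)"] by (simp_all add: osp_sf_def op_linear)

lemma od_comm:
  "a * F = F * star a" "a * dx F = dx F * star a" "a * dx (dx F) = dx (dx F) * star a"
  "a * D1 F = D1 F * a" "a * D2 F = D2 F * a" "a * D1 (D2 F) = D1 (D2 F) * star a"
  "a * dx (D1 F) = dx (D1 F) * a" "a * dx (D2 F) = dx (D2 F) * a"
  by (intro even_comm odd_comm; simp add: od_star)+

lemmas od_comms = od_comm od_comm[THEN mult_comm_left]

text \<open>Conjugation by \<open>star\<close> multiplies an operator of parity p by (-1)^p, which
  is the sign that an odd field requires in the second term of the commutator. With this sign the
  right-hand sides agree with those for even fields.\<close>

lemma od_000:
 "Lie mu F (a * g) - star (a * (star (Lie lam F g))) =
  Lie (mu - lam - 0) F a * g"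
  by (simp add: Lie_odd[OF od] op_linear op_leibniz od_star od_osp mult.assoc od_comms[of a]
      od_comms[of "star a"],
      simp add: ssf_eq_iff rep_arith, simp add: field_simps)

lemma od_010:
 "Lie mu F (a * (D1 g)) - star (a * (D1 (star (Lie lam F g)))) =
  Lie (mu - lam - 1/2) F a * (D1 g)
  + sc (1/2) (D1 (D2 F) * a) * (D2 g)
  + sc (lam) (star (D1 (dx F) * a)) * g"
  by (simp add: Lie_odd[OF od] op_linear op_leibniz od_star od_osp mult.assoc od_comms[of a]
      od_comms[of "star a"],
      simp add: ssf_eq_iff rep_arith, simp add: field_simps)

lemma od_001:
 "Lie mu F (a * (D2 g)) - star (a * (D2 (star (Lie lam F g)))) =
  Lie (mu - lam - 1/2) F a * (D2 g)
  + sc (-1/2) (D1 (D2 F) * a) * (D1 g)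
  + sc (lam) (star (D2 (dx F) * a)) * g"
  by (simp add: Lie_odd[OF od] op_linear op_leibniz od_star od_osp mult.assoc od_comms[of a]
      od_comms[of "star a"],
      simp add: ssf_eq_iff rep_arith, simp add: field_simps)

lemma od_100:
 "Lie mu F (a * (dx g)) - star (a * (dx (star (Lie lam F g)))) =
  Lie (mu - lam - 1) F a * (dx g)
  + sc (-1/2) (star (D1 (dx F) * a)) * (D1 g)
  + sc (-1/2) (star (D2 (dx F) * a)) * (D2 g)
  + sc (-lam) (dx (dx F) * a) * g"
  by (simp add: Lie_odd[OF od] op_linear op_leibniz od_star od_osp mult.assoc od_comms[of a]
      od_comms[of "star a"],
      simp add: ssf_eq_iff rep_arith, simp add: field_simps)

lemma od_011:
 "Lie mu F (a * (D1 (D2 g))) - star (a * (D1 (D2 (star (Lie lam F g))))) =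
  Lie (mu - lam - 1) F a * (D1 (D2 g))
  + sc (-(lam+1/2)) (star (D2 (dx F) * a)) * (D1 g)
  + sc (lam+1/2) (star (D1 (dx F) * a)) * (D2 g)"
  by (simp add: Lie_odd[OF od] op_linear op_leibniz od_star od_osp mult.assoc od_comms[of a]
      od_comms[of "star a"],
      simp add: ssf_eq_iff rep_arith, simp add: field_simps)

lemma od_110:
 "Lie mu F (a * (dx (D1 g))) - star (a * (dx (D1 (star (Lie lam F g))))) =
  Lie (mu - lam - 3/2) F a * (dx (D1 g))
  + sc (1/2) (D1 (D2 F) * a) * (dx (D2 g))
  + sc (lam+1/2) (star (D1 (dx F) * a)) * (dx g)
  + sc (1/2) (star (D2 (dx F) * a)) * (D1 (D2 g))
  + sc (-(lam+1/2)) (dx (dx F) * a) * (D1 g)"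
  by (simp add: Lie_odd[OF od] op_linear op_leibniz od_star od_osp mult.assoc od_comms[of a]
      od_comms[of "star a"],
      simp add: ssf_eq_iff rep_arith, simp add: field_simps)

lemma od_101:
 "Lie mu F (a * (dx (D2 g))) - star (a * (dx (D2 (star (Lie lam F g))))) =
  Lie (mu - lam - 3/2) F a * (dx (D2 g))
  + sc (-1/2) (D1 (D2 F) * a) * (dx (D1 g))
  + sc (lam+1/2) (star (D2 (dx F) * a)) * (dx g)
  + sc (-1/2) (star (D1 (dx F) * a)) * (D1 (D2 g))
  + sc (-(lam+1/2)) (dx (dx F) * a) * (D2 g)"
  by (simp add: Lie_odd[OF od] op_linear op_leibniz od_star od_osp mult.assoc od_comms[of a]
      od_comms[of "star a"],
      simp add: ssf_eq_iff rep_arith, simp add: field_simps)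

lemma od_200:
 "Lie mu F (a * (dx (dx g))) - star (a * (dx (dx (star (Lie lam F g))))) =
  Lie (mu - lam - 2) F a * (dx (dx g))
  + sc (-1) (star (D1 (dx F) * a)) * (dx (D1 g))
  + sc (-1) (star (D2 (dx F) * a)) * (dx (D2 g))
  + sc (-(2*lam+1)) (dx (dx F) * a) * (dx g)"
  by (simp add: Lie_odd[OF od] op_linear op_leibniz od_star od_osp mult.assoc od_comms[of a]
      od_comms[of "star a"],
      simp add: ssf_eq_iff rep_arith, simp add: field_simps)

lemma od_111:
 "Lie mu F (a * (dx (D1 (D2 g)))) - star (a * (dx (D1 (D2 (star (Lie lam F g)))))) =
  Lie (mu - lam - 2) F a * (dx (D1 (D2 g)))
  + sc (-(lam+1)) (star (D2 (dx F) * a)) * (dx (D1 g))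
  + sc (lam+1) (star (D1 (dx F) * a)) * (dx (D2 g))
  + sc (-(lam+1)) (dx (dx F) * a) * (D1 (D2 g))"
  by (simp add: Lie_odd[OF od] op_linear op_leibniz od_star od_osp mult.assoc od_comms[of a]
      od_comms[of "star a"],
      simp add: ssf_eq_iff rep_arith, simp add: field_simps)

end

section \<open>Uniqueness of the coefficients of a differential operator\<close>

type_synonym fam = "nat \<Rightarrow> bool \<Rightarrow> bool \<Rightarrow> ssf"

definition fdop :: "fam \<Rightarrow> dop" where "fdop a = (\<lambda>l m n. rep (a l m n))"

definition term_at :: "fam \<Rightarrow> nat \<Rightarrow> ssf \<Rightarrow> ssf" where
  "term_at a l g = a l False False * (dx ^^ l) g + a l True False * (dx ^^ l) (D1 g)
     + a l False True * (dx ^^ l) (D2 g) + a l True True * (dx ^^ l) (D1 (D2 g))"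

lemma rep_ops:
  "szero = rep 0" "sadd (rep a) (rep b) = rep (a + b)" "ssub (rep a) (rep b) = rep (a - b)"
  "smul (rep a) (rep b) = rep (a * b)" "ssc c (rep a) = rep (sc c a)"
  "sdx (rep a) = rep (dx a)" "Dbar1 (rep a) = rep (D1 a)" "Dbar2 (rep a) = rep (D2 a)"
  "Lden w (rep a) (rep b) = rep (Lie w a b)"
  by (transfer; rule refl)+

lemma rep_dx_pow: "(sdx ^^ l) (rep a) = rep ((dx ^^ l) a)"
  by (induction l) (simp_all add: rep_ops)

lemma smooth_rep: "smooth_sf (rep a)" using rep by blast

lemma smooth_sfE: assumes "smooth_sf f" obtains a where "f = rep a"
  using assms ab_inverse[of f] by (metis mem_Collect_eq)

lemma rep_eq_szero: "rep a = szero \<longleftrightarrow> a = 0" by (simp add: rep_ops rep_inject)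

lemma dsupp_fdop: "dsupp (fdop a) = {l. \<exists>m n. a l m n \<noteq> 0}"
  by (simp add: dsupp_def fdop_def rep_eq_szero)

lemma valid_dopE:
  assumes "valid_dop A"
  obtains a where "A = fdop a" "finite {l. \<exists>m n. a l m n \<noteq> 0}"
proof
  show A: "A = fdop (\<lambda>l m n. ab (A l m n))"
    using assms by (simp add: fdop_def valid_dop_def ab_inverse)
  show "finite {l. \<exists>m n. ab (A l m n) \<noteq> 0}"
    using assms unfolding dsupp_fdop[symmetric] A[symmetric] valid_dop_def by simp
qed

lemma rep_sum: "rep (sum f T) p q t = (\<Sum>l\<in>T. rep (f l) p q t)"
  by (induction T rule: infinite_finite_induct) (auto simp: rep_arith)

text \<open>The sum in \<open>dapply\<close> runs over the support of the operator itself. Passing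
  to any finite superset allows operators with different supports to be compared.\<close>

lemma dapply_fdop:
  assumes "finite T" "\<And>l m n. l \<notin> T \<Longrightarrow> a l m n = 0"
  shows "dapply (fdop a) (rep g) = rep (\<Sum>l\<in>T. term_at a l g)"
proof -
  have sub: "dsupp (fdop a) \<subseteq> T" using assms(2) by (auto simp: dsupp_def fdop_def
      rep_eq_szero)
  have z: "term_at a l g = 0" if "l \<notin> dsupp (fdop a)" for l
    using that by (auto simp: dsupp_def fdop_def rep_eq_szero term_at_def)
  have "dapply (fdop a) (rep g) = (\<lambda>p q t. \<Sum>l\<in>dsupp (fdop a). rep (term_at a l g)
      p q t)"
    unfolding dapply_def
    by (intro ext sum.cong refl)
      (simp add: UNIV_bool Dpow_def fdop_def rep_ops rep_dx_pow term_at_def rep_arith)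
  also have "\<dots> = (\<lambda>p q t. \<Sum>l\<in>T. rep (term_at a l g) p q t)"
    by (intro ext sum.mono_neutral_left) (use assms sub z in \<open>auto simp: rep_arith\<close>)
  finally show ?thesis by (simp add: rep_sum fun_eq_iff)
qed

text \<open>With the divisor k! differentiation lowers k without a factor, and the functions become
  dual to the derivatives at \<open>t0\<close>.\<close>

definition xpow_fn :: "real \<Rightarrow> nat \<Rightarrow> real \<Rightarrow> complex" where
  "xpow_fn t0 k = (\<lambda>t. (complex_of_real t - complex_of_real t0) ^ k / fact k)"

lemma smooth_fn_power [simp, intro]: "smooth_fn u \<Longrightarrow> smooth_fn (\<lambda>t. u t ^ k)"
  by (induction k) auto

lemma smooth_xpow_fn [simp]: "smooth_fn (xpow_fn t0 k)"
  unfolding xpow_fn_def divide_inverse by (intro smooth_fn_mult smooth_fn_power smooth_fn_diff) auto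

lemma dr_xpow_fn: "dr (xpow_fn t0 k) = (if k = 0 then (\<lambda>t. 0) else xpow_fn t0 (k - 1))"
proof (cases k)
  case 0 then show ?thesis by (simp add: xpow_fn_def)
next
  case (Suc j)
  have "((\<lambda>t. (complex_of_real t - complex_of_real t0) ^ Suc j / fact (Suc j))
      has_vector_derivative
      (complex_of_real t - complex_of_real t0) ^ j / fact j) (at t)" for t
  proof -
    have n: "of_nat (Suc j) \<noteq> (0 :: complex)" by (simp del: of_nat_Suc)
    have "((\<lambda>z. (z - complex_of_real t0) ^ Suc j) has_field_derivative
        of_nat (Suc j) * (complex_of_real t - complex_of_real t0) ^ j) (at (complex_of_real t))"
      by (rule derivative_eq_intros refl | simp)+
    from DERIV_cdivide[OF this, of "fact (Suc j)"]
    have 1: "((\<lambda>z. (z - complex_of_real t0) ^ Suc j / fact (Suc j)) has_field_derivative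
        (complex_of_real t - complex_of_real t0) ^ j / fact j) (at (complex_of_real t))"
      using n by (simp del: of_nat_Suc power_Suc)
    have 2: "(complex_of_real has_vector_derivative 1) (at t)"
      using has_vector_derivative_of_real[of "\<lambda>x. x" 1 "at t"] by (simp add: o_def)
    show ?thesis using field_vector_diff_chain_at[OF 2 1] by (simp add: o_def)
  qed
  then show ?thesis using Suc by (simp add: xpow_fn_def dr_eqI)
qed

lift_definition xpow :: "real \<Rightarrow> nat \<Rightarrow> ssf" is
  "\<lambda>t0 k a b. if a \<or> b then (\<lambda>t. 0) else xpow_fn t0 k"
  by (simp add: smooth_sf_iff)

lemma xpow_dx: "dx (xpow t0 k) = (if k = 0 then 0 else xpow t0 (k - 1))"
  by transfer (simp add: component_defs dr_xpow_fn)

section \<open>Evaluation of operators on body functions\<close>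

definition body :: "ssf \<Rightarrow> bool" where
  "body m \<longleftrightarrow> (\<forall>p q t. p \<or> q \<longrightarrow> rep m p q t = 0)"

lemma body_xpow: "body (xpow t0 k)"
  unfolding body_def by transfer auto

lemma body_D: assumes "body m" shows "D1 m = - (X1 * dx m)" "D2 m = - (X2 * dx m)"
proof -
  have "rep m True False = (\<lambda>t. 0)" "rep m False True = (\<lambda>t. 0)" "rep m True True =
      (\<lambda>t. 0)"
    using assms by (auto simp: body_def)
  then show "D1 m = - (X1 * dx m)" "D2 m = - (X2 * dx m)"
    by (transfer; simp add: component_defs)+
qed

lemma body_dx: assumes "body m" shows "body (dx m)"
proof -
  have "rep m p q = (\<lambda>t. 0)" if "p \<or> q" for p q using assms that by (auto simp: body_def)
  then show ?thesis unfolding body_def by transfer (simp add: sdx_def)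
qed

lemma X_simps: "star X1 = - X1" "star X2 = - X2" "dx X1 = 0" "dx X2 = 0"
  "D1 X1 = 1" "D2 X2 = 1" "D1 X2 = 0" "D2 X1 = 0" "X1 * X1 = 0" "X2 * X2 = 0" "X2 * X1 = - (X1 * X2)"
  by (transfer; simp add: component_defs)+

lemma X_assoc: "X1 * (X1 * a) = 0" "X2 * (X2 * a) = 0" "X2 * (X1 * a) = - (X1 * (X2 * a))"
  by (simp_all add: mult.assoc[symmetric] X_simps)

lemma dx_pow_0 [simp]: "(dx ^^ l) 0 = 0" by (induction l) (auto simp: dx_0)
lemma dx_pow_uminus: "(dx ^^ l) (- a) = - (dx ^^ l) a" by (induction l) (auto simp: dx_uminus)
lemma dx_pow_add: "(dx ^^ l) (a + b) = (dx ^^ l) a + (dx ^^ l) b" by (induction l) (auto simp: dx_add)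
lemma dx_pow_X: "(dx ^^ l) (X1 * a) = X1 * (dx ^^ l) a" "(dx ^^ l) (X2 * a) = X2 * (dx ^^ l) a"
  by (induction l) (auto simp: dx_mult X_simps)

lemma xpow_dx_pow: "(dx ^^ l) (xpow t0 k) = (if l \<le> k then xpow t0 (k - l) else 0)"
  by (induction l) (auto simp: xpow_dx dx_0)

lemma body_dx_pow: "body m \<Longrightarrow> body ((dx ^^ l) m)"
  by (induction l) (auto simp: body_dx)

lemma eval_body: "body m \<Longrightarrow> rep (a * m) p q t = rep a p q t * rep m False False t"
  unfolding body_def by transfer (cases p; cases q; simp add: smul_def)

lemma eval_xpow: "rep ((dx ^^ l) (xpow t0 k)) False False t0 = (if l = k then 1 else 0)"
proof -
  have "rep (xpow t0 k) False False t0 = (if k = 0 then 1 else 0)" for k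
    by transfer (auto simp: xpow_fn_def)
  then show ?thesis by (simp add: xpow_dx_pow rep_arith)
qed

lemma dx_pow_dx: "(dx ^^ l) (dx a) = (dx ^^ Suc l) a" by (simp add: funpow_swap1)

lemma D_body:
  assumes "body m"
  shows "D1 m = - (X1 * dx m)" "D2 m = - (X2 * dx m)" "D1 (X2 * dx m) = - (X1 * (X2 * dx (dx m)))"
    "D1 (X1 * m) = m" "D2 (X1 * m) = X1 * (X2 * dx m)" "D1 (X1 * (X2 * dx m)) = X2 * dx m"
    "D1 (X2 * m) = - (X1 * (X2 * dx m))" "D2 (X2 * m) = m"
    "D1 (X1 * (X2 * m)) = X2 * m" "D2 (X1 * (X2 * m)) = - (X1 * m)"
proof -
  show 1: "D1 m = - (X1 * dx m)" "D2 m = - (X2 * dx m)" by (simp_all add: body_D assms)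
  show 3: "D1 (X2 * dx m) = - (X1 * (X2 * dx (dx m)))"
    by (simp add: 1 D1_mult X_simps D1_dx dx_uminus dx_mult X_assoc)
  show 4: "D1 (X1 * m) = m" "D2 (X1 * m) = X1 * (X2 * dx m)" "D1 (X2 * m) = - (X1 * (X2 * dx m))"
      "D2 (X2 * m) = m"
    by (simp_all add: 1 D1_mult D2_mult X_simps X_assoc)
  show "D1 (X1 * (X2 * dx m)) = X2 * dx m"
    by (simp add: D1_mult[of X1] 3 X_simps X_assoc)
  show "D1 (X1 * (X2 * m)) = X2 * m" "D2 (X1 * (X2 * m)) = - (X1 * m)"
    by (simp_all add: D1_mult[of X1] D2_mult[of X1] 4 X_simps X_assoc)
qed

lemma eval_body2:
  assumes "body m"
  shows "rep (a * (dx ^^ l) m) p q t = rep a p q t * rep ((dx ^^ l) m) False False t"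
    "rep (a * (b * (dx ^^ l) m)) p q t = rep (a * b) p q t * rep ((dx ^^ l) m) False False t"
    "rep (a * (b * (c * (dx ^^ l) m))) p q t = rep (a * (b * c)) p q t * rep ((dx ^^ l) m) False
        False t"
  by (simp_all add: eval_body body_dx_pow assms mult.assoc[symmetric])

text \<open>D1 and D2 act on a body function through its x-derivative. On each of the sectors 1, X1,
  X2, X1 X2 a term is thus a combination of ordinary derivatives of the body. Both the triangular
  tests in \<open>dop_zero\<close> and the jet property of differential operators are read off from
  here.\<close>

lemma term_at_body:
  fixes m defines "u \<equiv> (\<lambda>l t. rep ((dx ^^ l) m) False False t)"
  assumes "body m"
  shows
    "rep (term_at a l m) p q t = rep (a l False False) p q t * u l t
      - rep (a l True False * X1) p q t * u (Suc l) t - rep (a l False True * X2) p q t * u (Suc l) t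
      + rep (a l True True * (X1 * X2)) p q t * u (Suc (Suc l)) t"
    "rep (term_at a l (X1 * m)) p q t = rep (a l False False * X1 + a l True False) p q t * u l t
      + rep (a l False True * (X1 * X2) + a l True True * X2) p q t * u (Suc l) t"
    "rep (term_at a l (X2 * m)) p q t = rep (a l False False * X2 + a l False True) p q t * u l t
      - rep (a l True False * (X1 * X2) + a l True True * X1) p q t * u (Suc l) t"
    "rep (term_at a l (X1 * (X2 * m))) p q t = rep (a l False False * (X1 * X2)
      + a l True False * X2 - a l False True * X1 - a l True True) p q t * u l t"
  unfolding u_def using assms(2)
  by (simp_all add: term_at_def D_body D1_uminus dx_pow_uminus dx_pow_X dx_pow_dx eval_body2 rep_arith
    algebra_simps del: funpow.simps)

lemma term_at_xpow:
  assumes "k \<le> l"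
  shows
    "rep (term_at a l (xpow t0 k)) p q t0 = (if l = k then rep (a k False False) p q t0 else 0)"
    "rep (term_at a l (X1 * xpow t0 k)) p q t0 =
      (if l = k then rep (a k False False * X1 + a k True False) p q t0 else 0)"
    "rep (term_at a l (X2 * xpow t0 k)) p q t0 =
      (if l = k then rep (a k False False * X2 + a k False True) p q t0 else 0)"
    "rep (term_at a l (X1 * (X2 * xpow t0 k))) p q t0 =
      (if l = k then rep (a k False False * (X1 * X2) + a k True False * X2 - a k False True * X1 -
          a k True True) p q t0 else 0)"
  using assms unfolding term_at_body[OF body_xpow] eval_xpow by auto

text \<open>Induction on l with test functions of degree k at \<open>t0\<close>: terms with l < k
  vanish by the induction hypothesis, terms with l > k vanish at \<open>t0\<close>. The tests with
  1, then with X1 and X2, then with X1 X2 are triangular in the four coefficients that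
  remain.\<close>

lemma dop_zero:
  assumes fin: "finite T" and out: "\<And>l m n. l \<notin> T \<Longrightarrow> a l m n = 0"
    and z: "\<And>g. (\<Sum>l\<in>T. term_at a l g) = 0"
  shows "a l m n = 0"
proof (induction l arbitrary: m n rule: less_induct)
  case (less k)
  show ?case
  proof (cases "k \<in> T")
    case False then show ?thesis by (simp add: out)
  next
    case True
    have single: "rep (term_at a k g) p q t0 = 0"
      if "\<And>l. k < l \<Longrightarrow> rep (term_at a l g) p q t0 = 0" for g p q t0
    proof -
      have "0 = (\<Sum>l\<in>T. rep (term_at a l g) p q t0)"
        by (simp add: rep_sum[symmetric] z rep_arith)
      also have "\<dots> = rep (term_at a k g) p q t0 + (\<Sum>l\<in>T - {k}. rep (term_at a l g) p
          q t0)"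
        using fin True by (simp add: sum.remove)
      also have "(\<Sum>l\<in>T - {k}. rep (term_at a l g) p q t0) = 0"
      proof (intro sum.neutral ballI)
        fix l assume "l \<in> T - {k}"
        then consider "l < k" | "k < l" by force
        then show "rep (term_at a l g) p q t0 = 0"
        proof cases
          case 1 then show ?thesis by (simp add: term_at_def less rep_arith)
        qed (rule that)
      qed
      finally show ?thesis by simp
    qed
    have FF: "a k False False = 0"
    proof -
      have "rep (a k False False) p q t0 = 0" for p q t0
      proof -
        have "rep (term_at a k (xpow t0 k)) p q t0 = 0"
          by (rule single) (simp add: term_at_xpow)
        then show ?thesis using term_at_xpow[of k k a t0 p q] by (simp add: rep_arith)
      qed
      then show ?thesis by (simp add: ssf_eq_iff rep_arith)
    qed
    have TF: "a k True False = 0"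
    proof -
      have "rep (a k True False) p q t0 = 0" for p q t0
      proof -
        have "rep (term_at a k (X1 * xpow t0 k)) p q t0 = 0"
          by (rule single) (simp add: term_at_xpow)
        then show ?thesis using term_at_xpow[of k k a t0 p q] by (simp add: FF rep_arith)
      qed
      then show ?thesis by (simp add: ssf_eq_iff rep_arith)
    qed
    have FT: "a k False True = 0"
    proof -
      have "rep (a k False True) p q t0 = 0" for p q t0
      proof -
        have "rep (term_at a k (X2 * xpow t0 k)) p q t0 = 0"
          by (rule single) (simp add: term_at_xpow)
        then show ?thesis using term_at_xpow[of k k a t0 p q] by (simp add: FF rep_arith)
      qed
      then show ?thesis by (simp add: ssf_eq_iff rep_arith)
    qed
    have TT: "a k True True = 0"
    proof -
      have "rep (a k True True) p q t0 = 0" for p q t0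
      proof -
        have "rep (term_at a k (X1 * (X2 * xpow t0 k))) p q t0 = 0"
          by (rule single) (simp add: term_at_xpow)
        then show ?thesis using term_at_xpow[of k k a t0 p q] by (simp add: FF TF FT rep_arith)
      qed
      then show ?thesis by (simp add: ssf_eq_iff rep_arith)
    qed
    show ?thesis using FF TF FT TT by (cases m; cases n) auto
  qed
qed

lemma term_at_diff: "term_at (\<lambda>l m n. a l m n - b l m n) l g = term_at a l g - term_at b l g"
  by (simp add: term_at_def algebra_simps)

text \<open>The definite description in \<open>dact\<close> denotes a determined operator by virtue
  of this lemma.\<close>

lemma dop_unique:
  assumes "valid_dop A" "valid_dop B" "\<And>g. smooth_sf g \<Longrightarrow> dapply A g = dapply B g"
  shows "A = B"
proof -
  obtain a where a: "A = fdop a" "finite {l. \<exists>m n. a l m n \<noteq> 0}" (is "finite ?S")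
      using assms(1) valid_dopE by blast
  obtain b where b: "B = fdop b" "finite {l. \<exists>m n. b l m n \<noteq> 0}" (is "finite ?T")
      using assms(2) valid_dopE by blast
  have fin: "finite (?S \<union> ?T)" using a b by simp
  have "rep (\<Sum>l\<in>?S \<union> ?T. term_at a l g) = rep (\<Sum>l\<in>?S \<union> ?T. term_at
      b l g)" for g
  proof -
    have "dapply A (rep g) = dapply B (rep g)" by (rule assms(3)) (rule smooth_rep)
    moreover have "dapply A (rep g) = rep (\<Sum>l\<in>?S \<union> ?T. term_at a l g)"
      unfolding a(1) by (rule dapply_fdop[OF fin]) blast
    moreover have "dapply B (rep g) = rep (\<Sum>l\<in>?S \<union> ?T. term_at b l g)"
      unfolding b(1) by (rule dapply_fdop[OF fin]) blast
    ultimately show ?thesis by simp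
  qed
  then have "(\<Sum>l\<in>?S \<union> ?T. term_at a l g) = (\<Sum>l\<in>?S \<union> ?T. term_at b l
      g)" for g
    by (simp add: rep_inject)
  then have "(\<Sum>l\<in>?S \<union> ?T. term_at (\<lambda>l m n. a l m n - b l m n) l g) = 0" for g
    unfolding term_at_diff sum_subtractf by simp
  then have "a l m n - b l m n = 0" for l m n
    by (rule dop_zero[OF fin, rotated]) auto
  then have "a = b" by (simp add: fun_eq_iff)
  then show ?thesis using a(1) b(1) by simp
qed

section \<open>The action on operators of order at most two\<close>

text \<open>The arguments of \<open>Op2\<close> are the coefficients of \<open>dx\<^sup>l D1\<^sup>m D2\<^sup>n\<close>, ordered by \<open>lmn\<close> as
  000, 010, 001, 100, 011, 110, 101, 200, 111.\<close>

datatype op2 = Op2 ssf ssf ssf ssf ssf ssf ssf ssf ssf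

fun coef :: "op2 \<Rightarrow> fam" where
  "coef (Op2 a000 a010 a001 a100 a011 a110 a101 a200 a111) l m n =
    (if l = 0 then (if m then (if n then a011 else a010) else (if n then a001 else a000))
     else if l = 1 then (if m then (if n then a111 else a110) else (if n then a101 else a100))
     else if l = 2 \<and> \<not> m \<and> \<not> n then a200 else 0)"

definition dop_of :: "op2 \<Rightarrow> dop" where "dop_of x = fdop (coef x)"

fun apply2 :: "op2 \<Rightarrow> ssf \<Rightarrow> ssf" where
  "apply2 (Op2 a000 a010 a001 a100 a011 a110 a101 a200 a111) g = a000 * g + a010 * (D1 g) + a001 *
      (D2 g) + a100 * (dx g) + a011 * (D1 (D2 g)) + a110 * (dx (D1 g)) + a101 * (dx (D2 g)) + a200
      * (dx (dx g)) + a111 * (dx (D1 (D2 g)))"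

text \<open>These are the ways in which the field enters besides the Lie derivative: rotation within
  one order, lowering of the order by 1/2, and lowering by 1. The \<open>star\<close> in
  \<open>grad1\<close> and \<open>grad2\<close> lets one formula serve fields of both
  parities.\<close>

definition rot :: "ssf \<Rightarrow> ssf \<Rightarrow> ssf" where "rot F a = D1 (D2 F) * a"
definition grad1 :: "ssf \<Rightarrow> ssf \<Rightarrow> ssf" where "grad1 F a = star (D1 (dx F) * a)"
definition grad2 :: "ssf \<Rightarrow> ssf \<Rightarrow> ssf" where "grad2 F a = star (D2 (dx F) * a)"
definition acc :: "ssf \<Rightarrow> ssf \<Rightarrow> ssf" where "acc F a = dx (dx F) * a"

lemmas coeff_op_defs = rot_def grad1_def grad2_def acc_def

fun act :: "complex \<Rightarrow> complex \<Rightarrow> ssf \<Rightarrow> op2 \<Rightarrow> op2" where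
  "act lam mu F (Op2 a000 a010 a001 a100 a011 a110 a101 a200 a111) = Op2
     (Lie (mu - lam) F a000 + sc (lam) (grad1 F a010) + sc (lam) (grad2 F a001) + sc (-lam) (acc F
         a100))
     (Lie (mu - lam - 1/2) F a010 + sc (-1/2) (rot F a001) + sc (-1/2) (grad1 F a100) + sc
         (-(lam+1/2)) (grad2 F a011) + sc (-(lam+1/2)) (acc F a110))
     (Lie (mu - lam - 1/2) F a001 + sc (1/2) (rot F a010) + sc (-1/2) (grad2 F a100) + sc (lam+1/2)
         (grad1 F a011) + sc (-(lam+1/2)) (acc F a101))
     (Lie (mu - lam - 1) F a100 + sc (lam+1/2) (grad1 F a110) + sc (lam+1/2) (grad2 F a101) + sc
         (-(2*lam+1)) (acc F a200))
     (Lie (mu - lam - 1) F a011 + sc (1/2) (grad2 F a110) + sc (-1/2) (grad1 F a101) + sc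
         (-(lam+1)) (acc F a111))
     (Lie (mu - lam - 3/2) F a110 + sc (-1/2) (rot F a101) + sc (-1) (grad1 F a200) + sc (-(lam+1))
         (grad2 F a111))
     (Lie (mu - lam - 3/2) F a101 + sc (1/2) (rot F a110) + sc (-1) (grad2 F a200) + sc (lam+1)
         (grad1 F a111))
     (Lie (mu - lam - 2) F a200)
     (Lie (mu - lam - 2) F a111)"

lemma coef_high: "2 < l \<Longrightarrow> coef x l m n = 0"
  by (cases x) auto

lemma coef_wt: "4 < wt l m n \<Longrightarrow> coef x l m n = 0"
  by (cases x) (auto simp: wt_def split: if_splits)

lemma dop_of_in_Dk: "dop_of x \<in> Dk 4"
proof -
  have "dsupp (dop_of x) \<subseteq> {..2}"
    using coef_high[of _ x] by (auto simp: dop_of_def dsupp_fdop not_less[symmetric])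
  then have "finite (dsupp (dop_of x))" by (rule finite_subset) simp
  then show ?thesis
    by (simp add: Dk_def valid_dop_def filt_def dop_of_def fdop_def smooth_rep rep_eq_szero coef_wt)
qed

lemma Dk_dop_of: assumes "A \<in> Dk 4" obtains x where "A = dop_of x"
proof -
  from assms obtain a where a: "A = fdop a" by (auto simp: Dk_def elim: valid_dopE)
  have z: "a l m n = 0" if "4 < wt l m n" for l m n
    using assms that by (auto simp: Dk_def filt_def a fdop_def rep_eq_szero)
  have "a l m n = coef (Op2 (a 0 False False) (a 0 True False) (a 0 False True) (a 1 False False)
      (a 0 True True) (a 1 True False) (a 1 False True) (a 2 False False) (a 1 True True)) l m n"
      for l m n
  proof (cases "4 < wt l m n")
    case True show ?thesis by (rule trans[OF z[OF True] coef_wt[OF True, symmetric]])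
  next
    case False
    then have "l = 0 \<or> l = 1 \<or> (l = 2 \<and> \<not> m \<and> \<not> n)"
      by (auto simp: wt_def split: if_splits)
    then show ?thesis by (cases m; cases n) auto
  qed
  then have "a = coef (Op2 (a 0 False False) (a 0 True False) (a 0 False True) (a 1 False False) (a
      0 True True) (a 1 True False) (a 1 False True) (a 2 False False) (a 1 True True))" by (intro ext)
  then have "A = dop_of (Op2 (a 0 False False) (a 0 True False) (a 0 False True) (a 1 False False)
      (a 0 True True) (a 1 True False) (a 1 False True) (a 2 False False) (a 1 True True))"
      unfolding a dop_of_def by (rule arg_cong)
  then show thesis by (rule that)
qed

lemma dapply_dop_of: "dapply (dop_of x) (rep g) = rep (apply2 x g)"
proof (cases x)
  case (Op2 a000 a010 a001 a100 a011 a110 a101 a200 a111)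
  have "dapply (dop_of x) (rep g) = rep (\<Sum>l\<in>{..2}. term_at (coef x) l g)"
    unfolding dop_of_def by (rule dapply_fdop) (auto intro: coef_high)
  also have "{..2::nat} = {0,1,2}" by auto
  also have "(\<Sum>l\<in>{0,1,2}. term_at (coef x) l g) = apply2 x g"
    by (simp add: Op2 term_at_def numeral_2_eq_2 algebra_simps D1_dx D2_dx)
  finally show ?thesis .
qed

lemma Lie_linear:
  assumes "star F = F \<or> star F = - F"
  shows "Lie w F (a + b) = Lie w F a + Lie w F b" "Lie w F (a - b) = Lie w F a - Lie w F b"
    "Lie w F (sc c a) = sc c (Lie w F a)" "Lie w F 0 = 0" "Lie w F (- a) = - Lie w F a"
  using assms
  by (auto simp: Lie_even Lie_odd dx_add D1_add D2_add dx_diff D1_diff D2_diff dx_sc D1_sc D2_sc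
      dx_0 D1_0 D2_0 dx_uminus D1_uminus D2_uminus sc_add sc_diff sc_uminus algebra_simps)

lemma apply2_act_even:
  assumes "star F = F" "osp_sf F"
  shows "apply2 (act lam mu F x) g = Lie mu F (apply2 x g) - apply2 x (Lie lam F g)"
proof (cases x)
  case (Op2 a000 a010 a001 a100 a011 a110 a101 a200 a111)
  note ev = ev_000 ev_010 ev_001 ev_100 ev_011 ev_110 ev_101 ev_200 ev_111
  note E = ev[OF assms, where lam = lam and mu = mu and g = g]
  have "Lie mu F (apply2 x g) - apply2 x (Lie lam F g) =
    (Lie mu F (a000 * g) - a000 * (Lie lam F g))
    + (Lie mu F (a010 * (D1 g)) - a010 * (D1 (Lie lam F g)))
    + (Lie mu F (a001 * (D2 g)) - a001 * (D2 (Lie lam F g)))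
    + (Lie mu F (a100 * (dx g)) - a100 * (dx (Lie lam F g)))
    + (Lie mu F (a011 * (D1 (D2 g))) - a011 * (D1 (D2 (Lie lam F g))))
    + (Lie mu F (a110 * (dx (D1 g))) - a110 * (dx (D1 (Lie lam F g))))
    + (Lie mu F (a101 * (dx (D2 g))) - a101 * (dx (D2 (Lie lam F g))))
    + (Lie mu F (a200 * (dx (dx g))) - a200 * (dx (dx (Lie lam F g))))
    + (Lie mu F (a111 * (dx (D1 (D2 g)))) - a111 * (dx (D1 (D2 (Lie lam F g)))))"
    by (simp add: Op2 Lie_linear assms)
  also have "\<dots> = apply2 (act lam mu F x) g"
    unfolding E Op2 by (simp add: coeff_op_defs algebra_simps)
  finally show ?thesis by simp
qed

lemma apply2_act_odd:
  assumes "star F = - F" "osp_sf F"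
  shows "apply2 (act lam mu F x) g = Lie mu F (apply2 x g) - star (apply2 x (star (Lie lam F g)))"
proof (cases x)
  case (Op2 a000 a010 a001 a100 a011 a110 a101 a200 a111)
  note od = od_000 od_010 od_001 od_100 od_011 od_110 od_101 od_200 od_111
  note E = od[OF assms, where lam = lam and mu = mu and g = g]
  have "Lie mu F (apply2 x g) - star (apply2 x (star (Lie lam F g))) =
    (Lie mu F (a000 * g) - star (a000 * (star (Lie lam F g))))
    + (Lie mu F (a010 * (D1 g)) - star (a010 * (D1 (star (Lie lam F g)))))
    + (Lie mu F (a001 * (D2 g)) - star (a001 * (D2 (star (Lie lam F g)))))
    + (Lie mu F (a100 * (dx g)) - star (a100 * (dx (star (Lie lam F g)))))
    + (Lie mu F (a011 * (D1 (D2 g))) - star (a011 * (D1 (D2 (star (Lie lam F g))))))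
    + (Lie mu F (a110 * (dx (D1 g))) - star (a110 * (dx (D1 (star (Lie lam F g))))))
    + (Lie mu F (a101 * (dx (D2 g))) - star (a101 * (dx (D2 (star (Lie lam F g))))))
    + (Lie mu F (a200 * (dx (dx g))) - star (a200 * (dx (dx (star (Lie lam F g))))))
    + (Lie mu F (a111 * (dx (D1 (D2 g)))) - star (a111 * (dx (D1 (D2 (star (Lie lam F g)))))))"
    by (simp add: Op2 Lie_linear assms star_add)
  also have "\<dots> = apply2 (act lam mu F x) g"
    unfolding E Op2 by (simp add: coeff_op_defs algebra_simps)
  finally show ?thesis by simp
qed

text \<open>Since \<open>peven h - podd h\<close> is \<open>sstar h\<close>, the signed difference
  of the even and odd parts of an additive A is the conjugate of A by \<open>star\<close>.\<close>

lemma opE_opO: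
  "ssub (opE (\<lambda>h. A h) h) (opO A h) = sstar (ssub (A (peven h)) (A (podd h)))"
  by (simp add: opE_def opO_def component_defs)

lemma peven_podd_rep: obtains u v where "peven (rep h) = rep u" "podd (rep h) = rep v" "star h = u
    - v" "h = u + v"
proof -
  have "smooth_sf (peven (rep h))" "smooth_sf (podd (rep h))"
    using smooth_rep[of h] by (auto simp: smooth_sf_iff peven_def podd_def)
  then obtain u v where uv: "peven (rep h) = rep u" "podd (rep h) = rep v" by (metis smooth_sfE)
  moreover from uv have "star h = u - v" "h = u + v" by (transfer; simp add: component_defs)+
  ultimately show thesis by (rule that)
qed

lemma apply2_diff: "apply2 x (g - h) = apply2 x g - apply2 x h"
  by (cases x) (simp add: op_linear algebra_simps)

lemma act_map_dop_of:
  assumes "star F = F \<or> star F = - F" "osp_sf F"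
  shows "act_map lam mu (rep F) (dapply (dop_of x)) (rep g) = rep (apply2 (act lam mu F x) g)"
proof (cases "star F = - F")
  \<comment> \<open>The odd case comes first because \<open>act_map\<close> and \<open>Xc\<close>
    decide by \<open>is_odd\<close>, which also holds for F = 0.\<close>
  case True
  obtain u v where uv: "peven (rep (Lie lam F g)) = rep u" "podd (rep (Lie lam F g)) = rep v"
    "star (Lie lam F g) = u - v" by (rule peven_podd_rep)
  have "sstar (rep a) = rep (star a)" for a by transfer simp
  with True uv show ?thesis
    by (simp only: act_map_def is_odd_rep refl if_True rep_ops(9,3) dapply_dop_of opE_opO
        apply2_act_odd[OF True assms(2)] apply2_diff)
next
  case False
  with assms(1) have "star F = F" by blast
  with False show ?thesis
    by (simp add: act_map_def is_odd_rep rep_ops dapply_dop_of apply2_act_even[OF _ assms(2)])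
qed

lemma dact_dop_of:
  assumes "star F = F \<or> star F = - F" "osp_sf F"
  shows "dact lam mu (rep F) (dop_of x) = dop_of (act lam mu F x)"
proof -
  have valid: "valid_dop (dop_of (act lam mu F x))" using dop_of_in_Dk[of "act lam mu F x"]
      unfolding Dk_def by blast
  show ?thesis unfolding dact_def
proof (rule the_equality, safe)
  show "valid_dop (dop_of (act lam mu F x))" by (rule valid)
  show "dapply (dop_of (act lam mu F x)) g = act_map lam mu (rep F) (dapply (dop_of x)) g" if
      "smooth_sf g" for g
    by (rule smooth_sfE[OF that]) (simp only: act_map_dop_of[OF assms] dapply_dop_of)
next
  fix B assume "valid_dop B" and *: "\<forall>g. smooth_sf g \<longrightarrow> dapply B g = act_map
      lam mu (rep F) (dapply (dop_of x)) g"
  moreover have "dapply B g = dapply (dop_of (act lam mu F x)) g" if "smooth_sf g" for g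
  proof -
    obtain h where "g = rep h" using \<open>smooth_sf g\<close> by (rule smooth_sfE)
    with * show ?thesis using smooth_rep[of h] by (simp only: act_map_dop_of[OF assms] dapply_dop_of)
  qed
  ultimately show "B = dop_of (act lam mu F x)" using valid by (intro dop_unique) simp_all
qed
qed

section \<open>The equivariant quantization map\<close>

text \<open>The twist by \<open>star\<close> makes the commutation rules below independent of the parity of \<open>F\<close>.\<close>

definition E1 :: "ssf \<Rightarrow> ssf" where "E1 a = D1 (star a)"
definition E2 :: "ssf \<Rightarrow> ssf" where "E2 a = D2 (star a)"

lemma E_linear:
  "E1 (a + b) = E1 a + E1 b" "E1 (a - b) = E1 a - E1 b" "E1 (- a) = - E1 a" "E1 0 = 0" "E1 (sc c a)
      = sc c (E1 a)"
  "E2 (a + b) = E2 a + E2 b" "E2 (a - b) = E2 a - E2 b" "E2 (- a) = - E2 a" "E2 0 = 0" "E2 (sc c a)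
      = sc c (E2 a)"
  by (simp_all add: E1_def E2_def op_linear)

text \<open>Moving \<open>star\<close> past an odd derivation costs a sign; this turns the squares
  -dx of D1 and D2 into +dx.\<close>

lemma E_rules:
  "E1 (E1 a) = dx a" "E2 (E2 a) = dx a" "E2 (E1 a) = - E1 (E2 a)" "E1 (dx a) = dx (E1 a)" "E2 (dx
      a) = dx (E2 a)"
  by (simp_all add: E1_def E2_def op_linear)

lemma coeff_op_linear:
  "rot F (a + b) = rot F a + rot F b" "rot F (a - b) = rot F a - rot F b" "rot F (- a) = - rot F a"
      "rot F 0 = 0" "rot F (sc c a) = sc c (rot F a)"
  "grad1 F (a + b) = grad1 F a + grad1 F b" "grad1 F (a - b) = grad1 F a - grad1 F b" "grad1 F (-
      a) = - grad1 F a" "grad1 F 0 = 0" "grad1 F (sc c a) = sc c (grad1 F a)"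
  "grad2 F (a + b) = grad2 F a + grad2 F b" "grad2 F (a - b) = grad2 F a - grad2 F b" "grad2 F (-
      a) = - grad2 F a" "grad2 F 0 = 0" "grad2 F (sc c a) = sc c (grad2 F a)"
  "acc F (a + b) = acc F a + acc F b" "acc F (a - b) = acc F a - acc F b" "acc F (- a) = - acc F a"
      "acc F 0 = 0" "acc F (sc c a) = sc c (acc F a)"
  by (simp_all add: coeff_op_defs op_linear)

lemma E_comm_even:
  assumes "star F = F" "osp_sf F"
  shows
    "E1 (Lie w F a) = Lie (w + 1/2) F (E1 a) - sc (1/2) (rot F (E2 a)) - sc w (grad1 F a)"
    "E2 (Lie w F a) = Lie (w + 1/2) F (E2 a) + sc (1/2) (rot F (E1 a)) - sc w (grad2 F a)"
    "E1 (rot F a) = rot F (E1 a) + grad2 F a" "E2 (rot F a) = rot F (E2 a) - grad1 F a"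
    "E1 (grad1 F a) = - grad1 F (E1 a) - acc F a" "E1 (grad2 F a) = - grad2 F (E1 a)"
    "E2 (grad1 F a) = - grad1 F (E2 a)" "E2 (grad2 F a) = - grad2 F (E2 a) - acc F a"
    "E1 (acc F a) = acc F (E1 a)" "E2 (acc F a) = acc F (E2 a)"
  apply (simp_all add: E1_def E2_def coeff_op_defs Lie_even[OF assms(1)] op_linear op_leibniz
      ev_star[OF assms] ev_osp[OF assms] mult.assoc)
  apply (simp_all add: ssf_eq_iff rep_arith field_simps)
  done

lemma E_comm_odd:
  assumes "star F = - F" "osp_sf F"
  shows
    "E1 (Lie w F a) = Lie (w + 1/2) F (E1 a) - sc (1/2) (rot F (E2 a)) - sc w (grad1 F a)"
    "E2 (Lie w F a) = Lie (w + 1/2) F (E2 a) + sc (1/2) (rot F (E1 a)) - sc w (grad2 F a)"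
    "E1 (rot F a) = rot F (E1 a) + grad2 F a" "E2 (rot F a) = rot F (E2 a) - grad1 F a"
    "E1 (grad1 F a) = - grad1 F (E1 a) - acc F a" "E1 (grad2 F a) = - grad2 F (E1 a)"
    "E2 (grad1 F a) = - grad1 F (E2 a)" "E2 (grad2 F a) = - grad2 F (E2 a) - acc F a"
    "E1 (acc F a) = acc F (E1 a)" "E2 (acc F a) = acc F (E2 a)"
  apply (simp_all add: E1_def E2_def coeff_op_defs Lie_odd[OF assms(1)] op_linear op_leibniz
      od_star[OF assms] od_osp[OF assms] mult.assoc)
  apply (simp_all add: ssf_eq_iff rep_arith field_simps)
  done

definition hom_osp :: "ssf \<Rightarrow> bool" where
  "hom_osp F \<longleftrightarrow> (star F = F \<or> star F = - F) \<and> osp_sf F"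

lemma hom_osp_cases: "hom_osp F \<Longrightarrow> star F = F \<and> osp_sf F \<or> star F = - F
    \<and> osp_sf F"
  by (auto simp: hom_osp_def)

text \<open>The operators built from F are closed under these commutations. Equivariance of an
  expression in E1 and E2 therefore reduces to comparing coefficients.\<close>

lemma E_comm:
  assumes "hom_osp F"
  shows
    "E1 (Lie w F a) = Lie (w + 1/2) F (E1 a) - sc (1/2) (rot F (E2 a)) - sc w (grad1 F a)"
    "E2 (Lie w F a) = Lie (w + 1/2) F (E2 a) + sc (1/2) (rot F (E1 a)) - sc w (grad2 F a)"
    "E1 (rot F a) = rot F (E1 a) + grad2 F a" "E2 (rot F a) = rot F (E2 a) - grad1 F a"
    "E1 (grad1 F a) = - grad1 F (E1 a) - acc F a" "E1 (grad2 F a) = - grad2 F (E1 a)"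
    "E2 (grad1 F a) = - grad1 F (E2 a)" "E2 (grad2 F a) = - grad2 F (E2 a) - acc F a"
    "E1 (acc F a) = acc F (E1 a)" "E2 (acc F a) = acc F (E2 a)"
  by (rule disjE[OF hom_osp_cases[OF assms]]; elim conjE; (rule E_comm_even E_comm_odd; assumption))+

text \<open>Two applications of the rules for E1, since dx is its square. The \<open>grad2\<close>
  term appears because E1 does not commute with \<open>rot\<close>.\<close>

lemma dx_comm:
  assumes "hom_osp F"
  shows
    "dx (Lie w F a) = Lie (w + 1) F (dx a) - sc (1/2) (grad1 F (E1 a) + grad2 F (E2 a)) + sc w (acc
        F a)"
    "dx (rot F a) = rot F (dx a)" "dx (grad1 F a) = grad1 F (dx a)" "dx (grad2 F a) = grad2 F (dx a)"
    "dx (acc F a) = acc F (dx a)"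
  unfolding E_rules(1)[symmetric]
  by (simp_all add: E_comm[OF assms] E_linear coeff_op_linear E_rules(3) sc_add sc_diff sc_uminus)
    (simp_all add: ssf_eq_iff rep_arith algebra_simps)

text \<open>The order-preserving part of \<open>act\<close>. Besides the Lie derivative only the
  rotation survives, and only at the orders 1/2 and 3/2, where D1 and D2 span a doublet; at integral
  order the components do not mix.\<close>

fun gact :: "complex \<Rightarrow> complex \<Rightarrow> ssf \<Rightarrow> op2 \<Rightarrow> op2" where
  "gact lam mu F (Op2 a000 a010 a001 a100 a011 a110 a101 a200 a111) = Op2
     (Lie (mu - lam) F a000)
     (Lie (mu - lam - 1/2) F a010 - sc (1/2) (rot F a001))
     (Lie (mu - lam - 1/2) F a001 + sc (1/2) (rot F a010))
     (Lie (mu - lam - 1) F a100)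
     (Lie (mu - lam - 1) F a011)
     (Lie (mu - lam - 3/2) F a110 - sc (1/2) (rot F a101))
     (Lie (mu - lam - 3/2) F a101 + sc (1/2) (rot F a110))
     (Lie (mu - lam - 2) F a200)
     (Lie (mu - lam - 2) F a111)"

fun top2 :: "nat \<Rightarrow> op2 \<Rightarrow> op2" where
  "top2 K (Op2 a000 a010 a001 a100 a011 a110 a101 a200 a111) = Op2
     (if K = 0 then a000 else 0) (if K = 1 then a010 else 0) (if K = 1 then a001 else 0)
     (if K = 2 then a100 else 0) (if K = 2 then a011 else 0) (if K = 3 then a110 else 0)
     (if K = 3 then a101 else 0) (if K = 4 then a200 else 0) (if K = 4 then a111 else 0)"

lemma top_dop_of: "top K (dop_of x) = dop_of (top2 K x)"
proof (cases x)
  case (Op2 a000 a010 a001 a100 a011 a110 a101 a200 a111)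
  have "(if wt l m n = K then rep (coef x l m n) else szero) = rep (coef (top2 K x) l m n)" for l m n
    by (cases m; cases n) (auto simp: Op2 wt_def rep_ops)
  then show ?thesis by (simp add: Defs.top_def dop_of_def fdop_def)
qed

lemma gract_dop_of:
  assumes "hom_osp F"
  shows "gract lam mu (rep F) (dop_of x) = dop_of (gact lam mu F x)"
proof (cases x)
  case (Op2 a000 a010 a001 a100 a011 a110 a101 a200 a111)
  have h: "star F = F \<or> star F = - F" "osp_sf F" using assms by (auto simp: hom_osp_def)
  have s: "{..4::nat} = {0,1,2,3,4}" by auto
  have "(\<Sum>K\<le>4. rep (coef (top2 K (act lam mu F (top2 K x))) l m n) p q t) = rep (coef
      (gact lam mu F x) l m n) p q t"
    for l m n p q t
    unfolding s by (cases m; cases n) (simp_all add: Op2 rep_arith Lie_linear[OF h(1)] coeff_op_linear)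
  then show ?thesis
    by (simp add: gract_def top_dop_of dact_dop_of[OF h]) (simp add: dop_of_def fdop_def)
qed

text \<open>The coefficients solve the linear system expressing equivariance; here \<open>l\<close> stands for lambda and
  \<open>d\<close> for mu - lambda. At a resonance the formula is meaningless, since division by zero yields zero.\<close>

fun qmap :: "complex \<Rightarrow> complex \<Rightarrow> op2 \<Rightarrow> op2" where
  "qmap l d (Op2 a000 a010 a001 a100 a011 a110 a101 a200 a111) = Op2
     (a000 - sc (l / d) (E1 a010 + E2 a001) - sc (l / (d - 1)) (dx a100)
        - sc (l * (1 + 2*l) / ((d - 1) * (2*d - 1))) (E1 (E2 a011))
        + sc (l * (1 + 2*l) / (2 * (d - 1)^2)) (dx (E1 a110 + E2 a101))
        + sc (l * (1 + 2*l) / ((d - 2) * (2*d - 3))) (dx (dx a200))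
        + sc (l * (1 + l) * (1 + 2*l) / ((d - 1) * (d - 2) * (2*d - 3))) (dx (E1 (E2 a111))))
     (a010 + sc (1 / (2 * (d - 1))) (E1 a100) + sc ((1 + 2*l) / (2 * (d - 1))) (E2 a011)
        - sc ((1 + 2*l) / (4 * (d - 1)^2)) (sc (2*d - 1) (dx a110) + E1 (E2 a101))
        - sc ((1 + 2*l) / ((d - 2) * (2*d - 3))) (dx (E1 a200) + sc (1 + l) (dx (E2 a111))))
     (a001 + sc (1 / (2 * (d - 1))) (E2 a100) - sc ((1 + 2*l) / (2 * (d - 1))) (E1 a011)
        - sc ((1 + 2*l) / (4 * (d - 1)^2)) (sc (2*d - 1) (dx a101) - E1 (E2 a110))
        - sc ((1 + 2*l) / ((d - 2) * (2*d - 3))) (dx (E2 a200) - sc (1 + l) (dx (E1 a111))))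
     (a100 - sc ((1 + 2*l) / (2 * (d - 1))) (E1 a110 + E2 a101)
        - sc ((1 + 2*l) / (d - 2)) (dx a200)
        - sc ((1 + l) * (1 + 2*l) / ((d - 2) * (2*d - 3))) (E1 (E2 a111)))
     (a011 + sc (1 / (2 * (d - 1))) (E1 a101 - E2 a110)
        + sc (1 / ((d - 2) * (2*d - 3))) (E1 (E2 a200)) - sc ((1 + l) / (d - 2)) (dx a111))
     (a110 + sc (1 / (d - 2)) (E1 a200) + sc ((1 + l) / (d - 2)) (E2 a111))
     (a101 + sc (1 / (d - 2)) (E2 a200) - sc ((1 + l) / (d - 2)) (E1 a111))
     a200 a111"

text \<open>The weights in \<open>act\<close> and \<open>gact\<close> have the form mu - lambda - c.
  Keeping this form lets rewriting bring both sides of the equivariance equation to matching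
  weights.\<close>

lemma E_comm':
  assumes "hom_osp F"
  shows
    "E1 (Lie (w - c) F a) = Lie (w - (c - 1/2)) F (E1 a) - sc (1/2) (rot F (E2 a)) - sc (w - c)
        (grad1 F a)"
    "E2 (Lie (w - c) F a) = Lie (w - (c - 1/2)) F (E2 a) + sc (1/2) (rot F (E1 a)) - sc (w - c)
        (grad2 F a)"
    "dx (Lie (w - c) F a) = Lie (w - (c - 1)) F (dx a) - sc (1/2) (grad1 F (E1 a) + grad2 F (E2 a))
        + sc (w - c) (acc F a)"
  by (simp_all add: E_comm[OF assms] dx_comm[OF assms] algebra_simps)

fun add2 :: "op2 \<Rightarrow> op2 \<Rightarrow> op2" where
  "add2 (Op2 a000 a010 a001 a100 a011 a110 a101 a200 a111) (Op2 b000 b010 b001 b100 b011 b110 b101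
      b200 b111) = Op2
     (a000 + b000) (a010 + b010) (a001 + b001) (a100 + b100) (a011 + b011) (a110 + b110) (a101 +
         b101) (a200 + b200) (a111 + b111)"

fun sc2 :: "complex \<Rightarrow> op2 \<Rightarrow> op2" where
  "sc2 c (Op2 a000 a010 a001 a100 a011 a110 a101 a200 a111) = Op2
     (sc c a000) (sc c a010) (sc c a001) (sc c a100) (sc c a011) (sc c a110) (sc c a101) (sc c
         a200) (sc c a111)"

lemmas dx_linear = dx_add dx_diff dx_uminus dx_0 dx_sc
lemmas sc_linear = sc_add sc_diff sc_uminus

lemma qmap_add: "qmap l d (add2 x y) = add2 (qmap l d x) (qmap l d y)"
  by (cases x; cases y) (simp add: E_linear dx_linear sc_linear)

lemma qmap_sc: "qmap l d (sc2 c x) = sc2 c (qmap l d x)"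
  by (cases x) (simp add: E_linear dx_linear sc_linear mult_ac)

lemma gact_add:
  assumes "hom_osp F"
  shows "gact lam mu F (add2 x y) = add2 (gact lam mu F x) (gact lam mu F y)"
proof -
  have h1: "star F = F \<or> star F = - F" using assms by (auto simp: hom_osp_def)
  show ?thesis by (cases x; cases y) (simp add: Lie_linear[OF h1] coeff_op_linear sc_linear)
qed

lemma act_add:
  assumes "hom_osp F"
  shows "act lam mu F (add2 x y) = add2 (act lam mu F x) (act lam mu F y)"
proof -
  have h1: "star F = F \<or> star F = - F" using assms by (auto simp: hom_osp_def)
  show ?thesis by (cases x; cases y) (simp add: Lie_linear[OF h1] coeff_op_linear sc_linear)
qed

text \<open>By additivity it is enough to treat operators with one nonzero coefficient. Everything
  then reduces to linear identities between words in E1, E2 and the operators built from F, with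
  coefficients rational in l and d.\<close>

lemma qmap_equiv_single:
  assumes h: "hom_osp F" and "d \<noteq> 0" "d - 1 \<noteq> 0" "d - 2 \<noteq> 0" "2*d - 1 \<noteq>
      0" "2*d-3 \<noteq> 0"
  shows
    "qmap l d (gact l (l + d) F (Op2 a 0 0 0 0 0 0 0 0)) = act l (l + d) F (qmap l d (Op2 a 0 0 0 0
        0 0 0 0))"
    "qmap l d (gact l (l + d) F (Op2 0 a 0 0 0 0 0 0 0)) = act l (l + d) F (qmap l d (Op2 0 a 0 0 0
        0 0 0 0))"
    "qmap l d (gact l (l + d) F (Op2 0 0 a 0 0 0 0 0 0)) = act l (l + d) F (qmap l d (Op2 0 0 a 0 0
        0 0 0 0))"
    "qmap l d (gact l (l + d) F (Op2 0 0 0 a 0 0 0 0 0)) = act l (l + d) F (qmap l d (Op2 0 0 0 a 0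
        0 0 0 0))"
    "qmap l d (gact l (l + d) F (Op2 0 0 0 0 a 0 0 0 0)) = act l (l + d) F (qmap l d (Op2 0 0 0 0 a
        0 0 0 0))"
    "qmap l d (gact l (l + d) F (Op2 0 0 0 0 0 a 0 0 0)) = act l (l + d) F (qmap l d (Op2 0 0 0 0 0
        a 0 0 0))"
    "qmap l d (gact l (l + d) F (Op2 0 0 0 0 0 0 a 0 0)) = act l (l + d) F (qmap l d (Op2 0 0 0 0 0
        0 a 0 0))"
    "qmap l d (gact l (l + d) F (Op2 0 0 0 0 0 0 0 a 0)) = act l (l + d) F (qmap l d (Op2 0 0 0 0 0
        0 0 a 0))"
    "qmap l d (gact l (l + d) F (Op2 0 0 0 0 0 0 0 0 a)) = act l (l + d) F (qmap l d (Op2 0 0 0 0 0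
        0 0 0 a))"
proof -
  have h1: "star F = F \<or> star F = - F" using h by (auto simp: hom_osp_def)
  \<comment> \<open>Centering at d = 1 simplifies the most frequent factor: d - 1, which also occurs
    squared, becomes u.\<close>
  obtain u where u: "d = u + 1" by (metis diff_add_cancel)
  have nz: "u + 1 \<noteq> 0" "1 + u \<noteq> 0" "u \<noteq> 0" "u - 1 \<noteq> 0" "2 * u + 1
      \<noteq> 0" "1 + 2 * u \<noteq> 0" "2 * u - 1 \<noteq> 0"
    using assms by (auto simp: u algebra_simps)
  \<comment> \<open>The denominators also occur in expanded form with a numerical factor; these
    factorizations show that they are nonzero.\<close>
  have "2 + u * 2 = 2 * (u + 1)" "2 + u * 4 = 2 * (2 * u + 1)" "u * 4 - 2 = 2 * (2 * u - 1)" "u * 2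
      - 2 = 2 * (u - 1)" by simp_all
  then have nz': "2 + u * 2 \<noteq> 0" "2 + u * 4 \<noteq> 0" "u * 4 - 2 \<noteq> 0" "u * 2 - 2
      \<noteq> 0"
    using nz by (metis mult_eq_0_iff zero_neq_numeral)+
  note rules = E_comm'[OF h] E_comm(3-)[OF h] dx_comm(2-)[OF h] Lie_linear[OF h1] coeff_op_linear
      E_linear E_rules
      dx_linear sc_linear
  show "qmap l d (gact l (l + d) F (Op2 a 0 0 0 0 0 0 0 0)) = act l (l + d) F (qmap l d (Op2 a 0 0
      0 0 0 0 0 0))"
    using assms by (simp add: rules)
  show "qmap l d (gact l (l + d) F (Op2 0 a 0 0 0 0 0 0 0)) = act l (l + d) F (qmap l d (Op2 0 a 0
      0 0 0 0 0 0))"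
    using nz nz' by (simp add: rules, simp add: ssf_eq_iff rep_arith, intro conjI allI)
     (simp_all add: u divide_simps, (simp_all add: algebra_simps power2_eq_square)?)
  show "qmap l d (gact l (l + d) F (Op2 0 0 a 0 0 0 0 0 0)) = act l (l + d) F (qmap l d (Op2 0 0 a
      0 0 0 0 0 0))"
    using nz nz' by (simp add: rules, simp add: ssf_eq_iff rep_arith, intro conjI allI)
     (simp_all add: u divide_simps, (simp_all add: algebra_simps power2_eq_square)?)
  show "qmap l d (gact l (l + d) F (Op2 0 0 0 a 0 0 0 0 0)) = act l (l + d) F (qmap l d (Op2 0 0 0
      a 0 0 0 0 0))"
    using nz nz' by (simp add: rules, simp add: ssf_eq_iff rep_arith, intro conjI allI)
     (simp_all add: u divide_simps, (simp_all add: algebra_simps power2_eq_square)?)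
  show "qmap l d (gact l (l + d) F (Op2 0 0 0 0 a 0 0 0 0)) = act l (l + d) F (qmap l d (Op2 0 0 0
      0 a 0 0 0 0))"
    using nz nz' by (simp add: rules, simp add: ssf_eq_iff rep_arith, intro conjI allI)
     (simp_all add: u divide_simps, (simp_all add: algebra_simps power2_eq_square)?)
  show "qmap l d (gact l (l + d) F (Op2 0 0 0 0 0 a 0 0 0)) = act l (l + d) F (qmap l d (Op2 0 0 0
      0 0 a 0 0 0))"
    using nz nz' by (simp add: rules, simp add: ssf_eq_iff rep_arith, intro conjI allI)
     (simp_all add: u divide_simps, (simp_all add: algebra_simps power2_eq_square)?)
  show "qmap l d (gact l (l + d) F (Op2 0 0 0 0 0 0 a 0 0)) = act l (l + d) F (qmap l d (Op2 0 0 0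
      0 0 0 a 0 0))"
    using nz nz' by (simp add: rules, simp add: ssf_eq_iff rep_arith, intro conjI allI)
     (simp_all add: u divide_simps, (simp_all add: algebra_simps power2_eq_square)?)
  show "qmap l d (gact l (l + d) F (Op2 0 0 0 0 0 0 0 a 0)) = act l (l + d) F (qmap l d (Op2 0 0 0
      0 0 0 0 a 0))"
    using nz nz' by (simp add: rules, simp add: ssf_eq_iff rep_arith, intro conjI allI)
     (simp_all add: u divide_simps, (simp_all add: algebra_simps power2_eq_square)?)
  show "qmap l d (gact l (l + d) F (Op2 0 0 0 0 0 0 0 0 a)) = act l (l + d) F (qmap l d (Op2 0 0 0
      0 0 0 0 0 a))"
    using nz nz' by (simp add: rules, simp add: ssf_eq_iff rep_arith, intro conjI allI)
     (simp_all add: u divide_simps, (simp_all add: algebra_simps power2_eq_square)?)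
qed

lemma op2_decomp: "Op2 a000 a010 a001 a100 a011 a110 a101 a200 a111 =
  (add2 (Op2 a000 0 0 0 0 0 0 0 0) (add2 (Op2 0 a010 0 0 0 0 0 0 0) (add2 (Op2 0 0 a001 0 0 0 0 0
      0) (add2 (Op2 0 0 0 a100 0 0 0 0 0) (add2 (Op2 0 0 0 0 a011 0 0 0 0) (add2 (Op2 0 0 0 0 0
      a110 0 0 0) (add2 (Op2 0 0 0 0 0 0 a101 0 0) (add2 (Op2 0 0 0 0 0 0 0 a200 0) (Op2 0 0 0 0 0
      0 0 0 a111)))))))))"
  by simp

lemma qmap_equiv:
  assumes h: "hom_osp F" and "d \<noteq> 0" "d - 1 \<noteq> 0" "d - 2 \<noteq> 0" "2*d - 1 \<noteq>
      0" "2*d-3 \<noteq> 0"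
  shows "qmap l d (gact l (l + d) F x) = act l (l + d) F (qmap l d x)"
proof -
  define P where "P x \<longleftrightarrow> qmap l d (gact l (l + d) F x) = act l (l + d) F (qmap l
      d x)" for x
  have add: "P (add2 x y)" if "P x" "P y" for x y
    using that by (simp add: P_def gact_add[OF h] act_add[OF h] qmap_add)
  note single = qmap_equiv_single[OF assms]
  have "P x"
  proof (cases x)
    case (Op2 a000 a010 a001 a100 a011 a110 a101 a200 a111)
    have "x = (add2 (Op2 a000 0 0 0 0 0 0 0 0) (add2 (Op2 0 a010 0 0 0 0 0 0 0) (add2 (Op2 0 0 a001
        0 0 0 0 0 0) (add2 (Op2 0 0 0 a100 0 0 0 0 0) (add2 (Op2 0 0 0 0 a011 0 0 0 0) (add2 (Op2 0
        0 0 0 0 a110 0 0 0) (add2 (Op2 0 0 0 0 0 0 a101 0 0) (add2 (Op2 0 0 0 0 0 0 0 a200 0) (Op2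
        0 0 0 0 0 0 0 0 a111)))))))))"
      unfolding Op2 by (rule op2_decomp)
    then show ?thesis by (simp only:) (intro add; unfold P_def; rule single)
  qed
  then show ?thesis by (simp add: P_def)
qed

section \<open>Bijectivity and compatibility with the filtration\<close>

lemma coef_inject: "coef x = coef y \<Longrightarrow> x = y"
proof (cases x; cases y)
  fix a b1 b2 c1 c2 e1 e2 u v a' b1' b2' c1' c2' e1' e2' u' v'
  assume xy: "coef x = coef y" and x: "x = Op2 a b1 b2 c1 c2 e1 e2 u v" and y: "y = Op2 a' b1' b2'
      c1' c2' e1' e2' u' v'"
  have *: "coef x l m n = coef y l m n" for l m n using xy by simp
  show "x = y"
    using *[of 0 False False] *[of 0 True False] *[of 0 False True] *[of 0 True True]
      *[of 1 False False] *[of 1 True False] *[of 1 False True] *[of 1 True True] *[of 2 False False]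
    by (simp add: x y)
qed

lemma inj_dop_of: "inj dop_of"
proof (rule injI)
  fix x y assume "dop_of x = dop_of y"
  then have "coef x = coef y" by (simp add: dop_of_def fdop_def fun_eq_iff rep_inject[symmetric])
  then show "x = y" by (rule coef_inject)
qed

lemma Dk_4_eq: "Dk 4 = range dop_of"
  using dop_of_in_Dk by (auto elim: Dk_dop_of)

lemma coef_add2: "coef (add2 x y) l m n = coef x l m n + coef y l m n"
  by (cases x; cases y) simp

lemma coef_sc2: "coef (sc2 c x) l m n = sc c (coef x l m n)"
  by (cases x) simp

lemma dadd_dop_of: "dadd (dop_of x) (dop_of y) = dop_of (add2 x y)"
  by (simp add: dadd_def dop_of_def fdop_def rep_ops coef_add2)

lemma dsc_dop_of: "dsc c (dop_of x) = dop_of (sc2 c x)"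
  by (simp add: dsc_def dop_of_def fdop_def rep_ops coef_sc2)

lemma inj_qmap: "inj (qmap l d)"
proof (rule injI)
  fix x y assume "qmap l d x = qmap l d y"
  then show "x = y" by (cases x; cases y) auto
qed

text \<open>The map is unitriangular for the order, so a preimage is found by back-substitution from
  the top order down, and additivity assembles the pieces.\<close>

lemma surj_qmap: "surj (qmap l d)"
proof (rule surjI)
  fix y :: op2
  have "\<exists>x. qmap l d x = y"
  proof (cases y)
    case (Op2 a b1 b2 c1 c2 e1 e2 u v)
    \<comment> \<open>What the order-2 coefficients u and v contribute to the entries of order 3/2
      is subtracted beforehand. The corrections at the orders 1, 1/2 and 0 follow with C, B and
      A.\<close>
    let ?e1 = "e1 - (sc (1 / (d - 2)) (E1 u) + sc ((1 + l) / (d - 2)) (E2 v))"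
    let ?e2 = "e2 - (sc (1 / (d - 2)) (E2 u) - sc ((1 + l) / (d - 2)) (E1 v))"
    obtain A B1 B2 C1 C2 where low: "qmap l d (Op2 0 0 0 0 0 ?e1 ?e2 u v) = Op2 A B1 B2 C1 C2 e1 e2 u v"
      by simp
    obtain A' B1' B2' where low2: "qmap l d (Op2 0 0 0 (c1 - C1) (c2 - C2) 0 0 0 0) = Op2 A' B1'
        B2' (c1 - C1) (c2 - C2) 0 0 0 0"
      by (simp add: E_linear dx_linear)
    obtain A'' where low3: "qmap l d (Op2 0 (b1 - B1 - B1') (b2 - B2 - B2') 0 0 0 0 0 0) = Op2 A''
        (b1 - B1 - B1') (b2 - B2 - B2') 0 0 0 0 0 0"
      by (simp add: E_linear dx_linear)
    have low4: "qmap l d (Op2 (a - A - A' - A'') 0 0 0 0 0 0 0 0) = Op2 (a - A - A' - A'') 0 0 0 0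
        0 0 0 0"
      by (simp add: E_linear dx_linear)
    have "qmap l d (add2 (Op2 0 0 0 0 0 ?e1 ?e2 u v) (add2 (Op2 0 0 0 (c1 - C1) (c2 - C2) 0 0 0 0)
      (add2 (Op2 0 (b1 - B1 - B1') (b2 - B2 - B2') 0 0 0 0 0 0) (Op2 (a - A - A' - A'') 0 0 0 0 0 0
          0 0)))) = y"
      unfolding qmap_add low low2 low3 low4 by (simp add: Op2)
    then show ?thesis by blast
  qed
  then show "qmap l d (SOME x. qmap l d x = y) = y" by (rule someI_ex)
qed

definition Qmap :: "complex \<Rightarrow> complex \<Rightarrow> dop \<Rightarrow> dop" where
  "Qmap l d A = dop_of (qmap l d (inv dop_of A))"

lemma Qmap_dop_of: "Qmap l d (dop_of x) = dop_of (qmap l d x)"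
  by (simp add: Qmap_def inv_f_f[OF inj_dop_of])

lemma bij_Qmap: "bij_betw (Qmap l d) (Dk 4) (Dk 4)"
proof -
  have "inj_on (Qmap l d) (Dk 4)"
    by (auto simp: inj_on_def Dk_4_eq Qmap_dop_of dest!: injD[OF inj_dop_of] injD[OF inj_qmap])
  moreover have "Qmap l d ` Dk 4 = Dk 4"
  proof -
    have "Qmap l d ` Dk 4 = dop_of ` range (qmap l d)"
      by (simp add: Dk_4_eq image_image Qmap_dop_of)
    then show ?thesis by (simp add: surj_qmap Dk_4_eq)
  qed
  ultimately show ?thesis by (simp add: bij_betw_def)
qed

lemma lin_Qmap: "lin_on (Dk 4) (Qmap l d)"
  by (auto simp: lin_on_def Dk_4_eq dadd_dop_of dsc_dop_of Qmap_dop_of qmap_add qmap_sc)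

lemma top_Qmap:
  assumes "K \<le> 4" "S \<in> Dk 4" "top K S = S"
  shows "Qmap l d S \<in> Dk K \<and> top K (Qmap l d S) = S"
proof -
  obtain x where S: "S = dop_of x" using assms(2) by (rule Dk_dop_of)
  with assms(3) have x: "top2 K x = x" by (auto simp: top_dop_of dest: injD[OF inj_dop_of])
  have K: "K = 0 \<or> K = 1 \<or> K = 2 \<or> K = 3 \<or> K = 4" using assms(1) by auto
  have "top2 K (qmap l d x) = x"
    using K by (subst (1 2) x[symmetric]; cases x) (auto simp: E_linear dx_linear)
  moreover have "coef (qmap l d x) i m n = 0" if "K < wt i m n" for i m n
    using K that by (subst x[symmetric]; cases x; cases m; cases n) (auto simp: wt_def E_linear
        dx_linear)
  ultimately show ?thesis using dop_of_in_Dk[of "qmap l d x"]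
    by (simp add: S Qmap_dop_of top_dop_of Dk_def filt_def) (simp add: dop_of_def fdop_def rep_eq_szero)
qed

section \<open>Entries of the quantization map as differential operators\<close>

definition diffop :: "(ssf \<Rightarrow> ssf) \<Rightarrow> bool" where
  "diffop T \<longleftrightarrow> (\<exists>a I. finite I \<and> (\<forall>l m n. l \<notin> I
      \<longrightarrow> a l m n = 0) \<and> (\<forall>g. T g = (\<Sum>l\<in>I. term_at a l g)))"

lemma diffop_dop:
  assumes "diffop T" shows "\<exists>p. valid_dop p \<and> (\<forall>a. dapply p (rep a) = rep (T a))"
proof -
  obtain a I where I: "finite I" "\<And>l m n. l \<notin> I \<Longrightarrow> a l m n = 0"
      "\<And>g. T g = (\<Sum>l\<in>I. term_at a l g)"
    using assms unfolding diffop_def by metis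
  have "dsupp (fdop a) \<subseteq> I" using I(2) by (auto simp: dsupp_fdop)
  then have "valid_dop (fdop a)" using I(1) finite_subset by (auto simp: valid_dop_def fdop_def
      smooth_rep)
  moreover have "dapply (fdop a) (rep g) = rep (T g)" for g using dapply_fdop[OF I(1,2)] I(3) by simp
  ultimately show ?thesis by blast
qed

lemma diffop_add: assumes "diffop T" "diffop U" shows "diffop (\<lambda>g. T g + U g)"
proof -
  obtain a I where I: "finite I" "\<And>l m n. l \<notin> I \<Longrightarrow> a l m n = 0"
      "\<And>g. T g = (\<Sum>l\<in>I. term_at a l g)"
    using assms unfolding diffop_def by metis
  obtain b J where J: "finite J" "\<And>l m n. l \<notin> J \<Longrightarrow> b l m n = 0"
      "\<And>g. U g = (\<Sum>l\<in>J. term_at b l g)"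
    using assms unfolding diffop_def by metis
  have 1: "T g = (\<Sum>l\<in>I \<union> J. term_at a l g)" for g
    unfolding I(3) by (rule sum.mono_neutral_left) (use I J in \<open>auto simp: term_at_def\<close>)
  have 2: "U g = (\<Sum>l\<in>I \<union> J. term_at b l g)" for g
    unfolding J(3) by (rule sum.mono_neutral_left) (use I J in \<open>auto simp: term_at_def\<close>)
  have 3: "term_at (\<lambda>l m n. a l m n + b l m n) l g = term_at a l g + term_at b l g" for l g
    by (simp add: term_at_def algebra_simps)
  have "T g + U g = (\<Sum>l\<in>I \<union> J. term_at (\<lambda>l m n. a l m n + b l m n) l g)" for g
    unfolding 1 2 3 sum.distrib ..
  moreover have "a l m n + b l m n = 0" if "l \<notin> I \<union> J" for l m n using I(2) J(2) that
      by simp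
  ultimately show ?thesis using I(1) J(1) unfolding diffop_def
    by (intro exI[of _ "\<lambda>l m n. a l m n + b l m n"] exI[of _ "I \<union> J"]) auto
qed

lemma diffop_base:
  "diffop (\<lambda>g. b * (dx ^^ l) g)" "diffop (\<lambda>g. b * (dx ^^ l) (D1 g))"
  "diffop (\<lambda>g. b * (dx ^^ l) (D2 g))" "diffop (\<lambda>g. b * (dx ^^ l) (D1 (D2 g)))"
proof -
  have "diffop (\<lambda>g. term_at (\<lambda>l' m' n'. if l' = l \<and> m' = m \<and> n' = n then
      b else 0) l g)" for m n
    unfolding diffop_def
    by (rule exI[of _ "\<lambda>l' m' n'. if l' = l \<and> m' = m \<and> n' = n then b else 0"],
        rule exI[of _ "{l}"]) auto
  from this[of False False] this[of True False] this[of False True] this[of True True]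
  show "diffop (\<lambda>g. b * (dx ^^ l) g)" "diffop (\<lambda>g. b * (dx ^^ l) (D1 g))"
  "diffop (\<lambda>g. b * (dx ^^ l) (D2 g))" "diffop (\<lambda>g. b * (dx ^^ l) (D1 (D2 g)))"
    by (simp_all add: term_at_def)
qed

text \<open>\<open>star\<close> is itself a differential operator, namely (1 - 2 xi1 D1)(1 - 2 xi2
  D2), since xi_i D_i equals xi_i d/dxi_i. Composing with D1 or D2 and moving the coefficients to
  the left gives these expansions, which have the normal form that \<open>diff_expr\<close>
  demands.\<close>

lemma E_expand:
  "E1 a = - D1 a - sc 2 (X1 * dx a) - sc 2 (X2 * D1 (D2 a)) + sc 4 (X1 * (X2 * dx (D2 a)))"
  "E2 a = - D2 a + sc 2 (X1 * D1 (D2 a)) - sc 2 (X2 * dx a) - sc 4 (X1 * (X2 * dx (D1 a)))"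
  unfolding E1_def E2_def by (transfer; simp add: component_defs dr_simps)+

lemma dx_pow_diff: "(dx ^^ l) (a - b) = (dx ^^ l) a - (dx ^^ l) b"
  by (induction l) (auto simp: dx_diff)

lemma dx_pow_sc: "(dx ^^ l) (sc c a) = sc c ((dx ^^ l) a)"
  by (induction l) (auto simp: dx_sc)

lemma diffop_E:
  "diffop (\<lambda>g. sc c ((dx ^^ l) g))" "diffop (\<lambda>g. sc c ((dx ^^ l) (E1 (E2 g))))"
  "diffop (\<lambda>g. sc c ((dx ^^ l) (E1 g)))" "diffop (\<lambda>g. sc c ((dx ^^ l) (E2 g)))"
proof -
  have "(\<lambda>g. sc c ((dx ^^ l) g)) = (\<lambda>g. sc c 1 * (dx ^^ l) g)" by simp
  then show "diffop (\<lambda>g. sc c ((dx ^^ l) g))" by (simp only: diffop_base)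
  \<comment> \<open>The two twists cancel up to a sign, so this composite has constant
    coefficients.\<close>
  have "E1 (E2 g) = - D1 (D2 g)" for g by (simp add: E1_def E2_def op_linear)
  then have "(\<lambda>g. sc c ((dx ^^ l) (E1 (E2 g)))) = (\<lambda>g. sc (- c) 1 * (dx ^^ l) (D1
      (D2 g)))"
    by (simp only: dx_pow_uminus) (simp add: ssf_eq_iff rep_arith fun_eq_iff)
  then show "diffop (\<lambda>g. sc c ((dx ^^ l) (E1 (E2 g))))" by (simp only: diffop_base)
  have "sc c ((dx ^^ l) (E1 g)) = (sc (- c) 1 * (dx ^^ l) (D1 g) + sc (-2*c) X1 * (dx ^^ Suc l) g)
     + (sc (-2*c) X2 * (dx ^^ l) (D1 (D2 g)) + sc (4*c) (X1 * X2) * (dx ^^ Suc l) (D2 g))" for g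
    unfolding E_expand dx_pow_uminus dx_pow_diff dx_pow_add dx_pow_sc dx_pow_X dx_pow_dx ssf_eq_iff
      mult.assoc sc_mult_left rep_arith sc_linear by (simp add: algebra_simps)
  then show "diffop (\<lambda>g. sc c ((dx ^^ l) (E1 g)))" by (simp only: diffop_base diffop_add)
  have "sc c ((dx ^^ l) (E2 g)) = (sc (- c) 1 * (dx ^^ l) (D2 g) + sc (2*c) X1 * (dx ^^ l) (D1 (D2 g)))
     + (sc (-2*c) X2 * (dx ^^ Suc l) g + sc (-4*c) (X1 * X2) * (dx ^^ Suc l) (D1 g))" for g
    unfolding E_expand dx_pow_uminus dx_pow_diff dx_pow_add dx_pow_sc dx_pow_X dx_pow_dx ssf_eq_iff
      mult.assoc sc_mult_left rep_arith sc_linear by (simp add: algebra_simps)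
  then show "diffop (\<lambda>g. sc c ((dx ^^ l) (E2 g)))" by (simp only: diffop_base diffop_add)
qed


lemma diffop_kinds:
  "diffop (\<lambda>g. 0)" "diffop (\<lambda>g. g)"
  "diffop (\<lambda>g. sc c (dx g))" "diffop (\<lambda>g. sc c (dx (dx g)))" "diffop (\<lambda>g.
      sc c (E1 g))" "diffop (\<lambda>g. sc c (E2 g))"
  "diffop (\<lambda>g. sc c (E1 (E2 g)))" "diffop (\<lambda>g. sc c (dx (E1 g)))" "diffop
      (\<lambda>g. sc c (dx (E2 g)))"
  "diffop (\<lambda>g. sc c (dx (E1 (E2 g))))"
  using diffop_E[of c 0] diffop_E[of c 1] diffop_E(1)[of c 2] diffop_E(1)[of 0 0] diffop_E(1)[of 1 0]
  by (simp_all add: numeral_2_eq_2)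

lemma diffop_uminus: "diffop (\<lambda>g. - sc c (T g))" if "diffop (\<lambda>g. sc (- c) (T g))"
proof -
  have "(\<lambda>g. - sc c (T g)) = (\<lambda>g. sc (- c) (T g))" by (simp add: ssf_eq_iff
      rep_arith fun_eq_iff)
  with that show ?thesis by simp
qed

definition single :: "nat \<Rightarrow> bool \<Rightarrow> bool \<Rightarrow> ssf \<Rightarrow>
    op2" where
  "single l m n a = Op2
     (if l = 0 \<and> \<not> m \<and> \<not> n then a else 0) (if l = 0 \<and> m \<and> \<not> n
         then a else 0)
     (if l = 0 \<and> \<not> m \<and> n then a else 0) (if l = 1 \<and> \<not> m \<and> \<not> n
         then a else 0)
     (if l = 0 \<and> m \<and> n then a else 0) (if l = 1 \<and> m \<and> \<not> n then a else 0)
     (if l = 1 \<and> \<not> m \<and> n then a else 0) (if l = 2 \<and> \<not> m \<and> \<not> n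
         then a else 0)
     (if l = 1 \<and> m \<and> n then a else 0)"

lemma diffop_entry: "diffop (\<lambda>a. coef (qmap c d (single l' m' n' a)) l m n)"
proof -
  have l': "l' = 0 \<or> l' = 1 \<or> l' = 2 \<or> 2 < l'" and l: "l = 0 \<or> l = 1 \<or> l = 2
      \<or> 2 < l" by auto
  have src: "(\<lambda>a. single l' m' n' a) \<in> {\<lambda>a. Op2 0 0 0 0 0 0 0 0 0,
    \<lambda>a. Op2 a 0 0 0 0 0 0 0 0, \<lambda>a. Op2 0 a 0 0 0 0 0 0 0, \<lambda>a. Op2 0 0 a 0 0
        0 0 0 0,
    \<lambda>a. Op2 0 0 0 a 0 0 0 0 0, \<lambda>a. Op2 0 0 0 0 a 0 0 0 0, \<lambda>a. Op2 0 0 0 0 0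
        a 0 0 0,
    \<lambda>a. Op2 0 0 0 0 0 0 a 0 0, \<lambda>a. Op2 0 0 0 0 0 0 0 a 0, \<lambda>a. Op2 0 0 0 0 0
        0 0 0 a}"
    using l' by (cases m'; cases n') (auto simp: single_def)
  have "diffop (\<lambda>a. coef (qmap c d (T a)) l m n)" if "T \<in> {\<lambda>a. Op2 0 0 0 0 0 0
      0 0 0,
    \<lambda>a. Op2 a 0 0 0 0 0 0 0 0, \<lambda>a. Op2 0 a 0 0 0 0 0 0 0, \<lambda>a. Op2 0 0 a 0 0
        0 0 0 0,
    \<lambda>a. Op2 0 0 0 a 0 0 0 0 0, \<lambda>a. Op2 0 0 0 0 a 0 0 0 0, \<lambda>a. Op2 0 0 0 0 0
        a 0 0 0,
    \<lambda>a. Op2 0 0 0 0 0 0 a 0 0, \<lambda>a. Op2 0 0 0 0 0 0 0 a 0, \<lambda>a. Op2 0 0 0 0 0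
        0 0 0 a}" for T
    using that unfolding insert_iff empty_iff
    by (elim disjE FalseE; simp only:; cases "l = 0"; cases "l = 1"; cases "l = 2"; cases m; cases n;
      simp add: E_linear dx_linear sc_uminus diffop_kinds diffop_uminus)
  from this[OF src] show ?thesis .
qed

text \<open>The matrix of operators is read off by feeding \<open>qmap\<close> operators with a
  single coefficient; additivity then recovers its value on every operator.\<close>

lemma diff_expr_Qmap: "diff_expr (Qmap c d)"
proof -
  define P where "P l m n l' m' n' =
    (SOME p. valid_dop p \<and> (\<forall>a. dapply p (rep a) = rep (coef (qmap c d (single l' m'
        n' a)) l m n)))"
    for l m n l' m' n'
  have "valid_dop (P l m n l' m' n') \<and>
     (\<forall>a. dapply (P l m n l' m' n') (rep a) = rep (coef (qmap c d (single l' m' n' a)) l m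
         n))" for l m n l' m' n'
    unfolding P_def by (rule someI_ex[OF diffop_dop[OF diffop_entry[of c d l' m' n' l m n]]])
  then have P: "\<And>l m n l' m' n'. valid_dop (P l m n l' m' n')"
    "\<And>l m n l' m' n' a. dapply (P l m n l' m' n') (rep a) = rep (coef (qmap c d (single l' m'
        n' a)) l m n)"
    by blast+
  have sum: "(\<Sum>l'\<le>2. \<Sum>m'\<in>UNIV. \<Sum>n'\<in>UNIV. coef (qmap c d (single l' m' n'
      (coef x l' m' n'))) l m n)
      = coef (qmap c d x) l m n" for x l m n
  proof (cases x)
    case (Op2 a000 a010 a001 a100 a011 a110 a101 a200 a111)
    have z: "qmap c d (Op2 0 0 0 0 0 0 0 0 0) = Op2 0 0 0 0 0 0 0 0 0" by (simp add: E_linear dx_linear)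
    have s: "{..2::nat} = {0,1,2}" by auto
    note R = arg_cong[OF op2_decomp[of a000 a010 a001 a100 a011 a110 a101 a200 a111],
      of "\<lambda>x. coef (qmap c d x) l m n", unfolded qmap_add coef_add2]
    show ?thesis
      by (simp add: s Op2 UNIV_bool single_def z R add_ac del: qmap.simps)
  qed
  show ?thesis unfolding diff_expr_def
  proof (intro exI[of _ P] conjI allI ballI)
    show "valid_dop (P l m n l' m' n')" for l m n l' m' n' by (rule P)
    fix S l m n assume "S \<in> Dk 4"
    then obtain x where S: "S = dop_of x" by (rule Dk_dop_of)
    show "Qmap c d S l m n = (\<lambda>a b t. \<Sum>l'\<le>2. \<Sum>m'\<in>UNIV. \<Sum>n'\<in>UNIV.
        dapply (P l m n l' m' n') (S l' m' n') a b t)"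
      unfolding S Qmap_dop_of unfolding dop_of_def fdop_def P(2) rep_sum[symmetric] sum by (rule refl)
  qed
qed

lemma quantization_Qmap: "quantization (Qmap c d)"
  by (auto simp: quantization_def bij_Qmap lin_Qmap diff_expr_Qmap top_Qmap)

section \<open>Equivariance of the explicit map\<close>

lemma osp22_rep:
  assumes "f \<in> osp22" "is_even f \<or> is_odd f"
  obtains F where "f = rep F" "hom_osp F"
proof -
  obtain c :: "nat \<Rightarrow> complex" where c: "f = (\<lambda>a b t.
      if \<not> a \<and> \<not> b then c 0 + c 1 * complex_of_real t + c 2 * (complex_of_real t)^2
      else if a \<and> \<not> b then c 4 + c 5 * complex_of_real t
      else if \<not> a \<and> b then c 6 + c 7 * complex_of_real t
      else c 3)" using assms(1) unfolding osp22_def by blast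
  have "smooth_sf f" unfolding smooth_sf_iff c
    by simp
  then obtain F where F: "f = rep F" by (rule smooth_sfE)
  have sq: "dr (\<lambda>t. complex_of_real t ^ 2) = (\<lambda>t. 2 * complex_of_real t)"
    unfolding power2_eq_square by (simp add: dr_mult)
  have lin: "dr (\<lambda>t. b * complex_of_real t) = (\<lambda>t. b)" for b by (simp add: dr_mult)
  have d1: "dr (\<lambda>t. a + b * complex_of_real t) = (\<lambda>t. b)" for a b
    by (subst dr_add) (auto simp: lin)
  have d2: "dr (\<lambda>t. a + b * complex_of_real t + e * (complex_of_real t)^2) = (\<lambda>t. b
      + (2 * e) * complex_of_real t)" for a b e
    by (subst dr_add) (auto simp: d1 dr_mult sq)
  have "osp_sf F"
  proof -
    have z: "rep (D1 (dx (dx F))) = szero" "rep (D2 (dx (dx F))) = szero" "rep (D1 (D2 (dx F))) = szero"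
      unfolding rep_ops(6-8)[symmetric] F[symmetric] c
      by (simp_all add: component_defs d1 d2)
    then show ?thesis by (simp add: osp_sf_def rep_eq_szero)
  qed
  moreover have "star F = F \<or> star F = - F" using assms(2) by (simp add: F is_even_rep is_odd_rep)
  ultimately show thesis using F that by (auto simp: hom_osp_def)
qed

lemma equivariant_Qmap:
  assumes "mu - lam \<notin> {0, 1/2, 1, 3/2, 2}"
  shows "equivariant lam mu (Qmap lam (mu - lam))"
  unfolding equivariant_def
proof (intro ballI impI)
  fix f S assume f: "f \<in> osp22" "is_even f \<or> is_odd f" and "S \<in> Dk 4"
  obtain F where F: "f = rep F" "hom_osp F" using f by (rule osp22_rep)
  obtain x where S: "S = dop_of x" using \<open>S \<in> Dk 4\<close> by (rule Dk_dop_of)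
  have h: "star F = F \<or> star F = - F" "osp_sf F" using F by (auto simp: hom_osp_def)
  define d where "d = mu - lam"
  have mu: "mu = lam + d" by (simp add: d_def)
  \<comment> \<open>The five excluded values are exactly the zeros of these factors.\<close>
  have nz: "d \<noteq> 0" "d - 1 \<noteq> 0" "d - 2 \<noteq> 0" "2 * d - 1 \<noteq> 0" "2 * d - 3
      \<noteq> 0"
    using assms by (auto simp: d_def[symmetric] field_simps)
  show "Qmap lam (mu - lam) (gract lam mu f S) = dact lam mu f (Qmap lam (mu - lam) S)"
    unfolding F S gract_dop_of[OF F(2)] Qmap_dop_of dact_dop_of[OF h] d_def[symmetric]
    unfolding mu qmap_equiv[OF F(2) nz] by (rule refl)
qed

section \<open>Jets of functionals\<close>

text \<open>Only values on body functions are prescribed; the odd sectors are reached in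
  \<open>jets\<close> by multiplication with X1 and X2. The number M of derivatives stays
  unspecified because \<open>diff_expr\<close> puts no bound on the order of its operators.\<close>

definition jet :: "real \<Rightarrow> (ssf \<Rightarrow> complex) \<Rightarrow> bool" where
  "jet t L \<longleftrightarrow> (\<exists>M c. \<forall>m. body m \<longrightarrow> L m =
      (\<Sum>k<M. c k * rep ((dx ^^ k) m) False False t))"

lemma jet_base: "jet t (\<lambda>m. b * rep ((dx ^^ k) m) False False t)"
  unfolding jet_def
  by (rule exI[of _ "Suc k"], rule exI[of _ "\<lambda>i. if i = k then b else 0"])
    (simp add: if_distrib[of "\<lambda>x. x * _"] sum.delta cong: if_cong)

lemma jet_0: "jet t (\<lambda>m. 0)"
  using jet_base[of t 0 0] by simp

lemma jet_add: assumes "jet t L" "jet t L'" shows "jet t (\<lambda>m. L m + L' m)"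
proof -
  obtain M c where L: "\<And>m. body m \<Longrightarrow> L m = (\<Sum>k<M. c k * rep ((dx ^^ k) m)
      False False t)"
    using assms(1) unfolding jet_def by blast
  obtain M' c' where L': "\<And>m. body m \<Longrightarrow> L' m = (\<Sum>k<M'. c' k * rep ((dx ^^
      k) m) False False t)"
    using assms(2) unfolding jet_def by blast
  \<comment> \<open>Padding with zero coefficients brings both sums to the common length M +
    M'.\<close>
  have ext: "(\<Sum>k<n. b k * f k) = (\<Sum>k<n + n'. (if k < n then b k else 0) * f k)"
    for n n' :: nat and b f :: "nat \<Rightarrow> complex"
    by (rule sum.mono_neutral_cong_left) auto
  have "L m + L' m = (\<Sum>k<M + M'. ((if k < M then c k else 0) + (if k < M' then c' k else 0)) *
      rep ((dx ^^ k) m) False False t)"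
    if "body m" for m
    using ext[where n = M and n' = M' and b = c] ext[where n = M' and n' = M and b = c']
    by (simp add: L[OF that] L'[OF that] add.commute[of M' M] distrib_right sum.distrib)
  then show ?thesis unfolding jet_def
    by (intro exI[of _ "M + M'"] exI[of _ "\<lambda>k. (if k < M then c k else 0) + (if k < M' then
        c' k else 0)"]) blast
qed

lemma jet_sum: assumes "\<And>i. i \<in> I \<Longrightarrow> jet t (L i)" shows "jet t (\<lambda>m.
    \<Sum>i\<in>I. L i m)"
  using assms by (induction I rule: infinite_finite_induct) (simp_all add: jet_0 jet_add)

lemma jet_uminus: assumes "jet t L" shows "jet t (\<lambda>m. - L m)"
proof -
  obtain M c where L: "\<And>m. body m \<Longrightarrow> L m = (\<Sum>k<M. c k * rep ((dx ^^ k) m)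
      False False t)"
    using assms(1) unfolding jet_def by blast
  then show ?thesis unfolding jet_def
    by (intro exI[of _ M] exI[of _ "\<lambda>k. - c k"]) (simp add: sum_negf)
qed

lemma jet_diff: "jet t L \<Longrightarrow> jet t L' \<Longrightarrow> jet t (\<lambda>m. L m - L' m)"
  using jet_add[OF _ jet_uminus, of t L L'] by simp

lemma jet_cong: "jet t L \<Longrightarrow> (\<And>m. body m \<Longrightarrow> L' m = L m)
    \<Longrightarrow> jet t L'"
  unfolding jet_def by auto

lemma jet_term_at:
  "jet t (\<lambda>m. rep (term_at a l m) p q t)" "jet t (\<lambda>m. rep (term_at a l (X1 * m)) p q t)"
  "jet t (\<lambda>m. rep (term_at a l (X2 * m)) p q t)" "jet t (\<lambda>m. rep (term_at a l (X1 *
      (X2 * m))) p q t)"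
proof -
  show "jet t (\<lambda>m. rep (term_at a l m) p q t)"
    by (rule jet_cong[OF _ term_at_body(1)]) (intro jet_add jet_diff jet_base)
  show "jet t (\<lambda>m. rep (term_at a l (X1 * m)) p q t)"
    by (rule jet_cong[OF _ term_at_body(2)]) (intro jet_add jet_diff jet_base)
  show "jet t (\<lambda>m. rep (term_at a l (X2 * m)) p q t)"
    by (rule jet_cong[OF _ term_at_body(3)]) (intro jet_add jet_diff jet_base)
  show "jet t (\<lambda>m. rep (term_at a l (X1 * (X2 * m))) p q t)"
    by (rule jet_cong[OF _ term_at_body(4)]) (intro jet_base)
qed

text \<open>A superfunction is built from four body functions, so these four restrictions determine
  an additive functional.\<close>

definition jets :: "real \<Rightarrow> (ssf \<Rightarrow> complex) \<Rightarrow> bool" where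
  "jets t L \<longleftrightarrow> jet t L \<and> jet t (\<lambda>m. L (X1 * m)) \<and> jet t
      (\<lambda>m. L (X2 * m)) \<and> jet t (\<lambda>m. L (X1 * (X2 * m)))"

lemma jets_diff: "jets t L \<Longrightarrow> jets t L' \<Longrightarrow> jets t (\<lambda>m. L m -
    L' m)"
  by (simp add: jets_def jet_diff)

lemma jets_0: "jets t (\<lambda>m. 0)" by (simp add: jets_def jet_0)

lemma jets_sum: assumes "\<And>i. i \<in> I \<Longrightarrow> jets t (L i)" shows "jets t
    (\<lambda>m. \<Sum>i\<in>I. L i m)"
  using assms by (simp add: jets_def jet_sum)

lemma jets_dapply:
  assumes "valid_dop p" shows "jets t (\<lambda>a. dapply p (rep a) False False t)"
proof -
  obtain a where a: "p = fdop a" "finite {l. \<exists>m n. a l m n \<noteq> 0}" (is "finite ?S")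
      using assms valid_dopE by blast
  have "dapply p (rep g) = rep (\<Sum>l\<in>?S. term_at a l g)" for g
    unfolding a(1) by (rule dapply_fdop[OF a(2)]) blast
  then show ?thesis
    by (simp add: rep_sum jets_def jet_sum jet_term_at)
qed

lemma dapply_0: assumes "valid_dop p" shows "dapply p (rep 0) = szero"
proof -
  obtain a where a: "p = fdop a" "finite {l. \<exists>m n. a l m n \<noteq> 0}" (is "finite ?S")
      using assms valid_dopE by blast
  have "dapply p (rep 0) = rep (\<Sum>l\<in>?S. term_at a l 0)"
    unfolding a(1) by (rule dapply_fdop[OF a(2)]) blast
  also have "(\<Sum>l\<in>?S. term_at a l 0) = 0" by (simp add: term_at_def D1_0 D2_0)
  finally show ?thesis by (simp add: rep_ops)
qed

lemma body_decomp: obtains u0 u1 u2 u3 where "body u0" "body u1" "body u2" "body u3"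
  "a = u0 + X1 * u1 + X2 * u2 + X1 * (X2 * u3)"
proof -
  define e where "e u = ab (\<lambda>p q. if p \<or> q then (\<lambda>t. 0) else u)" for u
  have e: "rep (e u) = (\<lambda>p q. if p \<or> q then (\<lambda>t. 0) else u)" if "smooth_fn u" for u
    unfolding e_def by (rule ab_inverse) (use that in \<open>simp add: smooth_sf_iff\<close>)
  have sm: "smooth_fn (rep a p q)" for p q using smooth_rep[of a] by (simp add: smooth_sf_def)
  show thesis
  proof (rule that[of "e (rep a False False)" "e (rep a True False)" "e (rep a False True)" "e (rep
      a True True)"])
    show "body (e (rep a False False))" "body (e (rep a True False))" "body (e (rep a False True))"
        "body (e (rep a True True))"
      by (simp_all add: body_def e sm)
    have "rep a = rep (e (rep a False False) + X1 * e (rep a True False) + X2 * e (rep a False True)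
      + X1 * (X2 * e (rep a True True)))"
      unfolding plus_ssf.rep_eq times_ssf.rep_eq X1.rep_eq X2.rep_eq e[OF sm] by (simp add:
          component_defs)
    then show "a = e (rep a False False) + X1 * e (rep a True False) + X2 * e (rep a False True)
      + X1 * (X2 * e (rep a True True))" by (simp only: rep_inject)
  qed
qed

text \<open>By duality between divided powers and derivatives at \<open>t0\<close>, the value on the
  i-th divided power is the i-th coefficient of the jet.\<close>

lemma jet_zero:
  assumes "jet t0 L" "\<And>k. L (xpow t0 k) = 0" "body m" shows "L m = 0"
proof -
  obtain M c where L: "\<And>m. body m \<Longrightarrow> L m = (\<Sum>k<M. c k * rep ((dx ^^ k) m)
      False False t0)"
    using assms(1) unfolding jet_def by blast
  have "c i = 0" if "i < M" for i
    using L[OF body_xpow[of t0 i]] that assms(2)[of i]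
    by (simp add: eval_xpow if_distrib[of "\<lambda>x. _ * x"] cong: if_cong)
  then show ?thesis by (simp add: L[OF assms(3)])
qed

lemma jets_zero:
  assumes "jets t0 L" "\<And>a b. L (a + b) = L a + L b"
    "\<And>k. L (xpow t0 k) = 0" "\<And>k. L (X1 * xpow t0 k) = 0" "\<And>k. L (X2 * xpow t0 k) =
        0" "\<And>k. L (X1 * (X2 * xpow t0 k)) = 0"
  shows "L a = 0"
proof -
  have z: "L u = 0" "L (X1 * u) = 0" "L (X2 * u) = 0" "L (X1 * (X2 * u)) = 0" if "body u" for u
    using assms(1) jet_zero[of t0 L, OF _ assms(3) that] jet_zero[of t0 "\<lambda>m. L (X1 * m)",
        OF _ assms(4) that]
      jet_zero[of t0 "\<lambda>m. L (X2 * m)", OF _ assms(5) that] jet_zero[of t0 "\<lambda>m. L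
          (X1 * (X2 * m))", OF _ assms(6) that]
    unfolding jets_def by auto
  obtain u0 u1 u2 u3 where "body u0" "body u1" "body u2" "body u3"
    "a = u0 + X1 * u1 + X2 * u2 + X1 * (X2 * u3)" by (rule body_decomp)
  then show ?thesis by (simp add: assms(2) z)
qed


section \<open>Euler and odd fields acting on monomials\<close>

lemma xpow_0: "xpow t0 0 = 1"
  by transfer (simp add: fun_eq_iff xpow_fn_def sone_def)

lemma body_star: "body m \<Longrightarrow> star m = m"
  unfolding body_def by transfer (simp add: component_defs)

lemma xpow_1_mult: "xpow t0 1 * xpow t0 k = sc (of_nat (Suc k)) (xpow t0 (Suc k))"
proof -
  have o: "of_nat (Suc 0) = (1 :: complex)" and n: "of_nat (Suc k) \<noteq> (0 :: complex)"
    by (simp, simp del: of_nat_Suc)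
  have "xpow_fn t0 1 t * xpow_fn t0 k t = of_nat (Suc k) * xpow_fn t0 (Suc k) t" for t
    unfolding xpow_fn_def using n by (simp add: o field_simps del: of_nat_Suc)
  then show ?thesis by transfer (simp add: component_defs del: of_nat_Suc)
qed

lemma body_comm: assumes "body m" shows "a * m = m * a"
  by (rule even_comm) (rule body_star[OF assms])

lemma hom_osp_basic:
  "hom_osp (xpow t0 1)" "hom_osp (X1 * xpow t0 1)" "hom_osp (X2 * xpow t0 1)" "hom_osp X1" "hom_osp X2"
proof -
  define F where "F = xpow t0 1"
  have b: "body F" unfolding F_def by (rule body_xpow)
  have d: "dx F = 1" "dx (1::ssf) = 0" "D1 (1::ssf) = 0" "D2 (1::ssf) = 0"
    using xpow_dx[of t0 1] xpow_dx[of t0 0] body_D[OF body_xpow[of t0 0]] by (simp_all add: xpow_0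
        F_def)
  show "hom_osp (xpow t0 1)" "hom_osp (X1 * xpow t0 1)" "hom_osp (X2 * xpow t0 1)" "hom_osp X1"
      "hom_osp X2"
    unfolding F_def[symmetric]
    by (simp_all add: hom_osp_def osp_sf_def body_star[OF b] star_mult X_simps d dx_0 D1_0 D2_0
        dx_mult D1_mult D2_mult)
qed

lemma osp_fields:
  fixes t0 defines "m \<equiv> xpow t0 1"
  shows "star m = m" "dx m = 1" "D1 m = - X1" "D2 m = - X2" "D1 (D2 m) = 0"
    "star (X1 * m) = - (X1 * m)" "dx (X1 * m) = X1" "D1 (X1 * m) = m" "D2 (X1 * m) = X1 * X2" "D1
        (D2 (X1 * m)) = X2"
    "star (X2 * m) = - (X2 * m)" "dx (X2 * m) = X2" "D1 (X2 * m) = - (X1 * X2)" "D2 (X2 * m) = m"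
        "D1 (D2 (X2 * m)) = - X1"
proof -
  have b: "body m" unfolding m_def by (rule body_xpow)
  show 1: "star m = m" "dx m = 1" "D1 m = - X1" "D2 m = - X2"
    using b by (simp_all add: body_star m_def xpow_dx xpow_0 body_D)
  show "D1 (D2 m) = 0" by (simp add: 1 D1_uminus X_simps)
  show "star (X1 * m) = - (X1 * m)" "star (X2 * m) = - (X2 * m)" "dx (X1 * m) = X1" "dx (X2 * m) = X2"
    by (simp_all add: star_mult X_simps 1 dx_mult)
  show 2: "D1 (X1 * m) = m" "D2 (X1 * m) = X1 * X2" "D1 (X2 * m) = - (X1 * X2)" "D2 (X2 * m) = m"
    by (simp_all add: D_body[OF b] 1)
  show "D1 (D2 (X1 * m)) = X2" "D1 (D2 (X2 * m)) = - X1"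
    by (simp_all add: 2 1 D1_mult X_simps)
qed

text \<open>Up to the shift by w the Euler field measures a weight in which x - t0 counts 1 and each
  xi counts 1/2. The fields xi_i (x - t0) raise this weight by 1/2 and so relate monomials of
  neighbouring weights.\<close>

lemma Lie_xpow:
  fixes t0 k w defines "F \<equiv> xpow t0 1" and "m \<equiv> xpow t0 k"
  shows "Lie w F m = sc (of_nat k + w) m"
    "Lie w F (X1 * m) = sc (of_nat k + 1/2 + w) (X1 * m)"
    "Lie w F (X2 * m) = sc (of_nat k + 1/2 + w) (X2 * m)"
    "Lie w F (X1 * (X2 * m)) = sc (of_nat k + 1 + w) (X1 * (X2 * m))"
    "Lie w (X1 * F) m = sc (of_nat k / 2 + w) (X1 * m)"
    "Lie w (X2 * F) m = sc (of_nat k / 2 + w) (X2 * m)"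
    "Lie w (X1 * F) (X1 * m) = sc (of_nat (Suc k) / 2) (xpow t0 (Suc k))"
    "Lie w (X2 * F) (X2 * m) = sc (of_nat (Suc k) / 2) (xpow t0 (Suc k))"
    "Lie w (X1 * F) (X2 * m) = sc (of_nat (Suc k) / 2 + w) (X1 * (X2 * m))"
    "Lie w (X2 * F) (X1 * m) = - sc (of_nat (Suc k) / 2 + w) (X1 * (X2 * m))"
proof -
  note f = osp_fields[of t0, folded F_def]
  have b: "body m" "body F" unfolding m_def F_def by (rule body_xpow)+
  have Fm: "F * m = sc (of_nat (Suc k)) (xpow t0 (Suc k))" unfolding F_def m_def by (rule xpow_1_mult)
  have Fdm: "F * dx m = sc (of_nat k) m"
    using xpow_1_mult[of t0 "k - 1"] by (cases k) (simp_all add: F_def m_def xpow_dx del: of_nat_Suc)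
  have c: "F * X1 = X1 * F" "F * X2 = X2 * F" by (simp_all add: body_comm[OF b(2)])
  have cl: "F * (X1 * a) = X1 * (F * a)" "F * (X2 * a) = X2 * (F * a)" for a
    by (simp_all add: mult.assoc[symmetric] c)
  have XF: "star (X1 * F) = - (X1 * F)" "star (X2 * F) = - (X2 * F)" by (rule f)+
  note simps = Lie_even[OF f(1)] Lie_odd[OF XF(1)] Lie_odd[OF XF(2)] f D_body[OF b(1)] dx_mult
      X_simps X_assoc mult.assoc cl
    Fm Fdm
  show "Lie w F m = sc (of_nat k + w) m"
    "Lie w F (X1 * m) = sc (of_nat k + 1/2 + w) (X1 * m)"
    "Lie w F (X2 * m) = sc (of_nat k + 1/2 + w) (X2 * m)"
    "Lie w F (X1 * (X2 * m)) = sc (of_nat k + 1 + w) (X1 * (X2 * m))"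
    "Lie w (X1 * F) m = sc (of_nat k / 2 + w) (X1 * m)"
    "Lie w (X2 * F) m = sc (of_nat k / 2 + w) (X2 * m)"
    "Lie w (X1 * F) (X1 * m) = sc (of_nat (Suc k) / 2) (xpow t0 (Suc k))"
    "Lie w (X2 * F) (X2 * m) = sc (of_nat (Suc k) / 2) (xpow t0 (Suc k))"
    "Lie w (X1 * F) (X2 * m) = sc (of_nat (Suc k) / 2 + w) (X1 * (X2 * m))"
    "Lie w (X2 * F) (X1 * m) = - sc (of_nat (Suc k) / 2 + w) (X1 * (X2 * m))"
    by (simp_all add: simps) (simp_all add: ssf_eq_iff rep_arith field_simps)
qed

section \<open>Vanishing of functionals off resonance\<close>

lemma pair_zero:
  fixes s r x y :: complex
  assumes "s * x + r * y = 0" "s * y + r * x = 0" "s\<^sup>2 \<noteq> r\<^sup>2"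
  shows "x = 0"
proof -
  have "(s\<^sup>2 - r\<^sup>2) * x = s * (s * x + r * y) - r * (s * y + r * x)"
    by (simp add: algebra_simps power2_eq_square)
  then show ?thesis using assms by simp
qed

lemma weight_zero:
  fixes \<kappa> w c x :: complex
  assumes "(\<kappa> + w) * x = (w + c / 2) * x" "2 * \<kappa> \<noteq> c" shows "x = 0"
proof -
  have "(2 * \<kappa> - c) * x = 2 * ((\<kappa> + w) * x - (w + c / 2) * x)" by (simp add:
      algebra_simps)
  then show ?thesis using assms by simp
qed

lemma of_nat_neq: "m \<noteq> n \<Longrightarrow> of_nat m \<noteq> (of_nat n :: complex)"
  by simp

text \<open>Here \<phi> and \<psi> stand for the contributions of the two components of a symbol to
  one coefficient at \<open>t0\<close>, j for twice the drop in order, and \<rho> for the strength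
  of the rotation between the components. The Euler relation leaves only monomials of weight j/2:
  for even j these are (x - t0)^(j/2) and X1 X2 (x - t0)^(j/2 - 1), for odd j they are X1 and X2
  times (x - t0)^((j - 1)/2). The relations for the odd fields have right-hand side 0 because these
  fields contribute nothing to the body value of a coefficient at \<open>t0\<close>.\<close>

lemma functional_zero:
  fixes \<phi> \<psi> :: "ssf \<Rightarrow> complex" and w \<rho> :: complex and j :: nat
  assumes add: "\<And>a b. \<phi> (a + b) = \<phi> a + \<phi> b" and sc: "\<And>c a. \<phi> (sc c
      a) = c * \<phi> a" "\<And>c a. \<psi> (sc c a) = c * \<psi> a"
    and jets: "jets t0 \<phi>"
    and euler: "\<And>a. \<phi> (Lie w (xpow t0 1) a) = (w + of_nat j / 2) * \<phi> a"
    and \<phi>1: "\<And>a. \<phi> (Lie w (X1 * xpow t0 1) a) + \<rho> * \<psi> (X2 * a) = 0"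
    and \<phi>2: "\<And>a. \<phi> (Lie w (X2 * xpow t0 1) a) - \<rho> * \<psi> (X1 * a) = 0"
    and \<psi>1: "\<And>a. \<psi> (Lie w (X1 * xpow t0 1) a) - \<rho> * \<phi> (X2 * a) = 0"
    and \<psi>2: "\<And>a. \<psi> (Lie w (X2 * xpow t0 1) a) + \<rho> * \<phi> (X1 * a) = 0"
    and "0 < j" and ev: "even j \<Longrightarrow> of_nat j / 4 + w \<noteq> 0" and od: "odd j
        \<Longrightarrow> ((of_nat j - 1) / 4 + w)\<^sup>2 \<noteq> \<rho>\<^sup>2"
  shows "\<phi> a = 0"
proof (rule jets_zero[OF jets add])
  have min: "\<phi> (- a) = - \<phi> a" "\<psi> (- a) = - \<psi> a" for a using sc[of "-1" a] by
      simp_all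
  have null: "\<phi> 0 = 0" "\<psi> 0 = 0" using sc[of 0 0] by simp_all
  note L = Lie_xpow[of w t0, unfolded One_nat_def]
  fix k
  show "\<phi> (X1 * (X2 * xpow t0 k)) = 0"
  proof (cases "j = 2 * Suc k")
    case True
    then have "(of_nat j / 4 :: complex) = of_nat (Suc k) / 2" by (simp add: field_simps)
    then have "of_nat (Suc k) / 2 + w \<noteq> 0" using ev True by (simp del: of_nat_Suc)
    \<comment> \<open>The test function contains X2, so the rotation term disappears by X2 X2 =
      0.\<close>
    then show ?thesis using \<phi>1[of "X2 * xpow t0 k"] by (simp add: L X_assoc null sc del:
        of_nat_Suc)
  next
    case False
    show ?thesis
      by (rule weight_zero[of "of_nat k + 1" w _ "of_nat j"])
        (use euler[of "X1 * (X2 * xpow t0 k)"] of_nat_neq[of "2 * Suc k" j] False in \<open>auto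
            simp: L sc algebra_simps\<close>)
  qed
  have X: "\<phi> (X1 * xpow t0 k) = 0 \<and> \<phi> (X2 * xpow t0 k) = 0"
  proof (cases "j = 2 * k + 1")
    case True
    let ?s = "of_nat k / 2 + w"
    have s: "?s\<^sup>2 \<noteq> \<rho>\<^sup>2" using od True by simp
    \<comment> \<open>The first and fourth relations couple \<phi> on X1 with \<psi> on X2, the
      second and third \<phi> on X2 with \<psi> on X1. Both systems have determinant s^2 -
      \<rho>^2.\<close>
    have 1: "?s * \<phi> (X1 * xpow t0 k) + \<rho> * \<psi> (X2 * xpow t0 k) = 0" using \<phi>1[of
        "xpow t0 k"] by (simp add: L sc)
    have 2: "?s * \<phi> (X2 * xpow t0 k) - \<rho> * \<psi> (X1 * xpow t0 k) = 0" using \<phi>2[of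
        "xpow t0 k"] by (simp add: L sc)
    have 3: "?s * \<psi> (X1 * xpow t0 k) - \<rho> * \<phi> (X2 * xpow t0 k) = 0" using \<psi>1[of
        "xpow t0 k"] by (simp add: L sc)
    have 4: "?s * \<psi> (X2 * xpow t0 k) + \<rho> * \<phi> (X1 * xpow t0 k) = 0" using \<psi>2[of
        "xpow t0 k"] by (simp add: L sc)
    have "\<phi> (X1 * xpow t0 k) = 0" using 1 4 s by (rule pair_zero)
    moreover have "\<phi> (X2 * xpow t0 k) = 0"
      by (rule pair_zero[of ?s _ "- \<rho>" "\<psi> (X1 * xpow t0 k)"]) (use 2 3 s in simp_all)
    ultimately show ?thesis by simp
  next
    case False
    have "\<phi> (X1 * xpow t0 k) = 0"
      by (rule weight_zero[of "of_nat k + 1/2" w _ "of_nat j"])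
        (use euler[of "X1 * xpow t0 k"] of_nat_neq[of "2 * k + 1" j] False in \<open>auto simp: L
            sc algebra_simps\<close>)
    moreover have "\<phi> (X2 * xpow t0 k) = 0"
      by (rule weight_zero[of "of_nat k + 1/2" w _ "of_nat j"])
        (use euler[of "X2 * xpow t0 k"] of_nat_neq[of "2 * k + 1" j] False in \<open>auto simp: L
            sc algebra_simps\<close>)
    ultimately show ?thesis by simp
  qed
  then show "\<phi> (X1 * xpow t0 k) = 0" "\<phi> (X2 * xpow t0 k) = 0" by auto
  show "\<phi> (xpow t0 k) = 0"
  proof (cases "j = 2 * k")
    case True
    \<comment> \<open>Positivity of j rules out the constant monomial, whose value occurs in none of
      the relations for the odd fields.\<close>
    then obtain k' where k: "k = Suc k'" using \<open>0 < j\<close> by (cases k) auto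
    have q: "(of_nat j / 4 :: complex) = of_nat (Suc k') / 2" using True k by (simp add: field_simps)
    have "even j" using True by simp
    from ev[OF this] have nz: "of_nat (Suc k') / 2 + w \<noteq> 0" unfolding q .
    \<comment> \<open>This is the rotation term in the relation for X1 (x - t0)^k'; once it
      vanishes, only the multiple of \<phi> on (x - t0)^(k' + 1) is left.\<close>
    have "\<psi> (X1 * (X2 * xpow t0 k')) = 0"
      using \<psi>1[of "X2 * xpow t0 k'"] nz by (simp add: L X_assoc null sc del: of_nat_Suc)
    then have "of_nat (Suc k') / 2 * \<phi> (xpow t0 (Suc k')) = 0"
      using \<phi>1[of "X1 * xpow t0 k'"] by (simp add: L X_assoc null sc min del: of_nat_Suc)
    then show ?thesis unfolding k by (simp del: of_nat_Suc)
  next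
    case False
    show ?thesis
      by (rule weight_zero[of "of_nat k" w _ "of_nat j"])
        (use euler[of "xpow t0 k"] of_nat_neq[of "2 * k" j] False in \<open>auto simp: L sc
            algebra_simps\<close>)
  qed
qed

text \<open>Each of the orders 1/2, 1, 3/2 and 2 has exactly two coefficients, so one notation for
  pairs serves all four.\<close>

definition pr :: "nat \<Rightarrow> ssf \<Rightarrow> ssf \<Rightarrow> op2" where
  "pr K a b = Op2 0 (if K = 1 then a else 0) (if K = 1 then b else 0) (if K = 2 then a else 0) (if
      K = 2 then b else 0)
     (if K = 3 then a else 0) (if K = 3 then b else 0) (if K = 4 then a else 0) (if K = 4 then b
         else 0)"

lemma pr_add: "add2 (pr K a b) (pr K a' b') = pr K (a + a') (b + b')"
  by (simp add: pr_def)

lemma pr_sc: "sc2 c (pr K a b) = pr K (sc c a) (sc c b)"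
  by (simp add: pr_def)

lemma top2_pr: "top2 K (pr K a b) = pr K a b"
  by (simp add: pr_def)

lemma gact_pr:
  assumes "hom_osp F" "K \<in> {1,2,3,4}"
  shows "gact lam mu F (pr K a b) =
    pr K (Lie (mu - lam - of_nat K / 2) F a - sc (if odd K then 1/2 else 0) (rot F b))
         (Lie (mu - lam - of_nat K / 2) F b + sc (if odd K then 1/2 else 0) (rot F a))"
proof -
  have h: "star F = F \<or> star F = - F" using assms(1) by (auto simp: hom_osp_def)
  show ?thesis using assms(2) by (elim insertE emptyE) (simp_all add: pr_def Lie_linear[OF h]
      coeff_op_linear)
qed

text \<open>All terms of \<open>act\<close> missing from \<open>gact\<close> are fed by coefficients
  of strictly higher order. In the uniqueness argument this makes the leading coefficient of the
  difference transform like a symbol.\<close>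

lemma act_eq_gact:
  assumes "\<And>l m n. wt l0 m0 n0 < wt l m n \<Longrightarrow> coef y l m n = 0"
  shows "coef (act lam mu F y) l0 m0 n0 = coef (gact lam mu F y) l0 m0 n0"
proof (cases y)
  case (Op2 a000 a010 a001 a100 a011 a110 a101 a200 a111)
  have r: "grad1 F 0 = 0" "grad2 F 0 = 0" "acc F 0 = 0" by (simp_all add: coeff_op_linear)
  have neg: "sc (- c) a = - sc c a" for c a by (simp add: ssf_eq_iff rep_arith)
  have z: "wt l0 m0 n0 < 2 \<Longrightarrow> a100 = 0" "wt l0 m0 n0 < 2 \<Longrightarrow> a011 = 0"
      "wt l0 m0 n0 < 1 \<Longrightarrow> a010 = 0" "wt l0 m0 n0 < 1 \<Longrightarrow> a001 = 0"
    "wt l0 m0 n0 < 3 \<Longrightarrow> a110 = 0" "wt l0 m0 n0 < 3 \<Longrightarrow> a101 = 0" "wt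
        l0 m0 n0 < 4 \<Longrightarrow> a200 = 0" "wt l0 m0 n0 < 4 \<Longrightarrow> a111 = 0"
    using assms[of 1 False False] assms[of 0 True True] assms[of 0 True False] assms[of 0 False True]
      assms[of 1 True False] assms[of 1 False True] assms[of 2 False False] assms[of 1 True True]
    by (simp_all add: Op2 wt_def)
  show ?thesis
    by (cases "l0 = 0"; cases "l0 = 1"; cases m0; cases n0; insert z; simp add: Op2 wt_def r neg)
qed

text \<open>The rotation term may stay unspecified: for the fields used below it contributes nothing
  to the evaluation at \<open>t0\<close>, because the relevant value of D1 D2 F is zero.\<close>

lemma gact_coef:
  assumes "wt l m n \<le> 4"
  shows "\<exists>\<rho> b. coef (gact lam mu F y) l m n = Lie (mu - lam - of_nat (wt l m n) / 2) F
      (coef y l m n) + sc \<rho> (rot F b)"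
proof (cases y)
  case (Op2 a000 a010 a001 a100 a011 a110 a101 a200 a111)
  have neg: "sc (- c) a = - sc c a" for c a by (simp add: ssf_eq_iff rep_arith)
  define E where "E x z \<longleftrightarrow> (\<exists>\<rho> b. x = z + sc \<rho> (rot F b))" for x z
  have r: "E z z" "E (z + sc c (rot F b)) z" "E (z - sc c (rot F b)) z" for z c b
    unfolding E_def by (rule exI[of _ 0], simp, blast, rule exI[of _ "- c"], rule exI[of _ b], simp
        add: neg)
  have "l = 0 \<or> l = 1 \<or> (l = 2 \<and> \<not> m \<and> \<not> n)"
    using assms by (auto simp: wt_def split: if_splits)
  then consider "l = 0" | "l = 1" | "l = 2" "\<not> m" "\<not> n" by blast
  then show ?thesis
    unfolding E_def[symmetric] by cases (cases m; cases n; simp add: Op2 wt_def r)+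
qed

lemma eval_mult: "rep (a * b) False False t = rep a False False t * rep b False False t"
  by transfer (simp add: smul_def)

lemma eval_D: "rep (D1 a) False False t = rep a True False t" "rep (D2 a) False False t = rep a
    False True t"
  "rep (D1 a) False True t = rep a True True t"
  by (transfer; simp add: sfun_defs)+

lemma eval_X: "rep X1 p q t = (if p \<and> \<not> q then 1 else 0)" "rep X2 p q t = (if \<not> p
    \<and> q then 1 else 0)"
  by (transfer; simp add: sfun_defs)+

lemma eval_X1_mult: "rep (X1 * a) False q t = 0" "rep (X2 * a) False False t = 0"
  by (transfer; cases q; simp add: sfun_defs)+

lemma eval_1: "rep 1 p q t = (if p \<or> q then 0 else 1)"
  by transfer (simp add: sone_def)

text \<open>For the fields x - t0 and xi_i (x - t0) the body values of F, D1 F and D2 F vanish at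
  \<open>t0\<close>; this leaves the weight term for the Euler field and nothing for the odd ones.
  For F = xi_i the term 1/2 D_i a survives and reads off the xi_i component.\<close>

lemma gact_eval:
  assumes "wt l m n \<le> 4"
  shows "rep (coef (gact lam mu (xpow t0 1) y) l m n) False False t0
      = (mu - lam - of_nat (wt l m n) / 2) * rep (coef y l m n) False False t0"
    "rep (coef (gact lam mu (X1 * xpow t0 1) y) l m n) False False t0 = 0"
    "rep (coef (gact lam mu (X2 * xpow t0 1) y) l m n) False False t0 = 0"
    "rep (coef (gact lam mu X1 y) l m n) False q t0 = 1/2 * rep (coef y l m n) True q t0"
    "rep (coef (gact lam mu X2 y) l m n) False False t0 = 1/2 * rep (coef y l m n) False True t0"
proof -
  let ?w = "mu - lam - of_nat (wt l m n) / 2"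
  let ?a = "coef y l m n"
  have e: "\<exists>\<rho> b. coef (gact lam mu F y) l m n = Lie ?w F ?a + sc \<rho> (rot F b)" for F
    using gact_coef[OF assms] .
  note f = osp_fields[of t0]
  have x0: "rep (xpow t0 1) False False t0 = 0" using eval_xpow[of 0 t0 1] by simp
  note ev = rep_arith eval_mult eval_D eval_X eval_X1_mult eval_1 x0
  obtain r b where "coef (gact lam mu (xpow t0 1) y) l m n = Lie ?w (xpow t0 1) ?a + sc r (rot
      (xpow t0 1) b)" using e by blast
  then show "rep (coef (gact lam mu (xpow t0 1) y) l m n) False False t0 = ?w * rep ?a False False t0"
    unfolding rot_def f(5) unfolding Lie_even[OF f(1)] f by (simp only: ev) simp
  obtain r b where "coef (gact lam mu (X1 * xpow t0 1) y) l m n = Lie ?w (X1 * xpow t0 1) ?a + sc r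
      (rot (X1 * xpow t0 1) b)" using e by blast
  then show "rep (coef (gact lam mu (X1 * xpow t0 1) y) l m n) False False t0 = 0"
    unfolding rot_def f(10) unfolding Lie_odd[OF f(6)] f by (simp only: ev) simp
  obtain r b where "coef (gact lam mu (X2 * xpow t0 1) y) l m n = Lie ?w (X2 * xpow t0 1) ?a + sc r
      (rot (X2 * xpow t0 1) b)" using e by blast
  then show "rep (coef (gact lam mu (X2 * xpow t0 1) y) l m n) False False t0 = 0"
    unfolding rot_def f(15) unfolding Lie_odd[OF f(11)] f by (simp only: ev) simp
  have one: "D1 (1::ssf) = 0" using body_D(1)[OF body_xpow[of t0 0]] xpow_dx[of t0 0] by (simp add:
      xpow_0)
  obtain r b where "coef (gact lam mu X1 y) l m n = Lie ?w X1 ?a + sc r (rot X1 b)" using e by blast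
  then show "rep (coef (gact lam mu X1 y) l m n) False q t0 = 1/2 * rep ?a True q t0"
    unfolding rot_def Lie_odd[OF X_simps(1)] X_simps D1_0 by (cases q) (simp_all add: ev)
  obtain r b where "coef (gact lam mu X2 y) l m n = Lie ?w X2 ?a + sc r (rot X2 b)" using e by blast
  then show "rep (coef (gact lam mu X2 y) l m n) False False t0 = 1/2 * rep ?a False True t0"
    unfolding rot_def Lie_odd[OF X_simps(2)] X_simps one by (simp_all add: ev)
qed

section \<open>Uniqueness\<close>

lemma act_sc:
  assumes "hom_osp F"
  shows "act lam mu F (sc2 c x) = sc2 c (act lam mu F x)"
proof -
  have h1: "star F = F \<or> star F = - F" using assms by (auto simp: hom_osp_def)
  have neg: "sc (- c) a = - sc c a" for c a by (simp add: ssf_eq_iff rep_arith)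
  show ?thesis by (cases x) (simp add: Lie_linear[OF h1] coeff_op_linear sc_linear mult_ac neg)
qed

text \<open>The Euler field and the odd fields are recentred at every point t, since uniqueness is
  argued at each point separately. Recentring stays inside osp(2|2).\<close>

definition basic :: "ssf set" where
  "basic = {X1, X2} \<union> (\<Union>t. {xpow t 1, X1 * xpow t 1, X2 * xpow t 1})"

lemma basic_hom: "F \<in> basic \<Longrightarrow> hom_osp F"
  using hom_osp_basic by (auto simp: basic_def)

lemma osp22_basic: assumes "F \<in> basic" shows "rep F \<in> osp22"
proof -
  have rx: "rep (xpow t 1) = (\<lambda>a b. if a \<or> b then (\<lambda>s. 0) else (\<lambda>s.
      complex_of_real s - complex_of_real t))" for t
    unfolding xpow.rep_eq by (intro ext) (simp add: xpow_fn_def)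
  have "rep (xpow t 1) \<in> osp22" for t
    unfolding osp22_def rx mem_Collect_eq
    by (rule exI[of _ "(\<lambda>_. 0)(0 := (- complex_of_real t), 1 := 1)"]) (intro ext, simp)
  moreover have "rep (X1 * xpow t 1) \<in> osp22" for t
    unfolding osp22_def times_ssf.rep_eq rx X1.rep_eq mem_Collect_eq
    by (rule exI[of _ "(\<lambda>_. 0)(4 := (- complex_of_real t), 5 := 1)"]) (intro ext, simp add:
        smul_def xi1_def xi2_def)
  moreover have "rep (X2 * xpow t 1) \<in> osp22" for t
    unfolding osp22_def times_ssf.rep_eq rx X2.rep_eq mem_Collect_eq
    by (rule exI[of _ "(\<lambda>_. 0)(6 := (- complex_of_real t), 7 := 1)"]) (intro ext, simp add:
        smul_def xi1_def xi2_def)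
  moreover have "rep X1 \<in> osp22"
    unfolding osp22_def X1.rep_eq mem_Collect_eq
    by (rule exI[of _ "(\<lambda>_. 0)(4 := 1, 5 := 0)"]) (intro ext, simp add: smul_def xi1_def
        xi2_def)
  moreover have "rep X2 \<in> osp22"
    unfolding osp22_def X2.rep_eq mem_Collect_eq
    by (rule exI[of _ "(\<lambda>_. 0)(6 := 1, 7 := 0)"]) (intro ext, simp add: smul_def xi1_def
        xi2_def)
  ultimately show ?thesis using assms unfolding basic_def Un_iff UN_iff insert_iff empty_iff
    by (elim disjE bexE FalseE; simp only:)
qed

lemma coef_pr: "coef (pr K a b) l m n = (if wt l m n = K \<and> 1 \<le> K \<and> K \<le> 4 then if
    n then b else a else 0)"
proof (cases "2 < l")
  case True
  then have "\<not> (wt l m n = K \<and> 1 \<le> K \<and> K \<le> 4)" by (auto simp: wt_def)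
  then show ?thesis unfolding coef_high[OF True] by (rule if_not_P[symmetric])
next
  case False
  then consider "l = 0" | "l = 1" | "l = 2" by linarith
  then show ?thesis
  proof cases
    case 1 then show ?thesis by (cases m; cases n) (auto simp: pr_def wt_def)
  next
    case 2 then show ?thesis by (cases m; cases n) (auto simp: pr_def wt_def)
  next
    case 3 then show ?thesis by (cases m; cases n) (auto simp: pr_def wt_def)
  qed
qed

text \<open>The alternative is uniform in a, as the jet property concerns the coefficient as a
  function of a.\<close>

lemma pr_coef:
  "(\<forall>a. coef (pr K a 0) l m n = a) \<or> (\<forall>a. coef (pr K a 0) l m n = 0)"
  "(\<forall>a. coef (pr K 0 a) l m n = a) \<or> (\<forall>a. coef (pr K 0 a) l m n = 0)"
proof -
  define c where "c \<longleftrightarrow> wt l m n = K \<and> 1 \<le> K \<and> K \<le> 4"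
  note eq = coef_pr[of K _ _ l m n, folded c_def]
  show "(\<forall>a. coef (pr K a 0) l m n = a) \<or> (\<forall>a. coef (pr K a 0) l m n = 0)"
    unfolding eq by (cases n; cases c) simp_all
  show "(\<forall>a. coef (pr K 0 a) l m n = a) \<or> (\<forall>a. coef (pr K 0 a) l m n = 0)"
    unfolding eq by (cases n; cases c) simp_all
qed

text \<open>This extracts from the definition what the uniqueness argument uses about an arbitrary
  equivariant quantization map. The differential expressions appear in the last two properties, as
  finite dependence on derivatives at a point.\<close>

lemma quantization_coordinates:
  assumes Q: "quantization Q" and eq: "equivariant lam mu Q"
  obtains q where "\<And>x. Q (dop_of x) = dop_of (q x)"
    "\<And>x y. q (add2 x y) = add2 (q x) (q y)" "\<And>c x. q (sc2 c x) = sc2 c (q x)"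
    "\<And>F x. F \<in> basic \<Longrightarrow> q (gact lam mu F x) = act lam mu F (q x)"
    "\<And>K x l m n. K \<le> 4 \<Longrightarrow> top2 K x = x \<Longrightarrow> K \<le> wt l m n
        \<Longrightarrow> coef (q x) l m n = coef (top2 K x) l m n"
    "\<And>K l m n t. jets t (\<lambda>a. rep (coef (q (pr K a 0)) l m n) False False t)"
    "\<And>K l m n t. jets t (\<lambda>a. rep (coef (q (pr K 0 a)) l m n) False False t)"
proof -
  define q where "q x = inv dop_of (Q (dop_of x))" for x
  have Dk: "Q S \<in> Dk 4" if "S \<in> Dk 4" for S
    using Q that by (auto simp: quantization_def bij_betw_def)
  have q: "Q (dop_of x) = dop_of (q x)" for x
    using Dk[OF dop_of_in_Dk[of x]] unfolding q_def Dk_4_eq by (simp add: f_inv_into_f)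
  note inj = injD[OF inj_dop_of]
  have lin: "lin_on (Dk 4) Q" using Q by (simp add: quantization_def)
  show thesis
  proof (rule that)
    show "Q (dop_of x) = dop_of (q x)" for x by (rule q)
    show "q (add2 x y) = add2 (q x) (q y)" for x y
    proof (rule inj)
      have "Q (dadd (dop_of x) (dop_of y)) = dadd (Q (dop_of x)) (Q (dop_of y))"
        using lin dop_of_in_Dk unfolding lin_on_def by blast
      then show "dop_of (q (add2 x y)) = dop_of (add2 (q x) (q y))" by (simp only: dadd_dop_of q)
    qed
    show "q (sc2 c x) = sc2 c (q x)" for c x
    proof (rule inj)
      have "Q (dsc c (dop_of x)) = dsc c (Q (dop_of x))"
        using lin dop_of_in_Dk unfolding lin_on_def by blast
      then show "dop_of (q (sc2 c x)) = dop_of (sc2 c (q x))" by (simp only: dsc_dop_of q)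
    qed
    show "q (gact lam mu F x) = act lam mu F (q x)" if "F \<in> basic" for F x
    proof (rule inj)
      have h: "hom_osp F" using that by (rule basic_hom)
      then have h': "star F = F \<or> star F = - F" "osp_sf F" by (auto simp: hom_osp_def)
      have "Q (gract lam mu (rep F) (dop_of x)) = dact lam mu (rep F) (Q (dop_of x))"
        using eq osp22_basic[OF that] h'(1) dop_of_in_Dk[of x]
        unfolding equivariant_def is_even_rep[symmetric] is_odd_rep[symmetric] by blast
      then show "dop_of (q (gact lam mu F x)) = dop_of (act lam mu F (q x))"
        by (simp only: gract_dop_of[OF h] q dact_dop_of[OF h'])
    qed
    show "coef (q x) l m n = coef (top2 K x) l m n" if "K \<le> 4" "top2 K x = x" "K \<le> wt l m
        n" for K x l m n
    proof -
      have "top K (dop_of x) = dop_of x" by (simp add: top_dop_of that)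
      with Q that(1) dop_of_in_Dk[of x] have *: "dop_of (q x) \<in> Dk K" "top K (dop_of (q x)) =
          dop_of x"
        unfolding quantization_def q[symmetric] by blast+
      show ?thesis
      proof (cases "wt l m n = K")
        case True
        have "top K (dop_of (q x)) l m n = dop_of x l m n" by (simp only: *)
        then have "dop_of (q x) l m n = dop_of x l m n" using True by (simp add: Defs.top_def)
        then show ?thesis unfolding that(2) dop_of_def fdop_def rep_inject .
      next
        case False
        with that(3) have K: "K < wt l m n" by simp
        have "coef (top2 K x) l m n = 0"
          using K by (cases x; cases m; cases n) (auto simp: wt_def)
        moreover have "dop_of (q x) l m n = szero" using *(1) K unfolding Dk_def filt_def by blast
        then have "coef (q x) l m n = 0" by (simp only: dop_of_def fdop_def rep_eq_szero)
        ultimately show ?thesis by simp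
      qed
    qed
    have "diff_expr Q" using Q by (simp add: quantization_def)
    then obtain P :: "nat \<Rightarrow> bool \<Rightarrow> bool \<Rightarrow> nat \<Rightarrow>
        bool \<Rightarrow> bool \<Rightarrow> dop" where
      P0: "(\<forall>l m n l' m' n'. valid_dop (P l m n l' m' n')) \<and> (\<forall>S\<in>Dk 4.
          \<forall>l m n. Q S l m n = (\<lambda>a b t.
           \<Sum>l'\<le>2. \<Sum>m'\<in>UNIV. \<Sum>n'\<in>UNIV. dapply (P l m n l' m' n') (S l' m'
               n') a b t))"
      unfolding diff_expr_def by (rule exE)
    have P: "valid_dop (P l m n l' m' n')" for l m n l' m' n' using conjunct1[OF P0] by simp
    note P2 = conjunct2[OF P0, THEN bspec, OF dop_of_in_Dk, rule_format]
    have val: "rep (coef (q x) l m n) False False t =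
      (\<Sum>l'\<le>2. \<Sum>m'\<in>UNIV. \<Sum>n'\<in>UNIV. dapply (P l m n l' m' n') (rep (coef x
          l' m' n')) False False t)" for x l m n t
    proof -
      have "rep (coef (q x) l m n) False False t = Q (dop_of x) l m n False False t" unfolding q by
          (simp only: dop_of_def fdop_def)
      also have "\<dots> = (\<Sum>l'\<le>2. \<Sum>m'\<in>UNIV. \<Sum>n'\<in>UNIV. dapply (P l m n
          l' m' n') (rep (coef x l' m' n')) False False t)"
        unfolding P2 by (simp only: dop_of_def fdop_def)
      finally show ?thesis .
    qed
    have j: "jets t (\<lambda>a. dapply (P l m n l' m' n') (rep (z a)) False False t)"
      if "(\<forall>a. z a = a) \<or> (\<forall>a. z a = 0)" for z l m n l' m' n' t
      using that
    proof
      assume "\<forall>a. z a = a"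
      then show ?thesis using jets_dapply[OF P] by simp
    next
      assume "\<forall>a. z a = 0"
      then show ?thesis using jets_0 by (simp add: dapply_0[OF P] szero_def)
    qed
    show "jets t (\<lambda>a. rep (coef (q (pr K a 0)) l m n) False False t)"
      "jets t (\<lambda>a. rep (coef (q (pr K 0 a)) l m n) False False t)" for K l m n t
      unfolding val by (intro jets_sum j pr_coef)+
  qed
qed

text \<open>For odd j the condition is a difference of squares, so each of the ten pairs J < K gives
  linear conditions on d, whose roots are excluded.\<close>

lemma no_resonance:
  fixes d :: complex
  assumes "d \<notin> {0, 1/2, 1, 3/2, 2}" "K \<in> {1,2,3,4}" "J < K"
  defines "\<rho> \<equiv> if odd K then 1/2 else 0" and "j \<equiv> K - J"
  shows "even j \<Longrightarrow> of_nat j / 4 + (d - of_nat K / 2) \<noteq> 0"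
    "odd j \<Longrightarrow> ((of_nat j - 1) / 4 + (d - of_nat K / 2))\<^sup>2 \<noteq> \<rho>\<^sup>2"
proof -
  have J: "J = 0 \<or> J = 1 \<or> J = 2 \<or> J = 3" using assms(2,3) by auto
  have d: "d \<noteq> 0" "d \<noteq> 1/2" "d \<noteq> 1" "d \<noteq> 3/2" "d \<noteq> 2" using
      assms(1) by auto
  have s: "x\<^sup>2 \<noteq> y\<^sup>2" if "x - y \<noteq> 0" "x + y \<noteq> 0" for x y :: complex
    using that by (auto simp: power2_eq_iff eq_neg_iff_add_eq_0)
  show "even j \<Longrightarrow> of_nat j / 4 + (d - of_nat K / 2) \<noteq> 0"
    using J assms(2,3) d unfolding j_def by (elim insertE emptyE disjE) (auto simp: field_simps)
  show "odd j \<Longrightarrow> ((of_nat j - 1) / 4 + (d - of_nat K / 2))\<^sup>2 \<noteq>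
      \<rho>\<^sup>2"
    using J assms(2,3) d unfolding j_def \<rho>_def by (elim insertE emptyE disjE; intro s) (auto
        simp: field_simps)
qed

text \<open>Induction on the bound i for the drop in order, that is, from the higher coefficients of
  the image down to the lower ones. At the order under consideration all higher coefficients vanish
  already, so \<open>act\<close> may be replaced by \<open>gact\<close>, and
  \<open>functional_zero\<close> applies to the body value at every point.\<close>

lemma equivariant_strict_zero:
  fixes N :: "op2 \<Rightarrow> op2"
  assumes d: "mu - lam \<notin> {0, 1/2, 1, 3/2, 2}"
    and add: "\<And>x y. N (add2 x y) = add2 (N x) (N y)" and sc: "\<And>c x. N (sc2 c x) = sc2 c (N x)"
    and equiv: "\<And>F x. F \<in> basic \<Longrightarrow> N (gact lam mu F x) = act lam mu F (N x)"
    and low: "\<And>K x l m n. K \<le> 4 \<Longrightarrow> top2 K x = x \<Longrightarrow> K \<le>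
        wt l m n \<Longrightarrow> coef (N x) l m n = 0"
    and jets: "\<And>K l m n t. jets t (\<lambda>a. rep (coef (N (pr K a 0)) l m n) False False t)"
      "\<And>K l m n t. jets t (\<lambda>a. rep (coef (N (pr K 0 a)) l m n) False False t)"
  shows "coef (N x) l m n = 0"
proof -
  have "coef (N (pr K a b)) l m n = 0" if K: "K \<in> {1,2,3,4}" and "K \<le> wt l m n + i" for K a
      b l m n i
    using that(2)
  proof (induction i arbitrary: a b l m n)
    case 0
    then show ?case using low[of K "pr K a b" l m n] K by (auto simp: top2_pr)
  next
    case (Suc i)
    show ?case
    proof (cases "K \<le> wt l m n + i")
      case True then show ?thesis by (rule Suc.IH)
    next
      case False
      define J where "J = wt l m n"
      define w where "w = mu - lam - of_nat K / 2"
      define \<rho> :: complex where "\<rho> = (if odd K then 1/2 else 0)"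
      have J: "J < K" "J \<le> 4" "K = J + Suc i" using False Suc.prems K by (auto simp: J_def)
      have high: "coef (N (pr K a b)) l' m' n' = 0" if "wt l m n < wt l' m' n'" for a b l' m' n'
        using that J by (intro Suc.IH) (simp add: J_def)
      have top: "coef (N (pr K (Lie w F a - sc \<rho> (rot F b)) (Lie w F b + sc \<rho> (rot F
          a)))) l m n =
          coef (gact lam mu F (N (pr K a b))) l m n" if "F \<in> basic" for F a b
        using equiv[OF that, of "pr K a b"] act_eq_gact[of l m n "N (pr K a b)" lam mu F, OF high]
        unfolding gact_pr[OF basic_hom[OF that] K] w_def[symmetric] \<rho>_def[symmetric] by simp
      note ev = gact_eval[OF J(2)[unfolded J_def]]
      have split: "N (pr K a b) = add2 (N (pr K a 0)) (N (pr K 0 b))" for a b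
        unfolding add[symmetric] pr_add by simp
      have FF: "rep (coef (N (pr K a b)) l m n) False False t = 0" for a b t
      proof -
        define \<phi> where "\<phi> a = rep (coef (N (pr K a 0)) l m n) False False t" for a
        define \<psi> where "\<psi> a = rep (coef (N (pr K 0 a)) l m n) False False t" for a
        have val: "rep (coef (N (pr K a b)) l m n) False False t = \<phi> a + \<psi> b" for a b
          unfolding split[of a b] coef_add2 rep_arith \<phi>_def \<psi>_def ..
        have linear: "\<phi> (a + b) = \<phi> a + \<phi> b" "\<psi> (a + b) = \<psi> a + \<psi> b"
            "\<phi> (sc c a) = c * \<phi> a" "\<psi> (sc c a) = c * \<psi> a" for a b c
        proof -
          have "pr K (a + b) 0 = add2 (pr K a 0) (pr K b 0)" "pr K 0 (a + b) = add2 (pr K 0 a) (pr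
              K 0 b)"
            "pr K (sc c a) 0 = sc2 c (pr K a 0)" "pr K 0 (sc c a) = sc2 c (pr K 0 a)"
            by (simp_all add: pr_add pr_sc)
          then show "\<phi> (a + b) = \<phi> a + \<phi> b" "\<psi> (a + b) = \<psi> a + \<psi> b"
              "\<phi> (sc c a) = c * \<phi> a" "\<psi> (sc c a) = c * \<psi> a"
            by (simp_all add: \<phi>_def \<psi>_def add sc coef_add2 coef_sc2 rep_arith)
        qed
        have min: "\<phi> (- a) = - \<phi> a" "\<psi> (- a) = - \<psi> a" for a using
            linear(3,4)[of "-1" a] by simp_all
        have null: "\<phi> 0 = 0" "\<psi> 0 = 0" using linear(3,4)[of 0 0] by simp_all
        have basics: "xpow t 1 \<in> basic" "X1 * xpow t 1 \<in> basic" "X2 * xpow t 1 \<in> basic"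
          by (auto simp: basic_def)
        have eqn: "\<phi> (Lie w F a - sc \<rho> (rot F b)) + \<psi> (Lie w F b + sc \<rho> (rot F a)) =
           rep (coef (gact lam mu F (N (pr K a b))) l m n) False False t" if "F \<in> basic" for F a b
          unfolding val[symmetric] top[OF that] ..
        have rot: "rot (xpow t 1) a = 0" "rot (X1 * xpow t 1) a = X2 * a" "rot (X2 * xpow t 1) a =
            - (X1 * a)" for a
          unfolding rot_def osp_fields(5,10,15) by simp_all
        have Lie0: "Lie w F 0 = 0" if "F \<in> basic" for F
          using Lie_linear(4)[of F w] basic_hom[OF that] by (auto simp: hom_osp_def)
        have w: "mu - lam - of_nat J / 2 = w + of_nat (K - J) / 2"
          using J by (simp add: w_def of_nat_diff field_simps)
        have "mu - lam - of_nat K / 2 = w" by (simp add: w_def)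
        have e1: "\<phi> (Lie w (xpow t 1) a) = (w + of_nat (K - J) / 2) * \<phi> a" for a
          using eqn[OF basics(1), of a 0] ev(1)[of lam mu t "N (pr K a 0)"]
          unfolding rot Lie0[OF basics(1)] val J_def[symmetric] w by (simp add: null)
        have e2: "\<psi> (Lie w (xpow t 1) a) = (w + of_nat (K - J) / 2) * \<psi> a" for a
          using eqn[OF basics(1), of 0 a] ev(1)[of lam mu t "N (pr K 0 a)"]
          unfolding rot Lie0[OF basics(1)] val J_def[symmetric] w by (simp add: null)
        have a1: "\<phi> (Lie w (X1 * xpow t 1) a) + \<rho> * \<psi> (X2 * a) = 0" for a
          using eqn[OF basics(2), of a 0] unfolding rot Lie0[OF basics(2)] ev(2) by (simp add: null
              linear)
        have a2: "\<phi> (Lie w (X2 * xpow t 1) a) - \<rho> * \<psi> (X1 * a) = 0" for a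
          using eqn[OF basics(3), of a 0] unfolding rot Lie0[OF basics(3)] ev(3) by (simp add: null
              linear min)
        have b1: "\<psi> (Lie w (X1 * xpow t 1) a) - \<rho> * \<phi> (X2 * a) = 0" for a
          using eqn[OF basics(2), of 0 a] unfolding rot Lie0[OF basics(2)] ev(2) by (simp add: null
              linear min)
        have b2: "\<psi> (Lie w (X2 * xpow t 1) a) + \<rho> * \<phi> (X1 * a) = 0" for a
          using eqn[OF basics(3), of 0 a] unfolding rot Lie0[OF basics(3)] ev(3) by (simp add: null
              linear min add.commute)
        have jj: "jets t \<phi>" "jets t \<psi>" unfolding \<phi>_def \<psi>_def by (rule jets)+
        note nr = no_resonance[OF d K J(1), folded w_def \<rho>_def]
        have "\<phi> a = 0" for a
          by (rule functional_zero[OF linear(1,3,4) jj(1) e1 a1 a2 b1 b2 _ nr]) (use J in simp)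
        \<comment> \<open>Exchanging the two components reverses the rotation, hence the parameter -
          \<rho>.\<close>
        moreover have "\<psi> a = 0" for a
          by (rule functional_zero[of \<psi> \<phi> t w "K - J" "- \<rho>"])
            (use linear jj(2) e2 a1 a2 b1 b2 nr J in \<open>simp_all\<close>)
        ultimately show ?thesis by (simp add: val)
      qed
      have basics: "X1 \<in> basic" "X2 \<in> basic" by (auto simp: basic_def)
      \<comment> \<open>Body values vanish for all symbols, hence also for the transformed one. For
        X1 and X2 the transformed body value is half of the next component; the last component takes
        X1 once more, applied to the vanishing of the xi2 component.\<close>
      have FF': "rep (coef (gact lam mu F (N (pr K a b))) l m n) False False t = 0" if "F \<in>
          basic" for F a b t
        unfolding top[OF that, symmetric] by (rule FF)
      have TF: "rep (coef (N (pr K a b)) l m n) True False t = 0" for a b t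
        using FF'[OF basics(1), of a b t] unfolding ev(4) by simp
      have FT: "rep (coef (N (pr K a b)) l m n) False True t = 0" for a b t
        using FF'[OF basics(2), of a b t] unfolding ev(5) by simp
      have "rep (coef (gact lam mu X1 (N (pr K a b))) l m n) False True t = 0" for a b t
        unfolding top[OF basics(1), symmetric] by (rule FT)
      then have TT: "rep (coef (N (pr K a b)) l m n) True True t = 0" for a b t
        unfolding ev(4) by simp
      have "rep (coef (N (pr K a b)) l m n) p q t = 0" for p q t
        using FF TF FT TT by (cases p; cases q) auto
      then show ?thesis by (simp add: ssf_eq_iff rep_arith)
    qed
  qed
  \<comment> \<open>The bound i = K covers all orders.\<close>
  then have pr0: "coef (N (pr K a b)) l m n = 0" if "K \<in> {1,2,3,4}" for K a b
    using that by (metis le_add2)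
  show ?thesis
  proof (cases x)
    case (Op2 a000 a010 a001 a100 a011 a110 a101 a200 a111)
    \<comment> \<open>No order lies below 0, so \<open>low\<close> with K = 0 already covers all
      coefficients.\<close>
    have z: "coef (N (Op2 a000 0 0 0 0 0 0 0 0)) l m n = 0" by (rule low[of 0]) simp_all
    have "x = add2 (Op2 a000 0 0 0 0 0 0 0 0) (add2 (pr 1 a010 a001) (add2 (pr 2 a100 a011) (add2
        (pr 3 a110 a101) (pr 4 a200 a111))))"
      by (simp add: Op2 pr_def)
    then show ?thesis by (simp add: add coef_add2 z pr0)
  qed
qed

lemma equivariant_quantization_unique:
  assumes d: "mu - lam \<notin> {0, 1/2, 1, 3/2, 2}"
    and Q: "quantization Q" "equivariant lam mu Q" and Q': "quantization Q'" "equivariant lam mu Q'"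
    and S: "S \<in> Dk 4"
  shows "Q' S = Q S"
proof -
  obtain q where q: "\<And>x. Q (dop_of x) = dop_of (q x)"
    "\<And>x y. q (add2 x y) = add2 (q x) (q y)" "\<And>c x. q (sc2 c x) = sc2 c (q x)"
    "\<And>F x. F \<in> basic \<Longrightarrow> q (gact lam mu F x) = act lam mu F (q x)"
    "\<And>K x l m n. K \<le> 4 \<Longrightarrow> top2 K x = x \<Longrightarrow> K \<le> wt l m n
        \<Longrightarrow> coef (q x) l m n = coef (top2 K x) l m n"
    "\<And>K l m n t. jets t (\<lambda>a. rep (coef (q (pr K a 0)) l m n) False False t)"
    "\<And>K l m n t. jets t (\<lambda>a. rep (coef (q (pr K 0 a)) l m n) False False t)"
    using quantization_coordinates[OF Q] by blast
  obtain q' where q': "\<And>x. Q' (dop_of x) = dop_of (q' x)"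
    "\<And>x y. q' (add2 x y) = add2 (q' x) (q' y)" "\<And>c x. q' (sc2 c x) = sc2 c (q' x)"
    "\<And>F x. F \<in> basic \<Longrightarrow> q' (gact lam mu F x) = act lam mu F (q' x)"
    "\<And>K x l m n. K \<le> 4 \<Longrightarrow> top2 K x = x \<Longrightarrow> K \<le> wt l m n
        \<Longrightarrow> coef (q' x) l m n = coef (top2 K x) l m n"
    "\<And>K l m n t. jets t (\<lambda>a. rep (coef (q' (pr K a 0)) l m n) False False t)"
    "\<And>K l m n t. jets t (\<lambda>a. rep (coef (q' (pr K 0 a)) l m n) False False t)"
    using quantization_coordinates[OF Q'] by blast
  \<comment> \<open>Subtraction is expressed through \<open>add2\<close> and \<open>sc2\<close>, for
    which linearity and equivariance are available.\<close>
  define N where "N x = add2 (q x) (sc2 (- 1) (q' x))" for x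
  have coefN: "coef (N x) l m n = coef (q x) l m n - coef (q' x) l m n" for x l m n
    by (simp add: N_def coef_add2 coef_sc2)
  have ac: "add2 (add2 a b) (add2 a' b') = add2 (add2 a a') (add2 b b')" for a b a' b'
    by (cases a; cases b; cases a'; cases b') (simp add: add_ac)
  have sca: "sc2 c (add2 a b) = add2 (sc2 c a) (sc2 c b)" for c a b
    by (cases a; cases b) (simp add: sc_add)
  have scc: "sc2 c (sc2 c' a) = sc2 c' (sc2 c a)" for c c' a
    by (cases a) (simp add: mult.commute)
  have "coef (N x) l m n = 0" for x l m n
  proof (rule equivariant_strict_zero[where N = N, OF d])
    show "N (add2 x y) = add2 (N x) (N y)" for x y by (simp only: N_def q(2) q'(2) sca ac)
    show "N (sc2 c x) = sc2 c (N x)" for c x unfolding N_def q(3) q'(3) sca scc[of "-1"] ..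
    show "N (gact lam mu F x) = act lam mu F (N x)" if "F \<in> basic" for F x
      using basic_hom[OF that] by (simp only: N_def q(4)[OF that] q'(4)[OF that] act_add act_sc)
    show "coef (N x) l m n = 0" if "K \<le> 4" "top2 K x = x" "K \<le> wt l m n" for K x l m n
      unfolding coefN q(5)[OF that] q'(5)[OF that] by simp
    show "jets t (\<lambda>a. rep (coef (N (pr K a 0)) l m n) False False t)"
      "jets t (\<lambda>a. rep (coef (N (pr K 0 a)) l m n) False False t)" for K l m n t
      unfolding coefN rep_arith by (intro jets_diff q q')+
  qed
  then have "q x = q' x" for x
    by (intro coef_inject ext) (simp add: coefN)
  moreover obtain x where "S = dop_of x" using S by (rule Dk_dop_of)
  ultimately show ?thesis by (simp add: q(1) q'(1))
qed

theorem theorem1p1: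
  fixes lam mu :: complex
  assumes "mu - lam \<notin> {0, 1/2, 1, 3/2, 2}"
  shows "(\<exists>Phi. module_iso lam mu Phi) \<and>
         (\<exists>Q. quantization Q \<and> equivariant lam mu Q \<and>
              (\<forall>Q'. quantization Q' \<and> equivariant lam mu Q' \<longrightarrow>
                  (\<forall>S\<in>Dk 4. Q' S = Q S)))"
proof
  let ?Q = "Qmap lam (mu - lam)"
  have Q: "quantization ?Q" "equivariant lam mu ?Q"
    using quantization_Qmap equivariant_Qmap[OF assms] by auto
  \<comment> \<open>Quantization maps are linear and bijective by definition, so the equivariant one
    is also the isomorphism of part (i).\<close>
  then have "module_iso lam mu ?Q"
    by (simp add: module_iso_def quantization_def)
  then show "\<exists>Phi. module_iso lam mu Phi" by blast
  show "\<exists>Q. quantization Q \<and> equivariant lam mu Q \<and>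
      (\<forall>Q'. quantization Q' \<and> equivariant lam mu Q' \<longrightarrow>
          (\<forall>S\<in>Dk 4. Q' S = Q S))"
    using Q equivariant_quantization_unique[OF assms Q] by blast
qed

end
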